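(* Let $p>5$ be a prime, $q=p^h$, and let $\mathcal{F}$ be the projective closure of the affine curve $ax^n+by^m=1$ defined over $\mathbb{F}_q$, where $a,b\in\mathbb{F}_q^*$ and $m,n$ are positive integers with $n\ge m>2$ and $p\nmid mn$. Suppose $\mathcal{F}$ is classical with respect to lines ($\Sigma_1$). Then $\mathcal{F}$ is $\mathbb{F}_q$-Frobenius nonclassical with respect to conics ($\Sigma_2$) if and only if one of the following holds: (a) $p\mid(n-2)$ and $m=n=\frac{2(q-1)}{p^r-1}$ for some $r<h$ with $r\mid h$, and $a,b\in\mathbb{F}_{p^r}$; (b) $p\mid(2n-1)$ and $m=n=\frac{q-1}{2(p^r-1)}$ for some $r<h$ with $r\mid h$, and $a^2,b^2\in\mathbb{F}_{p^r}$; (c) $p\mid(n+1)$, $q=n+1=m+1$ and $a+b=1$; (d) $p\mid(n-1)$ and $n=2m=\frac{q-1}{p^r-1}$ for some $r<h$ with $r\mid h$, and either $a,b\in\mathbb{F}_{p^r}$, or $2r\mid h$, $a\in\mathbb{F}_{p^r}$, $b\in\mathbb{F}_{p^{2r}}$ with $b^{p^r}=-b$; (e) $p\mid(n-2)$ and $n=2m=\frac{2(q-1)}{p^r-1}$ for some $r<h$ with $r\mid h$, and $a,b\in\mathbb{F}_{p^r}$.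
   Context: For a geometrically irreducible projective plane curve $\mathcal{F}$ over $\mathbb{F}_q$ with function field $\overline{\mathbb{F}}_q(x,y)$ and $s\ge1$, let $\Sigma_s$ be the linear system of plane curves of degree $s$, $M=\binom{s+2}{2}-1$, and $\varphi_0,\dots,\varphi_M$ the monomials of degree $s$ in $x,y,1$. With $\tau$ a separating element and $D^{(k)}_\tau$ Hasse derivatives, the order sequence $\varepsilon_0<\dots<\varepsilon_M$ is the lexicographically smallest sequence with $\det(D_\tau^{(\varepsilon_i)}\varphi_j)\ne0$; $\mathcal{F}$ is classical w.r.t. $\Sigma_s$ if $\varepsilon_i=i$ for all $i$. The $\mathbb{F}_q$-Frobenius order sequence $\nu_0<\dots<\nu_{M-1}$ is the lexicographically smallest sequence such that the $(M+1)\times(M+1)$ determinant with first row $(\varphi_0^q,\dots,\varphi_M^q)$ and further rows $(D^{(\nu_i)}_\tau\varphi_0,\dots,D^{(\nu_i)}_\tau\varphi_M)$, $i=0,\dots,M-1$, is nonzero; $\mathcal{F}$ is $\mathbb{F}_q$-Frobenius classical w.r.t. $\Sigma_s$ if $\nu_i=i$ for all $i$, and $\mathbb{F}_q$-Frobenius nonclassical otherwise. $\Sigma_1$ = lines, $\Sigma_2$ = conics. *)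

theory Defs
  imports "HOL-Computational_Algebra.Polynomial" "Jordan_Normal_Form.Determinant"
begin

definition alg_closed_field :: "'k::field itself \<Rightarrow> bool" where
  "alg_closed_field _ \<longleftrightarrow> (\<forall>P::'k poly. degree P > 0 \<longrightarrow> (\<exists>z. poly P z = 0))"

definition is_alg_closure_Fp :: "nat \<Rightarrow> 'k::field itself \<Rightarrow> bool" where
  "is_alg_closure_Fp p T \<longleftrightarrow> prime p \<and> of_nat p = (0::'k) \<and> alg_closed_field T \<and>
     (\<forall>z::'k. \<exists>e>0. z ^ (p ^ e) = z)"

definition is_subfield :: "'f::field set \<Rightarrow> bool" where
  "is_subfield S \<longleftrightarrow> 0 \<in> S \<and> 1 \<in> S \<and> (\<forall>u\<in>S. \<forall>v\<in>S. u + v \<in> S \<and> u * v \<in> S)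
     \<and> (\<forall>u\<in>S. - u \<in> S \<and> inverse u \<in> S)"

definition is_curve_function_field ::
  "('k::field \<Rightarrow> 'f::field) \<Rightarrow> 'f \<Rightarrow> 'f \<Rightarrow> 'k \<Rightarrow> 'k \<Rightarrow> nat \<Rightarrow> nat \<Rightarrow> bool" where
  "is_curve_function_field \<iota> x y a b n m \<longleftrightarrow>
     \<iota> 0 = 0 \<and> \<iota> 1 = 1 \<and> (\<forall>u v. \<iota> (u + v) = \<iota> u + \<iota> v \<and> \<iota> (u * v) = \<iota> u * \<iota> v)
     \<and> \<iota> a * x ^ n + \<iota> b * y ^ m = 1
     \<and> (\<forall>P::'k poly. P \<noteq> 0 \<longrightarrow> poly (map_poly \<iota> P) x \<noteq> 0)
     \<and> (\<forall>S. is_subfield S \<and> range \<iota> \<subseteq> S \<and> x \<in> S \<and> y \<in> S \<longrightarrow> S = UNIV)"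

definition is_hasse_system :: "('k \<Rightarrow> 'f::field) \<Rightarrow> 'f \<Rightarrow> (nat \<Rightarrow> 'f \<Rightarrow> 'f) \<Rightarrow> bool" where
  "is_hasse_system \<iota> t D \<longleftrightarrow>
     (\<forall>f. D 0 f = f)
     \<and> (\<forall>k f g. D k (f + g) = D k f + D k g)
     \<and> (\<forall>k f g. D k (f * g) = (\<Sum>i\<le>k. D i f * D (k - i) g))
     \<and> (\<forall>k c. k > 0 \<longrightarrow> D k (\<iota> c) = 0)
     \<and> D 1 t = 1 \<and> (\<forall>k\<ge>2. D k t = 0)"

definition hasse :: "('k \<Rightarrow> 'f::field) \<Rightarrow> 'f \<Rightarrow> nat \<Rightarrow> 'f \<Rightarrow> 'f" where
  "hasse \<iota> t = (THE D. is_hasse_system \<iota> t D)"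

(* exponent pairs (i,j) of the monomials x^i y^j of degree <= s, i.e. the monomials of
   degree s in x, y, 1 *)
definition mon_exps :: "nat \<Rightarrow> (nat \<times> nat) list" where
  "mon_exps s = [(i, k - i). k \<leftarrow> [0..<Suc s], i \<leftarrow> [0..<Suc k]]"

definition phi :: "'f::field \<Rightarrow> 'f \<Rightarrow> nat \<Rightarrow> nat \<Rightarrow> 'f" where
  "phi x y s j = x ^ fst (mon_exps s ! j) * y ^ snd (mon_exps s ! j)"

definition strict_inc :: "nat list \<Rightarrow> bool" where
  "strict_inc l \<longleftrightarrow> sorted_wrt (<) l"

definition lex_less :: "nat list \<Rightarrow> nat list \<Rightarrow> bool" where
  "lex_less l l' \<longleftrightarrow> (\<exists>i<length l. take i l = take i l' \<and> l ! i < l' ! i)"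

definition wr_det :: "(nat \<Rightarrow> 'f::field \<Rightarrow> 'f) \<Rightarrow> 'f \<Rightarrow> 'f \<Rightarrow> nat \<Rightarrow> nat list \<Rightarrow> 'f" where
  "wr_det D x y s eps = det (mat (length (mon_exps s)) (length (mon_exps s))
       (\<lambda>(i, j). D (eps ! i) (phi x y s j)))"

definition frob_det :: "(nat \<Rightarrow> 'f::field \<Rightarrow> 'f) \<Rightarrow> nat \<Rightarrow> 'f \<Rightarrow> 'f \<Rightarrow> nat \<Rightarrow> nat list \<Rightarrow> 'f" where
  "frob_det D q x y s nu = det (mat (length (mon_exps s)) (length (mon_exps s))
       (\<lambda>(i, j). if i = 0 then (phi x y s j) ^ q else D (nu ! (i - 1)) (phi x y s j)))"

definition is_order_seq :: "(nat \<Rightarrow> 'f::field \<Rightarrow> 'f) \<Rightarrow> 'f \<Rightarrow> 'f \<Rightarrow> nat \<Rightarrow> nat list \<Rightarrow> bool" where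
  "is_order_seq D x y s eps \<longleftrightarrow>
     length eps = length (mon_exps s) \<and> strict_inc eps \<and> wr_det D x y s eps \<noteq> 0 \<and>
     (\<forall>e. length e = length (mon_exps s) \<and> strict_inc e \<and> wr_det D x y s e \<noteq> 0 \<and> e \<noteq> eps
          \<longrightarrow> lex_less eps e)"

definition is_frob_order_seq :: "(nat \<Rightarrow> 'f::field \<Rightarrow> 'f) \<Rightarrow> nat \<Rightarrow> 'f \<Rightarrow> 'f \<Rightarrow> nat \<Rightarrow> nat list \<Rightarrow> bool" where
  "is_frob_order_seq D q x y s nu \<longleftrightarrow>
     length nu = length (mon_exps s) - 1 \<and> strict_inc nu \<and> frob_det D q x y s nu \<noteq> 0 \<and>
     (\<forall>e. length e = length (mon_exps s) - 1 \<and> strict_inc e \<and> frob_det D q x y s e \<noteq> 0 \<and> e \<noteq> nu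
          \<longrightarrow> lex_less nu e)"

definition classical_wrt :: "(nat \<Rightarrow> 'f::field \<Rightarrow> 'f) \<Rightarrow> 'f \<Rightarrow> 'f \<Rightarrow> nat \<Rightarrow> bool" where
  "classical_wrt D x y s \<longleftrightarrow> is_order_seq D x y s [0..<length (mon_exps s)]"

definition frob_nonclassical_wrt :: "(nat \<Rightarrow> 'f::field \<Rightarrow> 'f) \<Rightarrow> nat \<Rightarrow> 'f \<Rightarrow> 'f \<Rightarrow> nat \<Rightarrow> bool" where
  "frob_nonclassical_wrt D q x y s \<longleftrightarrow>
     (\<exists>nu. is_frob_order_seq D q x y s nu \<and> nu \<noteq> [0..<length (mon_exps s) - 1])"

definition in_Fpr :: "nat \<Rightarrow> nat \<Rightarrow> 'k::field \<Rightarrow> bool" where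
  "in_Fpr p r z \<longleftrightarrow> z ^ (p ^ r) = z"

end

theory Submission
  imports Defs "Jordan_Normal_Form.Char_Poly" "HOL-Computational_Algebra.Computational_Algebra"
begin

text \<open>Expanding along \<open>x \<mapsto> x + T\<close> embeds the function field into power series and realises the
Hasse derivatives. The curve is Frobenius nonclassical for conics iff the conic osculating it at the
generic point passes through the image of that point under the Frobenius map. Since \<open>x ^ q\<close> and
\<open>y ^ q\<close> are constants for the derivation, differentiating this incidence yields Monge's equation
for conics. With \<open>w = a x ^ n / (b y ^ m)\<close> that equation is a polynomial identity in a transcendental,
and its values at \<open>w = 0, - 1\<close> and infinity leave nine residue classes of \<open>(n, m)\<close> modulo \<open>p\<close>. In each
of them the osculating conic is explicit, because \<open>p\<close>-th powers are constants of the derivation, and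
the incidence becomes an identity between monomials on the curve, which is solved by specialising to
points over the algebraically closed constant field.\<close>

section \<open>Powers of a radical over a polynomial ring\<close>

text \<open>The function field is given abstractly, by the relation between \<open>x\<close> and
  \<open>y\<close>, the transcendence of \<open>x\<close> and generation, so irreducibility of the
  curve has to be derived. The source is a simple root of \<open>F\<close>, where
  \<open>y ^ m\<close> is \<open>F\<close> evaluated at \<open>x\<close>: there Y^m - F is
  Eisenstein, and every polynomial relation between \<open>x\<close> and \<open>y\<close> is a
  multiple of it. This makes the Taylor expansion well defined and carries identities from the
  function field to points; the same argument over power series rules out a conic of infinite
  contact. The equation of Monge is only a necessary condition and sees \<open>n\<close> and
  \<open>m\<close> only modulo \<open>p\<close>. The size of the exponents and the fields containing
  \<open>a\<close> and \<open>b\<close> must come from the incidence itself, which can be written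
  down only once the residues are known. The values w = 0, infinity and - 1 belong to the points of
  the curve on x = 0, on y = 0 and at infinity. The bound \<open>p > 5\<close> keeps the numbers 1
  to 5, which appear as derivatives up to order five are taken, invertible.\<close>

definition eval_at :: "('a::comm_ring_1 \<Rightarrow> 'b::comm_ring_1) \<Rightarrow> 'b \<Rightarrow> 'a poly \<Rightarrow> 'b" where
  "eval_at i X P = poly (map_poly i P) X"

lemma comm_ring_hom_eval_at:
  assumes "comm_ring_hom i"
  shows "comm_ring_hom (eval_at i X)"
proof -
  interpret i: comm_ring_hom i by fact
  interpret m: map_poly_comm_ring_hom i ..
  show ?thesis by unfold_locales (auto simp: eval_at_def hom_distribs)
qed

lemma eval_at_pCons:
  assumes "comm_ring_hom i"
  shows "eval_at i X (pCons c P) = i c + X * eval_at i X P"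
proof -
  interpret i: comm_ring_hom i by fact
  show ?thesis by (simp add: eval_at_def hom_distribs)
qed

lemma eval_at_0 [simp]: "eval_at i X 0 = 0"
  by (simp add: eval_at_def)

lemma eval_at_smult:
  assumes "comm_ring_hom i"
  shows "eval_at i X (smult c P) = i c * eval_at i X P"
proof -
  interpret i: comm_ring_hom i by fact
  show ?thesis by (simp add: eval_at_def hom_distribs)
qed

lemma eval_at_const [simp]: "eval_at i X [:c:] = i c" if "comm_ring_hom i"
  by (simp add: eval_at_pCons that)

lemma eval_at_monom [simp]: "eval_at i X (monom c k) = i c * X ^ k" if "comm_ring_hom i"
proof -
  interpret i: comm_ring_hom i by fact
  show ?thesis by (simp add: eval_at_def poly_monom)
qed

text \<open>Iterated \<open>eval_at\<close> evaluates bivariate polynomials at (\<open>x\<close>,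
  \<open>y\<close>), at their translates and at points. This rule lets the constant-coefficient map
  and the homomorphism built from a Hasse system pass through such evaluations.\<close>

lemma hom_eval_at:
  assumes "comm_ring_hom i" and "comm_ring_hom h"
  shows "h (eval_at i X P) = eval_at (h \<circ> i) (h X) P"
proof -
  interpret i: comm_ring_hom i by fact
  interpret h: comm_ring_hom h by fact
  have hi: "comm_ring_hom (h \<circ> i)" by unfold_locales (auto simp: hom_distribs)
  note hi' = eval_at_pCons[OF hi, unfolded comp_def]
  show ?thesis by (induction P) (simp_all add: eval_at_pCons[OF assms(1)] hi' hom_distribs comp_def)
qed

lemma eval_at_sum:
  assumes "comm_ring_hom i"
  shows "eval_at i X P = (\<Sum>j\<le>degree P. i (coeff P j) * X ^ j)"
proof -
  interpret i: comm_ring_hom i by fact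
  interpret e: comm_ring_hom "eval_at i X" by (rule comm_ring_hom_eval_at) fact
  have "eval_at i X P = eval_at i X (\<Sum>j\<le>degree P. monom (coeff P j) j)"
    by (simp add: poly_as_sum_of_monoms)
  also have "\<dots> = (\<Sum>j\<le>degree P. i (coeff P j) * X ^ j)"
    by (simp add: hom_distribs assms)
  finally show ?thesis .
qed

text \<open>Multiplication by \<open>\<Sum>j. A j * Y ^ j\<close> on the powers of \<open>Y\<close> is a matrix over the polynomial ring
  that is upper triangular with constant diagonal at the root \<open>\<rho>\<close> of \<open>f\<close>, where \<open>Y ^ m = f\<close>.\<close>
lemma radical_relation_root:
  fixes i :: "'a::field \<Rightarrow> 'b::idom"
  assumes i: "comm_ring_hom i"
    and tr: "\<And>P. P \<noteq> 0 \<Longrightarrow> eval_at i X P \<noteq> 0"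
    and Y: "Y ^ m = eval_at i X f" and f: "poly f \<rho> = 0" and m: "m > 0"
    and rel: "(\<Sum>j<m. eval_at i X (A j) * Y ^ j) = 0"
  shows "poly (A 0) \<rho> = 0"
proof -
  let ?e = "eval_at i X"
  interpret e: comm_ring_hom ?e by (rule comm_ring_hom_eval_at) fact
  \<comment> \<open>Row \<open>r\<close> holds the coefficients of Y^r times the relation; an
    exponent s + m is reduced by Y^m = f, which puts the factor \<open>f\<close> below the diagonal.
    The powers of \<open>Y\<close> therefore form a kernel vector.\<close>
  define M where "M = mat m m (\<lambda>(r, s). if r \<le> s then A (s - r) else f * A (s + m - r))"
  have M: "M \<in> carrier_mat m m" by (simp add: M_def)
  define v where "v = vec m (\<lambda>s. Y ^ s)"
  have "map_mat ?e M *\<^sub>v v = 0\<^sub>v m"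
  proof (rule eq_vecI)
    fix r assume "r < dim_vec (0\<^sub>v m :: 'b vec)"
    hence r: "r < m" by simp
    have "(map_mat ?e M *\<^sub>v v) $ r = (\<Sum>s<m. ?e (M $$ (r, s)) * Y ^ s)"
      using r M by (simp add: scalar_prod_def v_def atLeast0LessThan)
    also have "\<dots> = (\<Sum>s\<in>{r..<m}. ?e (A (s - r)) * Y ^ s) + (\<Sum>s<r. ?e (A (s + m - r)) * Y ^ (s + m))"
    proof -
      have "{..<m} = {r..<m} \<union> {..<r}" using r by auto
      hence "(\<Sum>s<m. ?e (M $$ (r, s)) * Y ^ s) =
        (\<Sum>s\<in>{r..<m}. ?e (M $$ (r, s)) * Y ^ s) + (\<Sum>s<r. ?e (M $$ (r, s)) * Y ^ s)"
        by (simp add: sum.union_disjoint Int_def)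
      moreover have "(\<Sum>s\<in>{r..<m}. ?e (M $$ (r, s)) * Y ^ s) = (\<Sum>s\<in>{r..<m}. ?e (A (s - r)) * Y ^ s)"
        using r by (intro sum.cong) (auto simp: M_def)
      moreover have "(\<Sum>s<r. ?e (M $$ (r, s)) * Y ^ s) = (\<Sum>s<r. ?e (A (s + m - r)) * Y ^ (s + m))"
        using r by (intro sum.cong) (auto simp: M_def hom_distribs Y power_add algebra_simps)
      ultimately show ?thesis by simp
    qed
    also have "(\<Sum>s\<in>{r..<m}. ?e (A (s - r)) * Y ^ s) = (\<Sum>j<m - r. ?e (A j) * Y ^ (j + r))"
      using r by (intro sum.reindex_bij_witness[of _ "\<lambda>j. j + r" "\<lambda>s. s - r"]) auto
    also have "(\<Sum>s<r. ?e (A (s + m - r)) * Y ^ (s + m)) = (\<Sum>j\<in>{m - r..<m}. ?e (A j) * Y ^ (j + r))"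
      using r by (intro sum.reindex_bij_witness[of _ "\<lambda>j. j + r - m" "\<lambda>s. s + m - r"]) auto
    also have "(\<Sum>j<m - r. ?e (A j) * Y ^ (j + r)) + (\<Sum>j\<in>{m - r..<m}. ?e (A j) * Y ^ (j + r))
        = (\<Sum>j<m. ?e (A j) * Y ^ (j + r))"
    proof -
      have "{..<m} = {..<m - r} \<union> {m - r..<m}" using r by auto
      thus ?thesis by (simp add: sum.union_disjoint Int_def)
    qed
    also have "\<dots> = Y ^ r * (\<Sum>j<m. ?e (A j) * Y ^ j)"
      by (simp add: sum_distrib_left power_add algebra_simps)
    finally show "(map_mat ?e M *\<^sub>v v) $ r = 0\<^sub>v m $ r" using rel r by simp
  qed (use M in auto)
  moreover have "v \<noteq> 0\<^sub>v m"
  proof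
    assume "v = 0\<^sub>v m"
    hence "v $ 0 = 0\<^sub>v m $ 0" by simp
    thus False using m by (simp add: v_def)
  qed
  ultimately have "det (map_mat ?e M) = 0"
    using M by (subst det_0_iff_vec_prod_zero[of _ m]) (auto simp: v_def intro!: exI[of _ v])
  hence "?e (det M) = 0" by (simp add: e.hom_det)
  hence "det M = 0" using tr by blast
  have p: "comm_ring_hom (\<lambda>P. poly P \<rho>)" by unfold_locales auto
  have "det (map_mat (\<lambda>P. poly P \<rho>) M) = 0" using \<open>det M = 0\<close> by (simp add: comm_ring_hom.hom_det[OF p])
  moreover have "det (map_mat (\<lambda>P. poly P \<rho>) M) = prod_list (diag_mat (map_mat (\<lambda>P. poly P \<rho>) M))"
    by (rule det_upper_triangular[of _ m]) (auto simp: M_def upper_triangular_def f)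
  moreover have "diag_mat (map_mat (\<lambda>P. poly P \<rho>) M) = map (\<lambda>_. poly (A 0) \<rho>) [0..<m]"
    by (auto simp: diag_mat_def M_def)
  ultimately show ?thesis by (simp add: map_replicate_const prod_list_replicate)
qed

text \<open>The Eisenstein argument at the simple root. Once the coefficients before
  \<open>k\<close> are divisible by T - \<rho>, multiplying the relation by Y^(m - k) makes every
  term divisible: the later ones acquire the factor f = (T - \<rho>) g. After division the constant
  coefficient is g * A k, and g does not vanish at \<rho>.\<close>

lemma radical_relation_roots:
  fixes i :: "'a::field \<Rightarrow> 'b::idom"
  assumes i: "comm_ring_hom i"
    and tr: "\<And>P. P \<noteq> 0 \<Longrightarrow> eval_at i X P \<noteq> 0"
    and Y: "Y ^ m = eval_at i X f" and f: "f = [:-\<rho>, 1:] * g" "poly g \<rho> \<noteq> 0"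
    and rel: "(\<Sum>j<m. eval_at i X (A j) * Y ^ j) = 0"
    and "j < m"
  shows "poly (A j) \<rho> = 0"
  using \<open>j < m\<close>
proof (induction j rule: less_induct)
  case (less k)
  let ?e = "eval_at i X"
  interpret e: comm_ring_hom ?e by (rule comm_ring_hom_eval_at) fact
  define \<pi> :: "'a poly" where "\<pi> = [:-\<rho>, 1:]"
  have f': "f = \<pi> * g" and pi0: "?e \<pi> \<noteq> 0" using f tr by (auto simp: \<pi>_def)
  have "\<forall>l<k. \<exists>B. A l = \<pi> * B" using less by (auto simp: poly_eq_0_iff_dvd dvd_def \<pi>_def)
  then obtain B where B: "\<And>l. l < k \<Longrightarrow> A l = \<pi> * B l" by metis
  \<comment> \<open>The coefficients of the relation multiplied by Y^(m - k) and divided by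
    \<open>\<pi>\<close>; the terms with j < k move to the top positions.\<close>
  define C where "C = (\<lambda>s. if s < m - k then g * A (s + k) else B (s - (m - k)))"
  have "?e \<pi> * (\<Sum>s<m. ?e (C s) * Y ^ s) = (\<Sum>j<m. ?e (A j) * Y ^ (j + (m - k)))"
  proof -
    have "{..<m} = {..<m - k} \<union> {m - k..<m}" using less by auto
    hence "?e \<pi> * (\<Sum>s<m. ?e (C s) * Y ^ s) =
       (\<Sum>s<m - k. ?e \<pi> * (?e (C s) * Y ^ s)) + (\<Sum>s\<in>{m - k..<m}. ?e \<pi> * (?e (C s) * Y ^ s))"
      by (simp add: sum.union_disjoint Int_def sum_distrib_left distrib_left)
    also have "(\<Sum>s<m - k. ?e \<pi> * (?e (C s) * Y ^ s)) = (\<Sum>s<m - k. ?e (A (s + k)) * Y ^ (s + m))"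
      by (intro sum.cong refl) (auto simp: C_def power_add Y f' hom_distribs algebra_simps)
    also have "\<dots> = (\<Sum>j\<in>{k..<m}. ?e (A j) * Y ^ (j + (m - k)))"
      using less by (intro sum.reindex_bij_witness[of _ "\<lambda>j. j - k" "\<lambda>s. s + k"]) auto
    also have "(\<Sum>s\<in>{m - k..<m}. ?e \<pi> * (?e (C s) * Y ^ s)) =
      (\<Sum>s\<in>{m - k..<m}. ?e (A (s - (m - k))) * Y ^ s)"
      by (intro sum.cong refl) (use less in \<open>auto simp: C_def B hom_distribs algebra_simps\<close>)
    also have "\<dots> = (\<Sum>j<k. ?e (A j) * Y ^ (j + (m - k)))"
      using less by (intro sum.reindex_bij_witness[of _ "\<lambda>j. j + (m - k)" "\<lambda>s. s - (m - k)"]) auto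
    also have "(\<Sum>j\<in>{k..<m}. ?e (A j) * Y ^ (j + (m - k))) + \<dots> = (\<Sum>j<m. ?e (A j) * Y ^ (j + (m - k)))"
    proof -
      have "{..<m} = {k..<m} \<union> {..<k}" using less by auto
      thus ?thesis by (simp add: sum.union_disjoint Int_def)
    qed
    finally show ?thesis .
  qed
  also have "\<dots> = Y ^ (m - k) * (\<Sum>j<m. ?e (A j) * Y ^ j)"
    by (simp add: sum_distrib_left power_add algebra_simps)
  finally have "(\<Sum>s<m. ?e (C s) * Y ^ s) = 0" using pi0 by (simp add: rel)
  hence "poly (C 0) \<rho> = 0"
    using less f by (intro radical_relation_root[OF i tr Y, of \<rho> C]) auto
  thus ?case using less f by (simp add: C_def)
qed

text \<open>Infinite descent on the total degree: all coefficients of a relation are divisible by T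
  - \<rho>, and dividing by it gives a smaller relation.\<close>

lemma radical_powers_independent:
  fixes i :: "'a::field \<Rightarrow> 'b::idom"
  assumes i: "comm_ring_hom i"
    and tr: "\<And>P. P \<noteq> 0 \<Longrightarrow> eval_at i X P \<noteq> 0"
    and Y: "Y ^ m = eval_at i X f" and f: "f = [:-\<rho>, 1:] * g" "poly g \<rho> \<noteq> 0"
    and rel: "(\<Sum>j<m. eval_at i X (A j) * Y ^ j) = 0"
  shows "\<forall>j<m. A j = 0"
  using rel
proof (induction "\<Sum>j<m. degree (A j)" arbitrary: A rule: less_induct)
  case less
  let ?e = "eval_at i X"
  interpret e: comm_ring_hom ?e by (rule comm_ring_hom_eval_at) fact
  define \<pi> :: "'a poly" where "\<pi> = [:-\<rho>, 1:]"
  have f': "f = \<pi> * g" and pi0: "?e \<pi> \<noteq> 0" using f tr by (auto simp: \<pi>_def)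
  show ?case
  proof (rule ccontr)
    assume "\<not> ?case"
    then obtain k where k: "k < m" "A k \<noteq> 0" by auto
    have "\<forall>j<m. \<exists>B. A j = \<pi> * B"
      using radical_relation_roots[OF i tr Y f less.prems] by (auto simp: poly_eq_0_iff_dvd dvd_def \<pi>_def)
    then obtain B where B: "\<And>j. j < m \<Longrightarrow> A j = \<pi> * B j" by metis
    have "?e \<pi> * (\<Sum>j<m. ?e (B j) * Y ^ j) = (\<Sum>j<m. ?e (A j) * Y ^ j)"
      unfolding sum_distrib_left by (intro sum.cong refl) (auto simp: B hom_distribs algebra_simps)
    hence relB: "(\<Sum>j<m. ?e (B j) * Y ^ j) = 0" using less.prems pi0 by simp
    have deg: "B j \<noteq> 0 \<Longrightarrow> degree (A j) = Suc (degree (B j))" if "j < m" for j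
      using B[OF that] degree_mult_eq[of \<pi> "B j"] by (simp add: \<pi>_def)
    have "(\<Sum>j<m. degree (B j)) < (\<Sum>j<m. degree (A j))"
    proof (rule sum_strict_mono_ex1)
      show "\<forall>j\<in>{..<m}. degree (B j) \<le> degree (A j)" 
        using deg by (metis Suc_n_not_le_n degree_0 lessThan_iff linear zero_le)
      have "B k \<noteq> 0" using B[of k] k by auto
      thus "\<exists>j\<in>{..<m}. degree (B j) < degree (A j)" using k deg by force
    qed auto
    hence "B k = 0" using less.hyps relB k by blast
    thus False using B[of k] k by simp
  qed
qed

section \<open>Polynomial identities over an algebraically closed field of positive characteristic\<close>

lemma CHAR_eq_prime:
  assumes "prime p" and "of_nat p = (0::'a::field)"
  shows "CHAR('a) = p"
proof -
  have "CHAR('a) dvd p" using assms(2) by (simp add: of_nat_eq_0_iff_char_dvd)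
  moreover have "CHAR('a) \<noteq> 1" by simp
  ultimately show ?thesis using assms(1) prime_nat_iff by blast
qed

locale closed_char =
  fixes p :: nat and K :: "'k::field itself"
  assumes prime_p: "prime p" and p5: "p > 5"
    and char0: "of_nat p = (0::'k)"
    and closed: "alg_closed_field K"
begin

lemma of_nat_k_eq_0_iff: "of_nat j = (0::'k) \<longleftrightarrow> p dvd j"
  using CHAR_eq_prime[OF prime_p char0] by (simp add: of_nat_eq_0_iff_char_dvd)

lemma two_k: "(2::'k) \<noteq> 0"
  using of_nat_k_eq_0_iff[of 2] p5 by (auto dest: dvd_imp_le)

lemma poly_root_exists: "degree (P::'k poly) > 0 \<Longrightarrow> \<exists>z. poly P z = 0"
  using closed by (simp add: alg_closed_field_def)

lemma root_exists:
  assumes "k > 0"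
  shows "\<exists>z::'k. z ^ k = c"
proof -
  have "degree (monom 1 k - [:c:]) = k"
    using assms by (simp add: degree_monom_eq degree_add_eq_left
        diff_conv_add_uminus del: add_uminus_conv_diff)
  then obtain z where "poly (monom 1 k - [:c:]) z = 0"
    using assms poly_root_exists by metis
  thus ?thesis by (auto simp: poly_monom)
qed

text \<open>Algebraic closedness suffices without counting roots: for nonconstant \<open>P\<close>
  the polynomial P + 1 has a root, and there P takes the value - 1.\<close>

lemma poly_vanishing:
  assumes "\<And>z. poly P z = (0::'k)"
  shows "P = 0"
proof (rule ccontr)
  assume "P \<noteq> 0"
  show False
  proof (cases "degree P > 0")
    case True
    hence "degree (P + 1) > 0" by (simp add: degree_add_eq_left)
    then obtain z where "poly (P + 1) z = 0" using poly_root_exists by blast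
    thus False using assms by simp
  next
    case False
    then obtain c where "P = [:c:]" by (auto elim: degree_eq_zeroE)
    thus False using assms[of 0] \<open>P \<noteq> 0\<close> by simp
  qed
qed

lemma poly_identity: "(\<And>z. poly P z = poly Q (z::'k)) \<Longrightarrow> P = Q"
  using poly_vanishing[of "P - Q"] by simp

lemma frob_add: "(z1 + z2 :: 'k) ^ p ^ r = z1 ^ p ^ r + z2 ^ p ^ r"
  using CHAR_eq_prime[OF prime_p char0] prime_p by (intro freshmans_dream'[where n = r]) auto

lemma frob_diff: "(z1 - z2 :: 'k) ^ p ^ r = z1 ^ p ^ r - z2 ^ p ^ r"
  using frob_add[of "z1 - z2" z2 r] by simp

lemma frob_uminus: "(- z :: 'k) ^ p ^ r = - (z ^ p ^ r)"
  using frob_diff[of 0 z r] p5 by (simp add: power_0_left)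

lemma frob_inj: "(z1 :: 'k) ^ p ^ r = z2 ^ p ^ r \<Longrightarrow> z1 = z2"
  using frob_diff[of z1 z2 r] by simp

lemma prime_power_decompose:
  assumes "(N::nat) > 0"
  obtains r k where "N = p ^ r * k" "\<not> p dvd k" "k > 0"
  using assms
proof (induction N arbitrary: thesis rule: less_induct)
  case (less N)
  show ?case
  proof (cases "p dvd N")
    case False thus ?thesis using less(2)[of 0 N] less(3) by simp
  next
    case True
    then obtain N' where N': "N = p * N'" by (auto simp: dvd_def)
    hence "N' < N" "N' > 0" using less(3) p5 by auto
    then obtain r k where "N' = p ^ r * k" "\<not> p dvd k" "k > 0" using less(1)[of N'] by metis
    thus ?thesis using less(2)[of "Suc r" k] N' by simp
  qed
qed

text \<open>By Bezout all \<open>n\<close>-th roots of unity are g-th roots of unity for g = gcd n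
  j. With e = n / g, taking g-th roots shows that 1 is the only e-th root of unity. If e > 1, a root
  of 1 + z + ... + z^(e - 1) must then be 1, so that e = 0 in the field and \<open>p\<close> divides
  \<open>n\<close>.\<close>

lemma roots_of_unity_dvd:
  assumes n: "n > 0" "\<not> p dvd n" and all: "\<And>z::'k. z ^ n = 1 \<Longrightarrow> z ^ j = 1"
  shows "n dvd j"
proof (rule ccontr)
  assume "\<not> n dvd j"
  define g where "g = gcd n j"
  have "g > 0" using n by (simp add: g_def)
  have gn: "g dvd n" by (simp add: g_def)
  then obtain e where e: "n = g * e" by (auto simp: dvd_def)
  have "e \<noteq> 0" using e n by auto
  moreover have "e \<noteq> 1"
  proof
    assume "e = 1"
    hence "n = g" using e by simp
    moreover have "g dvd j" by (simp add: g_def)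
    ultimately show False using \<open>\<not> n dvd j\<close> by simp
  qed
  ultimately have "e > 1" by simp
  have all_g: "z ^ g = 1" if "z ^ n = 1" for z :: 'k
  proof -
    obtain i k where "n * i = j * k + g" using bezout_nat[of n j] n by (auto simp: g_def)
    hence "(z ^ n) ^ i = (z ^ j) ^ k * z ^ g" by (simp add: power_add flip: power_mult)
    thus ?thesis using that all by simp
  qed
  have uniq: "\<omega> = 1" if "\<omega> ^ e = 1" for \<omega> :: 'k
  proof -
    obtain z where z: "z ^ g = \<omega>" using root_exists[OF \<open>g > 0\<close>] by blast
    hence "z ^ n = 1" using that by (simp add: e power_mult)
    thus ?thesis using all_g z by simp
  qed
  define P :: "'k poly" where "P = (\<Sum>i<e. monom 1 i)"
  have Pz: "poly P z = (\<Sum>i<e. z ^ i)" for z by (simp add: P_def poly_sum poly_monom)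
  have "coeff P (e - 1) = 1" using \<open>e > 1\<close> by (simp add: P_def coeff_sum sum.delta)
  hence "degree P \<ge> e - 1" by (intro le_degree) simp
  hence "degree P > 0" using \<open>e > 1\<close> by simp
  then obtain z where z: "poly P z = 0" using poly_root_exists by blast
  have "z ^ e - 1 = (z - 1) * poly P z" unfolding Pz by (simp add: power_diff_1_eq)
  hence "z ^ e = 1" using z by simp
  hence "z = 1" by (rule uniq)
  hence "of_nat e = (0::'k)" using z by (simp add: Pz)
  hence "p dvd n" using of_nat_k_eq_0_iff e by simp
  thus False using n by simp
qed

text \<open>Used for the points of the curve on a coordinate axis. The ratios of two such points are
  the \<open>n\<close>-th roots of unity, which gives the divisibility of the exponent; one point
  then determines the coefficient.\<close>

lemma fermat_axis:
  assumes n: "n > 0" "\<not> p dvd n" and a: "a \<noteq> 0"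
    and all: "\<And>z::'k. a * z ^ n = 1 \<Longrightarrow> c * z ^ A = 1"
  obtains N where "A = n * N" "c = a ^ N"
proof -
  obtain z0 where z0: "z0 ^ n = inverse a" using root_exists[OF n(1)] by blast
  hence 0: "a * z0 ^ n = 1" using a by simp
  have "n dvd A"
  proof (rule roots_of_unity_dvd[OF n])
    fix z :: 'k assume "z ^ n = 1"
    hence "a * (z * z0) ^ n = 1" using 0 by (simp add: power_mult_distrib)
    from all[OF this] have "z ^ A * (c * z0 ^ A) = 1" by (simp add: power_mult_distrib mult_ac)
    thus "z ^ A = 1" unfolding all[OF 0] by simp
  qed
  then obtain N where N: "A = n * N" by (auto simp: dvd_def)
  have "c * inverse a ^ N = 1" using all[OF 0] by (simp add: N power_mult z0)
  hence "c = a ^ N" using a by (simp add: field_simps)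
  thus ?thesis using that N by blast
qed

text \<open>Degrees give N = M. Frobenius is injective, so the \<open>p\<close>-part of the exponent
  can be removed; the derivative at 0 of the remaining identity is k * 0^(k - 1) - k, which leaves
  only k = 1.\<close>

lemma fermat_identity:
  assumes NM: "N > 0" "M > 0" and all: "\<And>u::'k. u ^ N + (1 - u) ^ M = 1"
  shows "N = M" and "\<exists>r. N = p ^ r"
proof -
  have pe: "monom 1 N + [:1, -1:] ^ M = (1::'k poly)"
    by (rule poly_identity) (simp add: poly_monom all)
  have dM: "degree ([:1, -1:] ^ M :: 'k poly) = M" by (simp add: degree_power_eq)
  have dN: "degree (monom 1 N :: 'k poly) = N" by (simp add: degree_monom_eq)
  show NM': "N = M"
  proof (rule ccontr)
    assume "N \<noteq> M"
    hence "degree (monom 1 N + [:1, -1:] ^ M :: 'k poly) = max N M"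
      using dM dN by (cases "N < M") (auto simp: degree_add_eq_right degree_add_eq_left)
    thus False using NM by (simp add: pe)
  qed
  obtain r k where k: "N = p ^ r * k" "\<not> p dvd k" "k > 0" using prime_power_decompose[OF NM(1)] .
  have all': "u ^ k + (1 - u) ^ k = 1" for u :: 'k
  proof (rule frob_inj[of _ r])
    have "(u ^ k + (1 - u) ^ k) ^ p ^ r = (u ^ k) ^ p ^ r + ((1 - u) ^ k) ^ p ^ r" by (rule frob_add)
    also have "\<dots> = u ^ N + (1 - u) ^ M" by (simp add: k(1) mult.commute flip: NM' power_mult)
    finally show "(u ^ k + (1 - u) ^ k) ^ p ^ r = 1 ^ p ^ r" by (simp add: all)
  qed
  have "monom 1 k + [:1, -1:] ^ k = (1::'k poly)"
    by (rule poly_identity) (simp add: poly_monom all')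
  hence "poly (pderiv (monom 1 k + [:1, -1:] ^ k)) 0 = (0::'k)" by simp
  hence "of_nat k * 0 ^ (k - 1) - of_nat k = (0::'k)"
    using k(3) by (simp add: pderiv_add pderiv_monom poly_monom pderiv_power pderiv_pCons)
  hence "k = 1" using k of_nat_k_eq_0_iff[of k] by (cases "k = 1") (auto simp: power_0_left)
  thus "\<exists>r. N = p ^ r" using k by auto
qed

lemma degree_one_minus_monom_sq:
  assumes "N > 0" and "e \<noteq> 0"
  shows "degree ((1 + monom e N) ^ 2 :: 'k poly) = 2 * N"
proof -
  have "degree (1 + monom e N :: 'k poly) = N"
    using assms by (simp add: degree_add_eq_right degree_monom_eq)
  moreover from this have "1 + monom e N \<noteq> (0::'k poly)" using assms(1) by auto
  ultimately show ?thesis by (simp add: degree_power_eq)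
qed

text \<open>Degrees give M = 2 N, so the identity is a difference of two squares in an integral
  domain. The factor with the plus sign has the value 2 at 0, hence the other one vanishes, which is
  the linear identity treated before.\<close>

lemma square_identity:
  assumes NM: "N > 0" "M > 0" and all: "\<And>u::'k. (1 - u) ^ M = (1 - u ^ N) ^ 2"
  shows "M = 2 * N" and "\<exists>r. N = p ^ r"
proof -
  have "[:1, -1:] ^ M = ((1 + monom (-1) N) ^ 2 :: 'k poly)"
    by (rule poly_identity) (simp add: poly_monom all)
  hence "degree ([:1, -1:] ^ M :: 'k poly) = 2 * N"
    using degree_one_minus_monom_sq[of N "-1"] NM by simp
  thus M: "M = 2 * N" by (simp add: degree_power_eq)
  let ?A = "[:1, -1:] ^ N :: 'k poly" and ?B = "1 - monom 1 N :: 'k poly"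
  have "(?A - ?B) * (?A + ?B) = 0"
  proof (rule poly_vanishing)
    fix z :: 'k
    have "((1 - z) ^ N) ^ 2 = (1 - z ^ N) ^ 2" using all[of z] by (simp add: M power_mult mult.commute)
    moreover have "(X1 - X2) * (X1 + X2) = X1 ^ 2 - X2 ^ 2" for X1 X2 :: 'k
      by (simp add: algebra_simps power2_eq_square)
    ultimately have "((1 - z) ^ N - (1 - z ^ N)) * ((1 - z) ^ N + (1 - z ^ N)) = 0" by simp
    moreover have "poly ?A z = (1 - z) ^ N" "poly ?B z = 1 - z ^ N" by (simp_all add: poly_monom)
    ultimately show "poly ((?A - ?B) * (?A + ?B)) z = 0"
      by (simp only: poly_mult poly_diff poly_add)
  qed
  moreover have "?A + ?B \<noteq> 0"
  proof
    assume "?A + ?B = 0"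
    hence "poly (?A + ?B) 0 = 0" by simp
    thus False using NM two_k by (simp add: poly_monom power_0_left)
  qed
  ultimately have AB: "?A - ?B = 0" by simp
  have "u ^ N + (1 - u) ^ N = 1" for u :: 'k
    using arg_cong[OF AB, of "\<lambda>P. poly P u"] by (simp add: poly_monom)
  from fermat_identity(2)[OF NM(1) NM(1) this] show "\<exists>r. N = p ^ r" .
qed

text \<open>With \<open>u = s ^ 2\<close> the equation of the parabola \<open>sqrt U + sqrt V = 1\<close> splits over the rational functions in \<open>s\<close>.\<close>
lemma parabola_split:
  assumes NM: "N > 0" "M > 0"
    and all: "\<And>u::'k. (1 - u ^ N - (1 - u) ^ M) ^ 2 = 4 * u ^ N * (1 - u) ^ M"
  obtains e :: 'k where "e = 1 \<or> e = - 1" "[:1, 0, -1:] ^ M = (1 + monom e N) ^ 2"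
proof -
  let ?V = "[:1, 0, -1:] ^ M :: 'k poly"
  have "(?V - (1 + monom 1 N) ^ 2) * (?V - (1 + monom (-1) N) ^ 2) = 0"
  proof (rule poly_vanishing)
    fix s :: 'k
    define t where "t = s ^ N"
    define V where "V = (1 - s ^ 2) ^ M"
    have "(1 - t ^ 2 - V) ^ 2 = 4 * t ^ 2 * V"
      using all[of "s ^ 2"] by (simp add: t_def V_def mult.commute flip: power_mult)
    hence "(V - (1 + t) ^ 2) * (V - (1 - t) ^ 2) = 0" by Groebner_Basis.algebra
    thus "poly ((?V - (1 + monom 1 N) ^ 2) * (?V - (1 + monom (-1) N) ^ 2)) s = 0"
      by (simp add: poly_monom t_def V_def power2_eq_square)
  qed
  hence "?V = (1 + monom 1 N) ^ 2 \<or> ?V = (1 + monom (-1) N) ^ 2" by simp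
  thus ?thesis using that by blast
qed

text \<open>Degrees in the split form give N = M. After the \<open>p\<close>-part is removed, (1 -
  s^2)^k = (1 + e s^k)^2 has to be compared near s = 0 only: the left side has the quadratic term -
  k s^2 and no linear term, which forces k = 2.\<close>

lemma parabola_identity:
  assumes NM: "N > 0" "M > 0"
    and all: "\<And>u::'k. (1 - u ^ N - (1 - u) ^ M) ^ 2 = 4 * u ^ N * (1 - u) ^ M"
  shows "N = M" and "\<exists>r. N = 2 * p ^ r"
proof -
  obtain e :: 'k where e: "e = 1 \<or> e = - 1" "[:1, 0, -1:] ^ M = (1 + monom e N) ^ 2"
    using parabola_split[OF NM all] .
  have "degree ([:1, 0, -1:] ^ M :: 'k poly) = 2 * N"
    unfolding e(2) using e(1) NM by (intro degree_one_minus_monom_sq) auto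
  thus M: "N = M" by (simp add: degree_power_eq)
  obtain r k where k: "N = p ^ r * k" "\<not> p dvd k" "k > 0" using prime_power_decompose[OF NM(1)] .
  have frob4: "4 * z ^ p ^ r = (4 * z) ^ p ^ r" for z :: 'k
  proof -
    have "(4 * z) ^ p ^ r = (z + z + (z + z)) ^ p ^ r" by simp
    thus ?thesis unfolding frob_add by simp
  qed
  have all': "(1 - u ^ k - (1 - u) ^ k) ^ 2 = 4 * u ^ k * (1 - u) ^ k" for u :: 'k
  proof (rule frob_inj[of _ r])
    have U: "(u ^ k) ^ p ^ r = u ^ N" and V: "((1 - u) ^ k) ^ p ^ r = (1 - u) ^ N"
      by (simp_all add: k(1) mult.commute flip: power_mult)
    have "((1 - u ^ k - (1 - u) ^ k) ^ 2) ^ p ^ r = ((1 - u ^ k - (1 - u) ^ k) ^ p ^ r) ^ 2"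
      by (simp add: mult.commute flip: power_mult)
    also have "\<dots> = (1 - u ^ N - (1 - u) ^ N) ^ 2"
      by (simp add: frob_diff U V)
    also have "\<dots> = 4 * (u ^ N * (1 - u) ^ N)" using all[of u] by (simp add: M)
    also have "\<dots> = 4 * (u ^ k * (1 - u) ^ k) ^ p ^ r" by (simp only: power_mult_distrib U V)
    also have "\<dots> = (4 * (u ^ k * (1 - u) ^ k)) ^ p ^ r" by (rule frob4)
    finally show "((1 - u ^ k - (1 - u) ^ k) ^ 2) ^ p ^ r = (4 * u ^ k * (1 - u) ^ k) ^ p ^ r"
      by (simp add: mult.assoc)
  qed
  obtain e :: 'k where e: "e = 1 \<or> e = - 1" "[:1, 0, -1:] ^ k = (1 + monom e k) ^ 2"
    using parabola_split[OF k(3) k(3) all'] .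
  let ?A = "[:1, 0, -1:] :: 'k poly"
  have "pderiv (?A ^ k) = smult (of_nat k) (?A ^ (k - 1)) * [:0, -2:]"
    by (simp add: pderiv_power pderiv_pCons mult_ac)
  moreover have "pderiv ((1 + monom e k) ^ 2) = 2 * (1 + monom e k) * monom (of_nat k * e) (k - 1)"
    by (simp add: power2_eq_square pderiv_mult pderiv_add pderiv_monom algebra_simps)
  ultimately have d: "smult (of_nat k) (?A ^ (k - 1)) * [:0, -2:] = 2 * (1 + monom e k) * monom (of_nat k * e) (k - 1)"
    using e(2) by simp
  have k0: "of_nat k \<noteq> (0::'k)" using k of_nat_k_eq_0_iff by simp
  have "k \<noteq> 1"
  proof
    assume "k = 1"
    from arg_cong[OF d, of "\<lambda>P. poly P 0"] show False
      using e(1) two_k \<open>k = 1\<close> by (auto simp: poly_monom)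
  qed
  \<comment> \<open>The identity \<open>d\<close> is differentiated once more at 0. On the right the
    factor s^(k - 1) still vanishes there, on the left - 2 k remains.\<close>
  moreover have "\<not> k \<ge> 3"
  proof
    assume k3: "k \<ge> 3"
    have "poly (pderiv (smult (of_nat k) (?A ^ (k - 1)) * [:0, -2:])) 0 = of_nat k * -2"
      unfolding pderiv_mult poly_add poly_mult by (simp add: pderiv_pCons)
    moreover have "poly (pderiv (2 * (1 + monom e k) * monom (of_nat k * e) (k - 1))) 0 = 0"
      unfolding pderiv_mult poly_add poly_mult using k3 by (simp add: pderiv_monom poly_monom power_0_left)
    ultimately show False using d k0 two_k by simp
  qed
  ultimately have "k = 2" using k(3) by linarith
  thus "\<exists>r. N = 2 * p ^ r" using k by (auto simp: mult.commute)
qed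

end

section \<open>The function field of the curve\<close>

locale curve = closed_char p K for p and K :: "'k::field itself" +
  fixes n m :: nat and a b :: 'k and \<iota> :: "'k \<Rightarrow> 'f::field" and x y :: 'f
  assumes a0: "a \<noteq> 0" and b0: "b \<noteq> 0"
    and n2: "n > 2" and m2: "m > 2" and pn: "\<not> p dvd n" and pm: "\<not> p dvd m"
    and ff: "is_curve_function_field \<iota> x y a b n m"
begin

lemma hom_i: "comm_ring_hom \<iota>"
  using ff by unfold_locales (auto simp: is_curve_function_field_def)

sublocale i: comm_ring_hom \<iota> by (rule hom_i)

lemma i_eq_0_iff [simp]: "\<iota> c = 0 \<longleftrightarrow> c = 0"
proof
  assume "\<iota> c = 0"
  show "c = 0"
  proof (rule ccontr)
    assume "c \<noteq> 0"
    hence "\<iota> c * \<iota> (inverse c) = \<iota> 1" by (simp flip: i.hom_mult)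
    thus False using \<open>\<iota> c = 0\<close> by simp
  qed
qed simp

sublocale i: inj_comm_ring_hom \<iota> by unfold_locales simp

lemma char_f: "CHAR('f) = p"
  using i.hom_of_nat[of p] char0 prime_p by (intro CHAR_eq_prime) auto

lemma of_nat_f_eq_0_iff: "of_nat j = (0::'f) \<longleftrightarrow> p dvd j"
  using char_f by (simp add: of_nat_eq_0_iff_char_dvd)

lemma curve_eq: "\<iota> a * x ^ n + \<iota> b * y ^ m = 1"
  using ff by (simp add: is_curve_function_field_def)

lemma transcendental: "P \<noteq> 0 \<Longrightarrow> eval_at \<iota> x P \<noteq> 0"
  using ff by (simp add: is_curve_function_field_def eval_at_def)

lemma generates: "is_subfield S \<Longrightarrow> range \<iota> \<subseteq> S \<Longrightarrow> x \<in> S \<Longrightarrow> y \<in> S \<Longrightarrow> S = UNIV"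
  using ff by (simp add: is_curve_function_field_def)

definition F :: "'k poly" where "F = smult (inverse b) (1 - monom a n)"

text \<open>A root of \<open>F\<close> is nonzero and simple, as the derivative - n a \<rho>^(n - 1)
  / b does not vanish when \<open>p\<close> does not divide \<open>n\<close>. This supplies the
  hypothesis of the Eisenstein argument.\<close>

lemma F_root: "\<exists>\<rho> g. F = [:-\<rho>, 1:] * g \<and> poly g \<rho> \<noteq> 0"
proof -
  obtain \<rho> where rho: "\<rho> ^ n = inverse a" using root_exists[of n] n2 by auto
  have "poly F \<rho> = 0" using rho a0 by (simp add: F_def poly_monom)
  then obtain g where g: "F = [:-\<rho>, 1:] * g" by (auto simp: poly_eq_0_iff_dvd dvd_def)
  have "\<rho> \<noteq> 0" using rho a0 n2 by (metis inverse_nonzero_iff_nonzero less_nat_zero_code zero_power bot_nat_0.not_eq_extremum)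
  have "poly g \<rho> = poly (pderiv F) \<rho>" unfolding g by (simp only: pderiv_mult) (simp add: pderiv_pCons)
  also have "\<dots> = - (inverse b * (of_nat n * a * \<rho> ^ (n - 1)))"
    by (simp add: F_def pderiv_smult pderiv_diff pderiv_monom poly_monom)
  also have "\<dots> \<noteq> 0" using a0 b0 \<open>\<rho> \<noteq> 0\<close> pn by (simp add: of_nat_k_eq_0_iff)
  finally show ?thesis using g by blast
qed

lemma y_power: "y ^ m = eval_at \<iota> x F"
proof -
  interpret e: comm_ring_hom "eval_at \<iota> x" by (rule comm_ring_hom_eval_at[OF hom_i])
  have "eval_at \<iota> x F = \<iota> (inverse b) * (1 - \<iota> a * x ^ n)"
    by (simp add: F_def eval_at_smult[OF hom_i] e.hom_minus hom_i)
  hence "\<iota> b * eval_at \<iota> x F = (\<iota> b * \<iota> (inverse b)) * (1 - \<iota> a * x ^ n)"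
    by (simp add: mult.assoc)
  also have "\<iota> b * \<iota> (inverse b) = 1" using b0 by (simp flip: i.hom_mult)
  also have "1 * (1 - \<iota> a * x ^ n) = \<iota> b * y ^ m" using curve_eq by (simp add: algebra_simps)
  finally show ?thesis using b0 by simp
qed

text \<open>Irreducibility of the curve in usable form: the remainder on division by the monic
  polynomial Y^m - F has degree below \<open>m\<close> in Y, and the powers of \<open>y\<close>
  below \<open>m\<close> are independent over the polynomials in \<open>x\<close>.\<close>

lemma kernel_eval:
  assumes "eval_at (eval_at \<iota> x) y P = 0"
  shows "\<exists>Q. P = (monom 1 m - [:F:]) * Q"
proof -
  let ?e = "eval_at \<iota> x"
  let ?G = "monom 1 m - [:F:] :: 'k poly poly"
  have e: "comm_ring_hom ?e" by (rule comm_ring_hom_eval_at[OF hom_i])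
  interpret e0: comm_ring_hom ?e by (rule e)
  interpret ev: comm_ring_hom "eval_at ?e y" by (rule comm_ring_hom_eval_at[OF e])
  have dG: "degree ?G = m"
    using m2 by (simp add: degree_monom_eq degree_add_eq_left
        diff_conv_add_uminus del: add_uminus_conv_diff)
  have lc: "coeff ?G m = 1" using m2 by (simp add: coeff_pCons split: nat.splits)
  have G0: "?G \<noteq> 0" using lc by (metis coeff_0 zero_neq_one)
  \<comment> \<open>The coefficients lie in a polynomial ring, hence pseudo-division; as the divisor
    is monic, it is an honest division.\<close>
  obtain Q R where QR: "pseudo_divmod P ?G = (Q, R)" by (cases "pseudo_divmod P ?G")
  have PQR: "P = ?G * Q + R" using pseudo_divmod(1)[OF G0 QR] lc by (simp add: dG)
  have R: "R = 0 \<or> degree R < m" using pseudo_divmod(2)[OF G0 QR] dG by simp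
  have "eval_at ?e y ?G = 0"
    by (simp add: ev.hom_minus e y_power e0.hom_one)
  hence "eval_at ?e y R = 0" using assms PQR by (simp add: ev.hom_add ev.hom_mult)
  have "(\<Sum>j<m. ?e (coeff R j) * y ^ j) = eval_at ?e y R"
    unfolding eval_at_sum[OF e] using R m2 
    by (intro sum.mono_neutral_right) (auto simp: coeff_eq_0)
  hence "(\<Sum>j<m. ?e (coeff R j) * y ^ j) = 0" using \<open>eval_at ?e y R = 0\<close> by simp
  moreover obtain \<rho> g where "F = [:-\<rho>, 1:] * g" "poly g \<rho> \<noteq> 0" using F_root by blast
  ultimately have "\<forall>j<m. coeff R j = 0"
    using radical_powers_independent[OF hom_i transcendental y_power] by blast
  hence "lead_coeff R = 0" using R m2 by (cases "R = 0") auto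
  hence "R = 0" by simp
  thus ?thesis using PQR by auto
qed

text \<open>Since a relation in the function field is a multiple of the defining equation, it holds
  at every affine point. The identity is passed as a list of triples of a coefficient and two
  exponents because a polynomial has to be recovered from it.\<close>

lemma specialize:
  assumes "(\<Sum>(c, i, j)\<leftarrow>l. \<iota> c * x ^ i * y ^ j) = 0" and "a * u ^ n + b * v ^ m = 1"
  shows "(\<Sum>(c, i, j)\<leftarrow>l. c * u ^ i * v ^ j) = 0"
proof -
  define P where "P = (\<lambda>l::('k \<times> nat \<times> nat) list. (\<Sum>(c, i, j)\<leftarrow>l. monom (monom c i) j))"
  have P: "P [] = 0" "P ((c, i, j) # l) = monom (monom c i) j + P l" for c i j l
    by (simp_all add: P_def)
  have e: "comm_ring_hom (eval_at \<iota> x)" by (rule comm_ring_hom_eval_at[OF hom_i])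
  interpret e: comm_ring_hom "eval_at (eval_at \<iota> x) y" by (rule comm_ring_hom_eval_at[OF e])
  have "eval_at (eval_at \<iota> x) y (P l) = (\<Sum>(c, i, j)\<leftarrow>l. \<iota> c * x ^ i * y ^ j)"
    by (induction l) (auto simp: P e.hom_add e hom_i)
  then obtain Q where Q: "P l = (monom 1 m - [:F:]) * Q" using kernel_eval[of "P l"] assms(1) by auto
  have s: "comm_ring_hom (\<lambda>c. poly c u)" by unfold_locales auto
  then interpret s: comm_ring_hom "eval_at (\<lambda>c. poly c u) v" by (rule comm_ring_hom_eval_at)
  have "v ^ m = poly F u" using assms(2) b0 by (simp add: F_def poly_monom field_simps)
  hence "eval_at (\<lambda>c. poly c u) v (P l) = 0" unfolding Q by (simp add: s.hom_mult s.hom_minus s)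
  moreover have "eval_at (\<lambda>c. poly c u) v (P l) = (\<Sum>(c, i, j)\<leftarrow>l. c * u ^ i * v ^ j)"
    by (induction l) (auto simp: P s.hom_add s poly_monom)
  ultimately show ?thesis by simp
qed

end

section \<open>Hasse derivatives\<close>

no_notation vec_index (infixl "$" 100)

lemma is_subfield_add: "is_subfield S \<Longrightarrow> u \<in> S \<Longrightarrow> v \<in> S \<Longrightarrow> u + v \<in> S"
  and is_subfield_mult: "is_subfield S \<Longrightarrow> u \<in> S \<Longrightarrow> v \<in> S \<Longrightarrow> u * v \<in> S"
  by (simp_all add: is_subfield_def)

text \<open>The series (y + T)^m - y^m has linear coefficient m y^(m - 1), which is nonzero, and
  thus a compositional inverse. Composing the inverse with g - y^m yields the correction to the
  constant term \<open>y\<close> of the root.\<close>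

lemma fps_nth_root_exists:
  fixes g :: "'a::field fps"
  assumes "y \<noteq> 0" and "of_nat m \<noteq> (0::'a)" and "g $ 0 = y ^ m"
  shows "\<exists>Y. Y $ 0 = y \<and> Y ^ m = g"
proof -
  have m: "m > 0" using assms(2) by (cases m) auto
  define P where "P = (fps_const y + fps_X) ^ m - fps_const (y ^ m)"
  have P0: "P $ 0 = 0" by (simp add: P_def fps_nth_power_0)
  have "P $ 1 = fps_deriv P $ 0" by simp
  also have "\<dots> = of_nat m * y ^ (m - 1)"
    using m by (simp add: P_def fps_deriv_power fps_nth_power_0 fps_mult_nth_0 fps_of_nat[symmetric])
  finally have P1: "P $ 1 \<noteq> 0" using assms by simp
  define h where "h = g - fps_const (y ^ m)"
  define Z where "Z = fps_inv P oo h"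
  have h0: "h $ 0 = 0" using assms by (simp add: h_def)
  have Z0: "Z $ 0 = 0" by (simp add: Z_def fps_compose_nth_0 fps_inv_def)
  have "P oo Z = h"
    unfolding Z_def using h0 fps_inv_right[OF P0 P1]
    by (subst fps_compose_assoc) (auto simp: fps_inv_def)
  moreover have "P oo Z = (fps_const y + Z) ^ m - fps_const (y ^ m)"
    by (simp add: P_def fps_compose_sub_distrib fps_compose_power[OF Z0, symmetric]
        fps_compose_add_distrib Z0)
  ultimately have "(fps_const y + Z) ^ m = g" by (simp add: h_def)
  thus ?thesis using Z0 by (intro exI[of _ "fps_const y + Z"]) simp
qed

context curve begin

lemma x0: "x \<noteq> 0"
  using transcendental[of "[:0, 1:]"] by (auto simp: eval_at_pCons hom_i)

lemma y0: "y \<noteq> 0"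
proof
  assume "y = 0"
  hence "eval_at \<iota> x F = 0" using y_power m2 by (simp add: power_0_left)
  hence "F = 0" using transcendental by blast
  thus False using F_root by (metis mult_eq_0_iff poly_0 pCons_eq_0_iff zero_neq_one)
qed

lemma of_nat_m: "of_nat m \<noteq> (0::'f)"
  using pm by (simp add: of_nat_f_eq_0_iff)

text \<open>The constants, \<open>x\<close> and \<open>y\<close> after translation by \<open>T\<close>; that the choice defining \<open>yT\<close> exists
  and is unique is Hensel's lemma, as \<open>p\<close> does not divide \<open>m\<close>.\<close>
definition cst :: "'k \<Rightarrow> 'f fps" where "cst c = fps_const (\<iota> c)"
definition xT :: "'f fps" where "xT = fps_const x + fps_X"
definition yT :: "'f fps" where "yT = (SOME Y. Y $ 0 = y \<and> Y ^ m = eval_at cst xT F)"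
definition eF :: "'k poly poly \<Rightarrow> 'f" where "eF = eval_at (eval_at \<iota> x) y"
definition eT :: "'k poly poly \<Rightarrow> 'f fps" where "eT = eval_at (eval_at cst xT) yT"

lemma hom_cst: "comm_ring_hom cst"
  by unfold_locales (auto simp: cst_def hom_distribs)

lemma hom_nth0: "comm_ring_hom (\<lambda>g::'f fps. g $ 0)"
  by unfold_locales (auto simp: fps_mult_nth_0)

lemma nth0_eval: "eval_at cst xT P $ 0 = eval_at \<iota> x P"
proof -
  have "eval_at cst xT P $ 0 = eval_at ((\<lambda>g. g $ 0) \<circ> cst) (xT $ 0) P"
    by (rule hom_eval_at[OF hom_cst hom_nth0])
  also have "(\<lambda>g. g $ 0) \<circ> cst = \<iota>" by (auto simp: cst_def)
  finally show ?thesis by (simp add: xT_def)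
qed

lemma yT: "yT $ 0 = y" "yT ^ m = eval_at cst xT F"
proof -
  have "\<exists>Y. Y $ 0 = y \<and> Y ^ m = eval_at cst xT F"
    using y0 of_nat_m y_power by (intro fps_nth_root_exists) (auto simp: nth0_eval)
  from someI_ex[OF this] show "yT $ 0 = y" "yT ^ m = eval_at cst xT F"
    by (simp_all add: yT_def)
qed

lemma yT_unique:
  assumes "Y $ 0 = y" and "Y ^ m = eval_at cst xT F"
  shows "Y = yT"
proof -
  have "(Y - yT) * (\<Sum>i<m. yT ^ (m - Suc i) * Y ^ i) = Y ^ m - yT ^ m"
    by (simp add: power_diff_sumr2)
  also have "\<dots> = 0" using assms yT by simp
  finally have "Y - yT = 0 \<or> (\<Sum>i<m. yT ^ (m - Suc i) * Y ^ i) = 0" by simp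
  moreover have "(\<Sum>i<m. yT ^ (m - Suc i) * Y ^ i) $ 0 = (\<Sum>i<m. y ^ (m - 1))"
    unfolding fps_sum_nth
    by (intro sum.cong refl) (auto simp: fps_mult_nth_0 fps_nth_power_0 assms yT simp flip: power_add)
  hence "(\<Sum>i<m. yT ^ (m - Suc i) * Y ^ i) $ 0 \<noteq> 0" using y0 of_nat_m by simp
  ultimately show ?thesis by auto
qed

sublocale eF: comm_ring_hom eF
  unfolding eF_def by (intro comm_ring_hom_eval_at hom_i)
sublocale eT: comm_ring_hom eT
  unfolding eT_def by (intro comm_ring_hom_eval_at hom_cst)

lemma nth0_eT: "eT P $ 0 = eF P"
proof -
  have c: "comm_ring_hom (eval_at cst xT)" by (intro comm_ring_hom_eval_at hom_cst)
  have "eT P $ 0 = eval_at ((\<lambda>g. g $ 0) \<circ> eval_at cst xT) (yT $ 0) P"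
    unfolding eT_def by (rule hom_eval_at[OF c hom_nth0])
  also have "(\<lambda>g. g $ 0) \<circ> eval_at cst xT = eval_at \<iota> x" by (auto simp: nth0_eval)
  finally show ?thesis by (simp add: eF_def yT)
qed

text \<open>\<open>yT\<close> satisfies the translated equation of the curve, so translation is well
  defined on the ring generated by the constants, \<open>x\<close> and \<open>y\<close>.\<close>

lemma eT_eq_0: assumes "eF P = 0" shows "eT P = 0"
proof -
  obtain Q where Q: "P = (monom 1 m - [:F:]) * Q" using kernel_eval[of P] assms unfolding eF_def by blast
  have c: "comm_ring_hom (eval_at cst xT)" by (intro comm_ring_hom_eval_at hom_cst)
  then interpret c: comm_ring_hom "eval_at cst xT" .
  have "eT (monom 1 m - [:F:]) = 0"
    by (simp add: eT.hom_minus) (simp add: eT_def c yT c.hom_one)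
  thus ?thesis by (simp add: Q eT.hom_mult)
qed

section \<open>The Taylor expansion of arbitrary functions\<close>

lemma fraction_exists: "\<exists>P Q. eF Q \<noteq> 0 \<and> f = eF P / eF Q"
proof -
  let ?S = "{f. \<exists>P Q. eF Q \<noteq> 0 \<and> f = eF P / eF Q}"
  have quot_in_S: "u \<in> ?S" if "eF Q \<noteq> 0" "u = eF P / eF Q" for u P Q using that by blast
  have in_S: "eF P \<in> ?S" for P by (rule quot_in_S[of 1 _ P]) auto
  have c: "comm_ring_hom (eval_at \<iota> x)" by (intro comm_ring_hom_eval_at hom_i)
  then interpret c: comm_ring_hom "eval_at \<iota> x" .
  have "?S = UNIV"
  proof (rule generates)
    show "is_subfield ?S"
      unfolding is_subfield_def
    proof (intro conjI ballI)
      show "0 \<in> ?S" "1 \<in> ?S" using in_S[of 0] in_S[of 1] by simp_all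
      fix u assume u: "u \<in> ?S"
      then obtain P Q where PQ: "eF Q \<noteq> 0" "u = eF P / eF Q" by auto
      show "- u \<in> ?S" by (rule quot_in_S[of Q _ "- P"]) (use PQ in \<open>auto simp: eF.hom_uminus\<close>)
      show "inverse u \<in> ?S" 
      proof (cases "eF P = 0")
        case True thus ?thesis using PQ in_S[of 0] by auto
      next
        case False show ?thesis by (rule quot_in_S[of P _ Q]) (use PQ False in auto)
      qed
      fix v assume v: "v \<in> ?S"
      then obtain P' Q' where PQ': "eF Q' \<noteq> 0" "v = eF P' / eF Q'" by auto
      show "u + v \<in> ?S"
        by (rule quot_in_S[of "Q * Q'" _ "P * Q' + P' * Q"])
          (use PQ PQ' in \<open>auto simp: eF.hom_add eF.hom_mult add_frac_eq\<close>)
      show "u * v \<in> ?S"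
        by (rule quot_in_S[of "Q * Q'" _ "P * P'"]) (use PQ PQ' in \<open>auto simp: eF.hom_mult\<close>)
    qed
    show "range \<iota> \<subseteq> ?S"
    proof safe
      fix c show "\<exists>P Q. eF Q \<noteq> 0 \<and> \<iota> c = eF P / eF Q"
        using in_S[of "[:[:c:]:]"] by (simp add: eF_def c hom_i)
    qed
    show "x \<in> ?S" using in_S[of "[:[:0, 1:]:]"] by (simp add: eF_def c hom_i eval_at_pCons)
    show "y \<in> ?S" using in_S[of "[:0, 1:]"]
      by (simp add: eF_def c hom_i eval_at_pCons c.hom_one)
  qed
  thus ?thesis by blast
qed

text \<open>The expansion of f at the translated generic point. The denominator has nonzero constant
  coefficient, so its inverse exists already as a power series. The fraction is chosen; cross
  multiplication shows later that the choice is immaterial.\<close>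

definition expand :: "'f \<Rightarrow> 'f fps" where
  "expand f = (let PQ = (SOME PQ. eF (snd PQ) \<noteq> 0 \<and> f * eF (snd PQ) = eF (fst PQ))
     in eT (fst PQ) * inverse (eT (snd PQ)))"

lemma eT_inverse: "eF Q \<noteq> 0 \<Longrightarrow> inverse (eT Q) * eT Q = 1"
  by (intro inverse_mult_eq_1) (simp add: nth0_eT)

lemma expand_frac:
  assumes "eF Q \<noteq> 0" "f * eF Q = eF P"
  shows "expand f * eT Q = eT P"
proof -
  define P' where "P' = fst (SOME PQ. eF (snd PQ) \<noteq> 0 \<and> f * eF (snd PQ) = eF (fst PQ))"
  define Q' where "Q' = snd (SOME PQ. eF (snd PQ) \<noteq> 0 \<and> f * eF (snd PQ) = eF (fst PQ))"
  have "\<exists>PQ. eF (snd PQ) \<noteq> 0 \<and> f * eF (snd PQ) = eF (fst PQ)"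
    by (rule exI[of _ "(P, Q)"]) (simp add: assms)
  from someI_ex[OF this] have PQ': "eF Q' \<noteq> 0" "f * eF Q' = eF P'"
    unfolding P'_def Q'_def by blast+
  have ex: "expand f = eT P' * inverse (eT Q')"
    by (simp add: expand_def Let_def P'_def Q'_def)
  have "eF (P' * Q - P * Q') = f * eF Q' * eF Q - f * eF Q * eF Q'"
    by (simp only: eF.hom_minus eF.hom_mult assms(2) PQ'(2))
  hence "eT (P' * Q - P * Q') = 0" by (intro eT_eq_0) simp
  hence *: "eT P' * eT Q = eT P * eT Q'" by (simp add: eT.hom_minus eT.hom_mult)
  have "expand f * eT Q = inverse (eT Q') * (eT P' * eT Q)" by (simp only: ex mult_ac)
  also have "\<dots> = eT P * (inverse (eT Q') * eT Q')" by (simp only: * mult_ac)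
  finally show ?thesis using eT_inverse[OF PQ'(1)] by simp
qed

lemma expand_eF: "expand (eF P) = eT P"
proof -
  have "expand (eF P) * eT 1 = eT P" by (rule expand_frac) simp_all
  thus ?thesis by simp
qed

lemma expand_eqI:
  assumes "eF Q \<noteq> 0" "f * eF Q = eF P" "g * eT Q = eT P"
  shows "g = expand f"
proof -
  have "eT Q \<noteq> 0" using assms(1) nth0_eT[of Q] by auto
  moreover have "g * eT Q = expand f * eT Q" using expand_frac[OF assms(1,2)] assms(3) by simp
  ultimately show ?thesis by simp
qed

lemma hom_expand: "comm_ring_hom expand"
proof unfold_locales
  fix f g
  obtain P Q where PQ: "eF Q \<noteq> 0" "f * eF Q = eF P" using fraction_exists[of f] by auto
  obtain P' Q' where PQ': "eF Q' \<noteq> 0" "g * eF Q' = eF P'" using fraction_exists[of g] by auto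
  note e = expand_frac[OF PQ] expand_frac[OF PQ']
  have "(f + g) * eF (Q * Q') = (f * eF Q) * eF Q' + (g * eF Q') * eF Q"
    by (simp add: eF.hom_mult algebra_simps)
  moreover have "(expand f + expand g) * eT (Q * Q') = (expand f * eT Q) * eT Q' + (expand g * eT Q') * eT Q"
    by (simp add: eT.hom_mult algebra_simps)
  ultimately show "expand (f + g) = expand f + expand g"
    unfolding PQ(2) PQ'(2) e eF.hom_mult[symmetric] eT.hom_mult[symmetric] eF.hom_add[symmetric] eT.hom_add[symmetric]
    by (intro expand_eqI[symmetric, of "Q * Q'"]) (use PQ PQ' in \<open>simp_all add: eF.hom_mult\<close>)
  have "(f * g) * eF (Q * Q') = (f * eF Q) * (g * eF Q')"
    by (simp add: eF.hom_mult)
  moreover have "(expand f * expand g) * eT (Q * Q') = (expand f * eT Q) * (expand g * eT Q')"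
    by (simp add: eT.hom_mult)
  ultimately show "expand (f * g) = expand f * expand g"
    unfolding PQ(2) PQ'(2) e eF.hom_mult[symmetric] eT.hom_mult[symmetric]
    by (intro expand_eqI[symmetric, of "Q * Q'"]) (use PQ PQ' in \<open>simp_all add: eF.hom_mult\<close>)
next
  show "expand 1 = 1" using expand_eF[of 1] by simp
  show "expand 0 = 0" using expand_eF[of 0] by simp
qed

sublocale ex: comm_ring_hom expand by (rule hom_expand)

lemma expand_nth0: "expand f $ 0 = f"
proof -
  obtain P Q where PQ: "eF Q \<noteq> 0" "f * eF Q = eF P" using fraction_exists[of f] by auto
  have "(expand f * eT Q) $ 0 = eT P $ 0" using expand_frac[OF PQ] by simp
  hence "expand f $ 0 * eF Q = f * eF Q" by (simp add: fps_mult_nth_0 nth0_eT PQ(2))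
  thus ?thesis using PQ(1) by simp
qed

lemma hom_eval_x: "comm_ring_hom (eval_at \<iota> x)" and hom_eval_xT: "comm_ring_hom (eval_at cst xT)"
  by (rule comm_ring_hom_eval_at, rule hom_i, rule comm_ring_hom_eval_at, rule hom_cst)

lemma expand_i: "expand (\<iota> c) = cst c"
  using expand_eF[of "[:[:c:]:]"] unfolding eF_def eT_def
  by (simp only: eval_at_const hom_eval_x hom_eval_xT hom_i hom_cst)

lemma expand_x: "expand x = xT"
proof -
  interpret c: comm_ring_hom cst by (rule hom_cst)
  show ?thesis
    using expand_eF[of "[:[:0, 1:]:]"] unfolding eF_def eT_def
    by (simp only: eval_at_const eval_at_pCons hom_eval_x hom_eval_xT hom_i hom_cst
        i.hom_zero i.hom_one c.hom_zero c.hom_one) simp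
qed

lemma expand_y: "expand y = yT"
proof -
  interpret e: comm_ring_hom "eval_at \<iota> x" by (rule hom_eval_x)
  interpret c: comm_ring_hom "eval_at cst xT" by (rule hom_eval_xT)
  show ?thesis
    using expand_eF[of "[:0, 1:]"] unfolding eF_def eT_def
    by (simp only: eval_at_const eval_at_pCons hom_eval_x hom_eval_xT hom_i hom_cst
        e.hom_zero e.hom_one c.hom_zero c.hom_one) simp
qed

lemma is_hasse_expand: "is_hasse_system \<iota> x (\<lambda>k f. expand f $ k)"
  unfolding is_hasse_system_def
  by (auto simp: expand_nth0 ex.hom_add ex.hom_mult fps_mult_nth expand_i cst_def expand_x xT_def
      atMost_atLeast0 fps_X_def)

text \<open>A Hasse system is the same as a ring homomorphism into power series, f being sent to the
  series with coefficients D k f. It agrees with \<open>expand\<close> on the constants and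
  \<open>x\<close> by the axioms, on \<open>y\<close> by uniqueness of the root \<open>yT\<close>,
  and so on the field they generate. This gives meaning to the description operator in
  \<open>hasse\<close>.\<close>

lemma hasse_system_unique:
  assumes D: "is_hasse_system \<iota> x D"
  shows "D k f = expand f $ k"
proof -
  define E where "E = (\<lambda>f. Abs_fps (\<lambda>k. D k f))"
  have D0: "D 0 f = f" and Da: "D k (f + g) = D k f + D k g"
    and Dm: "D k (f * g) = (\<Sum>i\<le>k. D i f * D (k - i) g)"
    and Dc: "k > 0 \<Longrightarrow> D k (\<iota> c) = 0" and D1: "D 1 x = 1" and D2: "k \<ge> 2 \<Longrightarrow> D k x = 0" for k f g c
    using D by (auto simp: is_hasse_system_def)
  have Ei: "E (\<iota> c) = cst c" for c
    by (rule fps_ext) (auto simp: E_def cst_def D0 Dc)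
  have "comm_ring_hom E"
  proof unfold_locales
    show "E 0 = 0" using Ei[of 0] by (simp add: cst_def)
    show "E 1 = 1" using Ei[of 1] by (simp add: cst_def)
    fix f g
    show "E (f + g) = E f + E g" by (rule fps_ext) (simp add: E_def Da)
    show "E (f * g) = E f * E g" by (rule fps_ext) (simp add: E_def Dm fps_mult_nth atMost_atLeast0)
  qed
  then interpret E: comm_ring_hom E .
  have D1': "D (Suc 0) x = 1" using D1 by simp
  have Ex: "E x = xT"
  proof (rule fps_ext)
    fix k show "E x $ k = xT $ k"
      by (cases "k \<ge> 2") (use D0 D1' D2 in \<open>auto simp: E_def xT_def not_le less_2_cases_iff\<close>)
  qed
  have "E y ^ m = E (eval_at \<iota> x F)" by (simp add: E.hom_power[symmetric] y_power)
  also have "\<dots> = eval_at (E \<circ> \<iota>) (E x) F" by (rule hom_eval_at[OF hom_i]) unfold_locales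
  also have "E \<circ> \<iota> = cst" using Ei by auto
  finally have Ey: "E y = yT" using Ex by (intro yT_unique) (auto simp: E_def D0)
  have "{f. E f = expand f} = UNIV"
  proof (rule generates)
    show "is_subfield {f. E f = expand f}"
      unfolding is_subfield_def
    proof safe
      fix u assume u: "E u = expand u"
      show "E (inverse u) = expand (inverse u)"
      proof (cases "u = 0")
        case False
        have "E u * E (inverse u) = 1" "expand u * expand (inverse u) = 1"
          using False by (simp_all flip: E.hom_mult ex.hom_mult)
        thus ?thesis using u by (metis mult_left_cancel mult_zero_left zero_neq_one)
      qed simp
    qed (auto simp: E.hom_add E.hom_mult ex.hom_add ex.hom_mult E.hom_uminus ex.hom_uminus)
  qed (auto simp: Ei expand_i Ex Ey expand_x expand_y)
  hence "E f = expand f" by auto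
  thus ?thesis by (metis E_def fps_nth_Abs_fps)
qed

abbreviation D :: "nat \<Rightarrow> 'f \<Rightarrow> 'f" where "D \<equiv> hasse \<iota> x"

lemma D_expand: "D k f = expand f $ k"
proof -
  have "hasse \<iota> x = (\<lambda>k f. expand f $ k)"
    unfolding hasse_def
  proof (rule the_equality)
    fix E assume "is_hasse_system \<iota> x E"
    from hasse_system_unique[OF this] show "E = (\<lambda>k f. expand f $ k)" by (intro ext) 
  qed (rule is_hasse_expand)
  thus ?thesis by simp
qed

section \<open>Rules for Hasse derivatives\<close>

lemma D_0 [simp]: "D 0 f = f"
  by (simp add: D_expand expand_nth0)

lemma D_add: "D k (f + g) = D k f + D k g"
  and D_minus: "D k (f - g) = D k f - D k g"
  and D_uminus: "D k (- f) = - D k f"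
  by (simp_all add: D_expand ex.hom_add ex.hom_minus ex.hom_uminus)

lemma D_mult: "D k (f * g) = (\<Sum>i\<le>k. D i f * D (k - i) g)"
  by (simp add: D_expand ex.hom_mult fps_mult_nth atMost_atLeast0)

lemma D_i [simp]: "k > 0 \<Longrightarrow> D k (\<iota> c) = 0"
  by (simp add: D_expand expand_i cst_def)

lemma D_x: "D (Suc 0) x = 1" "k \<ge> 2 \<Longrightarrow> D k x = 0"
  by (auto simp: D_expand expand_x xT_def fps_X_def)

lemma D1_mult: "D 1 (f * g) = D 1 f * g + f * D 1 g"
  by (simp add: D_mult add.commute)

lemma D1_power: "D 1 (f ^ k) = of_nat k * f ^ (k - 1) * D 1 f"
proof (induction k)
  case (Suc k)
  have "D 1 (f ^ Suc k) = D 1 f * f ^ k + f * (of_nat k * f ^ (k - 1) * D 1 f)"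
    by (simp only: power_Suc D1_mult Suc.IH)
  also have "\<dots> = of_nat (Suc k) * f ^ (Suc k - 1) * D 1 f"
    by (cases k) (simp_all add: algebra_simps)
  finally show ?case .
next
  case 0 show ?case using D_i[of 1 1] by simp
qed

text \<open>Both sides are derivations along the Taylor expansion that agree on generators.\<close>
lemma fps_deriv_expand: "fps_deriv (expand f) = expand (D 1 f)"
proof -
  have "{f. fps_deriv (expand f) = expand (D 1 f)} = UNIV"
  proof (rule generates)
    let ?S = "{f. fps_deriv (expand f) = expand (D 1 f)}"
    show c: "range \<iota> \<subseteq> ?S" by (auto simp: expand_i cst_def)
    have i01: "\<iota> 0 \<in> ?S" "\<iota> 1 \<in> ?S" using c by blast+
    show X: "x \<in> ?S" using D_x by (simp add: expand_x xT_def)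
    show s: "is_subfield ?S"
      unfolding is_subfield_def
    proof safe
      show "fps_deriv (expand 0) = expand (D 1 0)" "fps_deriv (expand 1) = expand (D 1 1)"
        using i01 by simp_all
      fix u assume u: "fps_deriv (expand u) = expand (D 1 u)"
      show "fps_deriv (expand (- u)) = expand (D 1 (- u))"
        by (simp add: u[simplified] D_uminus ex.hom_uminus)
      show "fps_deriv (expand (inverse u)) = expand (D 1 (inverse u))"
      proof (cases "u = 0")
        case True thus ?thesis using u by simp
      next
        case False
        have 1: "expand u * expand (inverse u) = 1" using False by (simp flip: ex.hom_mult)
        have "0 = fps_deriv (expand u * expand (inverse u))" by (simp add: 1)
        also have "\<dots> = expand u * fps_deriv (expand (inverse u)) + expand (D 1 u) * expand (inverse u)"
          using u by simp
        finally have "expand u * fps_deriv (expand (inverse u)) = - (expand (D 1 u) * expand (inverse u))"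
          by (simp add: eq_neg_iff_add_eq_0)
        moreover have "0 = expand (D 1 (u * inverse u))" using D_i[of 1 1] False by simp
        hence "expand u * expand (D 1 (inverse u)) = - (expand (D 1 u) * expand (inverse u))"
          unfolding D1_mult by (simp add: ex.hom_add ex.hom_mult eq_neg_iff_add_eq_0 add.commute)
        moreover have "expand u \<noteq> 0" using 1 by auto
        ultimately show ?thesis by (metis mult_left_cancel)
      qed
      fix v assume v: "fps_deriv (expand v) = expand (D 1 v)"
      show "fps_deriv (expand (u + v)) = expand (D 1 (u + v))"
        using u v by (simp add: D_add ex.hom_add)
      show "fps_deriv (expand (u * v)) = expand (D 1 (u * v))"
        unfolding D1_mult using u v by (simp add: ex.hom_add ex.hom_mult algebra_simps)
    qed
    show "y \<in> ?S"
    proof -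
      have "eval_at \<iota> x P \<in> ?S" for P
      proof (induction P)
        case 0 show ?case using i01 by simp
      next
        case (pCons d P)
        have "\<iota> d \<in> ?S" using c by blast
        thus ?case unfolding eval_at_pCons[OF hom_i]
          by (intro is_subfield_add[OF s] is_subfield_mult[OF s] X pCons.IH)
      qed
      hence "fps_deriv (expand (y ^ m)) = expand (D 1 (y ^ m))" by (simp only: y_power mem_Collect_eq)
      moreover have "fps_deriv (expand (y ^ m)) = of_nat m * fps_deriv (expand y) * expand y ^ (m - 1)"
        by (simp only: ex.hom_power fps_deriv_power fps_of_nat)
      moreover have "expand (D 1 (y ^ m)) = of_nat m * expand (D 1 y) * expand y ^ (m - 1)"
        by (simp only: D1_power ex.hom_power ex.hom_mult ex.hom_of_nat mult_ac)
      ultimately have "expand y ^ (m - 1) * (of_nat m * fps_deriv (expand y)) =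
          expand y ^ (m - 1) * (of_nat m * expand (D 1 y))"
        by (simp only: mult_ac)
      moreover have "expand y \<noteq> 0" using arg_cong[of _ _ "\<lambda>h. h $ 0"] expand_nth0 y0
        by (metis fps_zero_nth)
      moreover have "of_nat m \<noteq> (0 :: 'f fps)"
        using of_nat_m by (simp flip: fps_of_nat)
      ultimately have "fps_deriv (expand y) = expand (D 1 y)"
        by (simp only: mult_left_cancel power_not_zero not_False_eq_True)
      thus ?thesis by simp
    qed
  qed
  thus ?thesis by auto
qed

text \<open>Coefficients of \<open>fps_deriv_expand\<close> give D j (D 1 g) = (j + 1) D (j + 1) g.
  Exchanging the two operators costs a division by k + 1 at each inductive step, allowed below
  \<open>p\<close>.\<close>

lemma D1_D:
  assumes "k < p"
  shows "D 1 (D k f) = of_nat (Suc k) * D (Suc k) f"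
  using assms
proof (induction k arbitrary: f)
  case (Suc k)
  have comm: "D j (D 1 g) = of_nat (Suc j) * D (Suc j) g" for j g
    using arg_cong[OF fps_deriv_expand[of g], of "\<lambda>h. h $ j"] by (simp add: D_expand mult.commute)
  have "of_nat (Suc k) * D 1 (D (Suc k) f) = D 1 (of_nat (Suc k) * D (Suc k) f)"
    using D_i[of 1 "of_nat (Suc k)"] by (simp only: D1_mult i.hom_of_nat) simp
  also have "\<dots> = D 1 (D k (D 1 f))" by (simp only: comm)
  also have "\<dots> = of_nat (Suc k) * D (Suc k) (D 1 f)" using Suc by simp
  finally have "D 1 (D (Suc k) f) = D (Suc k) (D 1 f)"
    using Suc.prems of_nat_f_eq_0_iff[of "Suc k"] by (auto dest: dvd_imp_le simp del: of_nat_Suc)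
  thus ?case by (simp only: comm)
qed simp

end

section \<open>Determinants and order sequences\<close>

text \<open>In the applications the columns are indexed by monomials, so a relation c among the
  columns is the coefficient vector of a curve that satisfies one linear condition for each
  row.\<close>

lemma det_mat_eq_0_iff:
  fixes g :: "nat \<times> nat \<Rightarrow> 'a::field"
  shows "det (mat N N g) = 0 \<longleftrightarrow>
    (\<exists>c. (\<exists>j<N. c j \<noteq> 0) \<and> (\<forall>i<N. (\<Sum>j<N. c j * g (i, j)) = 0))"
proof -
  have *: "(mat N N g *\<^sub>v v = 0\<^sub>v N) \<longleftrightarrow> (\<forall>i<N. (\<Sum>j<N. vec_index v j * g (i, j)) = 0)"
    if "v \<in> carrier_vec N" for v
    using that by (auto simp: vec_eq_iff scalar_prod_def atLeast0LessThan mult.commute)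
  have **: "v \<noteq> 0\<^sub>v N \<longleftrightarrow> (\<exists>j<N. vec_index v j \<noteq> 0)" if "v \<in> carrier_vec N" for v :: "'a vec"
    using that by (auto simp: vec_eq_iff)
  have "det (mat N N g) = 0 \<longleftrightarrow>
    (\<exists>v. v \<in> carrier_vec N \<and> v \<noteq> 0\<^sub>v N \<and> mat N N g *\<^sub>v v = 0\<^sub>v N)"
    by (rule det_0_iff_vec_prod_zero_field) simp
  also have "\<dots> \<longleftrightarrow> (\<exists>c. (\<exists>j<N. c j \<noteq> 0) \<and> (\<forall>i<N. (\<Sum>j<N. c j * g (i, j)) = 0))"
  proof
    assume "\<exists>v. v \<in> carrier_vec N \<and> v \<noteq> 0\<^sub>v N \<and> mat N N g *\<^sub>v v = 0\<^sub>v N"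
    then obtain v where "v \<in> carrier_vec N" "v \<noteq> 0\<^sub>v N" "mat N N g *\<^sub>v v = 0\<^sub>v N" by blast
    thus "\<exists>c. (\<exists>j<N. c j \<noteq> 0) \<and> (\<forall>i<N. (\<Sum>j<N. c j * g (i, j)) = 0)"
      by (intro exI[of _ "vec_index v"]) (simp add: * **)
  next
    assume "\<exists>c. (\<exists>j<N. c j \<noteq> 0) \<and> (\<forall>i<N. (\<Sum>j<N. c j * g (i, j)) = 0)"
    then obtain c where "\<exists>j<N. c j \<noteq> 0" "\<forall>i<N. (\<Sum>j<N. c j * g (i, j)) = 0" by blast
    thus "\<exists>v. v \<in> carrier_vec N \<and> v \<noteq> 0\<^sub>v N \<and> mat N N g *\<^sub>v v = 0\<^sub>v N"
      by (intro exI[of _ "vec N c"]) (auto simp: * **)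
  qed
  finally show ?thesis .
qed

text \<open>A new row is found by pairing all candidates with the vector of cofactors of the last row.\<close>
lemma extend_to_nonsingular:
  fixes V :: "nat \<Rightarrow> nat \<Rightarrow> 'a::field"
  assumes v: "v 0 \<noteq> 0"
    and indep: "\<And>c. (\<And>k. (\<Sum>j<N. c j * V k j) = 0) \<Longrightarrow> \<forall>j<N. c j = 0"
    and "r < N"
  shows "\<exists>ks. length ks = r \<and>
    det (mat (Suc r) (Suc r) (\<lambda>(i, j). if i = 0 then v j else V (ks ! (i - 1)) j)) \<noteq> 0"
  using \<open>r < N\<close>
proof (induction r)
  case 0
  have "det (mat (Suc 0) (Suc 0) (\<lambda>(i, j). if i = 0 then v j else V ([] ! (i - 1)) j)) \<noteq> 0"
    using v by (simp add: det_mat_eq_0_iff)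
  thus ?case by (intro exI[of _ "[]"]) simp
next
  case (Suc r)
  from Suc.IH[OF Suc_lessD[OF Suc.prems]] obtain ks where ks: "length ks = r"
    "det (mat (Suc r) (Suc r) (\<lambda>(i, j). if i = 0 then v j else V (ks ! (i - 1)) j)) \<noteq> 0"
    by (elim exE conjE)
  define M where "M = (\<lambda>k. mat (Suc (Suc r)) (Suc (Suc r))
    (\<lambda>(i, j). if i = 0 then v j else V ((ks @ [k]) ! (i - 1)) j))"
  \<comment> \<open>Cofactors of the last row do not involve that row, so one vector c serves all
    candidates; its last entry is the determinant from the induction hypothesis.\<close>
  have del: "mat_delete (M k) (Suc r) j = mat_delete (M 0) (Suc r) j" for k j
    using ks(1) by (intro eq_matI) (auto simp: mat_delete_def M_def nth_append)
  have del_last: "mat_delete (M 0) (Suc r) (Suc r) =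
      mat (Suc r) (Suc r) (\<lambda>(i, j). if i = 0 then v j else V (ks ! (i - 1)) j)"
    using ks(1) by (intro eq_matI) (auto simp: mat_delete_def M_def nth_append)
  define c where "c = (\<lambda>j. if j < Suc (Suc r) then cofactor (M 0) (Suc r) j else 0)"
  have det: "det (M k) = (\<Sum>j<N. c j * V k j)" for k
  proof -
    have "det (M k) = (\<Sum>j<Suc (Suc r). M k $$ (Suc r, j) * cofactor (M k) (Suc r) j)"
      by (rule laplace_expansion_row) (auto simp: M_def)
    also have "\<dots> = (\<Sum>j<Suc (Suc r). c j * V k j)"
    proof (intro sum.cong refl)
      fix j assume "j \<in> {..<Suc (Suc r)}"
      moreover from this have "M k $$ (Suc r, j) = V k j" using ks(1) by (simp add: M_def nth_append)
      ultimately show "M k $$ (Suc r, j) * cofactor (M k) (Suc r) j = c j * V k j"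
        by (simp add: c_def cofactor_def del[of k])
    qed
    also have "\<dots> = (\<Sum>j<N. c j * V k j)"
      using Suc.prems by (intro sum.mono_neutral_left) (auto simp: c_def)
    finally show ?thesis .
  qed
  have "c (Suc r) \<noteq> 0" using ks(2) by (simp add: c_def cofactor_def del_last)
  have "\<exists>k. (\<Sum>j<N. c j * V k j) \<noteq> 0"
  proof (rule ccontr)
    assume no: "\<not> ?thesis"
    have "\<forall>j<N. c j = 0" by (rule indep) (use no in simp)
    thus False using \<open>c (Suc r) \<noteq> 0\<close> Suc.prems by simp
  qed
  then obtain k where "(\<Sum>j<N. c j * V k j) \<noteq> 0" by (elim exE)
  hence "det (M k) \<noteq> 0" by (simp only: det not_False_eq_True)
  thus ?case unfolding M_def using ks(1)
    by (intro exI[of _ "ks @ [k]"] conjI) simp_all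
qed

text \<open>Order sequences must increase. A nonzero determinant has distinct rows, and its being
  nonzero depends only on the set of rows, so the list found may be sorted.\<close>

lemma extend_to_nonsingular_sorted:
  fixes V :: "nat \<Rightarrow> nat \<Rightarrow> 'a::field"
  assumes v: "v 0 \<noteq> 0"
    and indep: "\<And>c. (\<And>k. (\<Sum>j<Suc r. c j * V k j) = 0) \<Longrightarrow> \<forall>j<Suc r. c j = 0"
  shows "\<exists>ks. length ks = r \<and> sorted_wrt (<) ks \<and>
    det (mat (Suc r) (Suc r) (\<lambda>(i, j). if i = 0 then v j else V (ks ! (i - 1)) j)) \<noteq> 0"
proof -
  define M where "M = (\<lambda>ks. mat (Suc r) (Suc r) (\<lambda>(i, j). if i = 0 then v j else V (ks ! (i - 1)) j))"
  have "\<exists>ks. length ks = r \<and> det (M ks) \<noteq> 0"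
    unfolding M_def
  proof (rule extend_to_nonsingular)
    fix c assume "\<And>k. (\<Sum>j<Suc r. c j * V k j) = 0"
    thus "\<forall>j<Suc r. c j = 0" by (rule indep)
  qed (simp_all add: v)
  then obtain ks where ks: "length ks = r" "det (M ks) \<noteq> 0" by blast
  have "distinct ks"
  proof (rule ccontr)
    assume "\<not> distinct ks"
    then obtain i j where ij: "i < r" "j < r" "i \<noteq> j" "ks ! i = ks ! j"
      using ks(1) by (auto simp: distinct_conv_nth)
    have "det (M ks) = 0"
      by (rule det_identical_rows[of _ "Suc r" "Suc i" "Suc j"]) (use ij in \<open>auto simp: M_def\<close>)
    thus False using ks by simp
  qed
  define ls where "ls = sorted_list_of_set (set ks)"
  have ls: "length ls = r" "sorted_wrt (<) ls" "set ls = set ks"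
    using ks(1) \<open>distinct ks\<close> by (simp_all add: ls_def distinct_card)
  have rows: "(\<forall>i<Suc r. (\<Sum>j<Suc r. c j * (if i = 0 then v j else V (l ! (i - 1)) j)) = 0) \<longleftrightarrow>
      (\<Sum>j<Suc r. c j * v j) = 0 \<and> (\<forall>k\<in>set l. (\<Sum>j<Suc r. c j * V k j) = 0)"
    if "length l = r" for c l
  proof -
    have *: "(\<forall>i<r. Q (l ! i)) \<longleftrightarrow> (\<forall>k\<in>set l. Q k)" for Q :: "nat \<Rightarrow> bool"
      using that by (simp add: all_set_conv_all_nth)
    show ?thesis
      unfolding All_less_Suc2 using *[of "\<lambda>k. (\<Sum>j<Suc r. c j * V k j) = 0"]
      by (simp del: sum.lessThan_Suc)
  qed
  have "det (M ls) = 0 \<longleftrightarrow> det (M ks) = 0"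
    unfolding M_def det_mat_eq_0_iff prod.case rows[OF ls(1)] rows[OF ks(1)] ls(3) ..
  hence "det (M ls) \<noteq> 0" using ks(2) by simp
  thus ?thesis using ls unfolding M_def by (intro exI[of _ ls]) simp
qed

lemma lex_least_exists:
  fixes P :: "nat list \<Rightarrow> bool"
  assumes "\<And>l. P l \<Longrightarrow> length l = r" and "P l0"
  shows "\<exists>l. P l \<and> (\<forall>e. P e \<and> e \<noteq> l \<longrightarrow> lex_less l e)"
proof -
  have "wf (lexn less_than r)" by (rule wf_lexn) simp
  then obtain l where l: "P l" "\<And>e. (e, l) \<in> lexn less_than r \<Longrightarrow> \<not> P e"
    using assms(2) by (elim wfE_min[of _ l0 "Collect P"]) auto
  have "lex_less l e" if e: "P e" "e \<noteq> l" for e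
  proof -
    have len: "length e = r" "length l = r" using assms(1) e l by auto
    define i where "i = (LEAST i. i < r \<and> e ! i \<noteq> l ! i)"
    have "\<exists>i. i < r \<and> e ! i \<noteq> l ! i"
    proof (rule ccontr)
      assume "\<not> ?thesis"
      hence "e = l" using len by (intro nth_equalityI) auto
      thus False using e(2) by simp
    qed
    from LeastI_ex[OF this] have i: "i < r" "e ! i \<noteq> l ! i" unfolding i_def by auto
    have i_min: "e ! j = l ! j" if "j < i" for j
      using not_less_Least[OF that[unfolded i_def]] that i(1) by simp
    have take: "take i l = take i e"
      using i(1) i_min len by (intro nth_equalityI) simp_all
    have "\<not> e ! i < l ! i"
    proof
      assume less: "e ! i < l ! i"
      have "e = take i l @ e ! i # drop (Suc i) e" "l = take i l @ l ! i # drop (Suc i) l"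
        using id_take_nth_drop[of i e] id_take_nth_drop[of i l] i(1) len take by simp_all
      moreover have "(e ! i, l ! i) \<in> less_than" using less by simp
      ultimately have "(e, l) \<in> lexn less_than r"
        unfolding lexn_conv mem_Collect_eq prod.case using len by blast
      thus False using l e by blast
    qed
    thus ?thesis unfolding lex_less_def using i take len by (intro exI[of _ i]) simp
  qed
  thus ?thesis using l by blast
qed

section \<open>The determinants of the linear system of conics\<close>

lemma mon_exps_2: "mon_exps 2 = [(0,0), (0,1), (1,0), (0,2), (1,1), (2,0)]"
  by (simp add: mon_exps_def numeral_2_eq_2)

lemma phi_2:
  "phi x y 2 0 = 1" "phi x y 2 (Suc 0) = y" "phi x y 2 2 = x" 
  "phi x y 2 3 = y ^ 2" "phi x y 2 4 = x * y" "phi x y 2 5 = x ^ 2"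
  by (simp_all add: phi_def mon_exps_2)

lemma sum_lessThan_6: "(\<Sum>j<6. g j) = g 0 + g (Suc 0) + g 2 + g 3 + g 4 + (g 5 :: 'a::comm_monoid_add)"
  by (simp add: lessThan_nat_numeral lessThan_Suc add_ac)

context curve begin

lemma frob_det_eq_0_iff:
  assumes "length nu = 5"
  shows "frob_det D q x y 2 nu = 0 \<longleftrightarrow> (\<exists>c. (\<exists>j<6. c j \<noteq> 0) \<and>
     (\<Sum>j<6. c j * phi x y 2 j ^ q) = 0 \<and> (\<forall>k\<in>set nu. (\<Sum>j<6. c j * D k (phi x y 2 j)) = 0))"
proof -
  have rows: "(\<forall>i<Suc 5. (\<Sum>j<6. c j * (if i = 0 then phi x y 2 j ^ q else D (nu ! (i - 1)) (phi x y 2 j))) = 0) \<longleftrightarrow>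
      (\<Sum>j<6. c j * phi x y 2 j ^ q) = 0 \<and> (\<forall>k\<in>set nu. (\<Sum>j<6. c j * D k (phi x y 2 j)) = 0)"
    for c
    using assms unfolding All_less_Suc2 all_set_conv_all_nth[of nu] by auto
  have "length (mon_exps 2) = 6" by (simp add: mon_exps_2)
  thus ?thesis unfolding frob_det_def det_mat_eq_0_iff prod.case using rows by simp
qed

text \<open>A conic through all infinitely near points would make \<open>1, yT, yT ^ 2\<close> dependent.\<close>
lemma no_osculating_conic:
  assumes c: "\<And>k. (\<Sum>j<6. c j * D k (phi x y 2 j)) = 0"
  shows "\<forall>j<6. c j = 0"
proof -
  have hc: "comm_ring_hom (fps_const :: 'f \<Rightarrow> _)" by unfold_locales auto
  have tr: "eval_at fps_const xT P \<noteq> 0" if "P \<noteq> 0" for P :: "'f poly"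
  proof -
    \<comment> \<open>Evaluation at \<open>xT\<close> is the Taylor shift P(x + T), which is zero
      only for P = 0: \<open>xT\<close> is transcendental over the field of constant series.\<close>
    have "eval_at fps_const xT P = fps_of_poly (pcompose P [:x, 1:])"
      by (induction P) (auto simp: eval_at_pCons[OF hc] fps_of_poly_add fps_of_poly_mult pcompose_pCons
          xT_def fps_of_poly_pCons)
    moreover have "pcompose P [:x, 1:] \<noteq> 0" using that pcompose_eq_0[of P "[:x, 1:]"] by auto
    ultimately show ?thesis by simp
  qed
  have m3: "{..<m} = insert 0 (insert 1 (insert 2 {3..<m}))" using m2 by auto
  obtain \<rho> g where F: "F = [:-\<rho>, 1:] * g" "poly g \<rho> \<noteq> 0" using F_root by blast
  interpret mi: map_poly_comm_ring_hom \<iota> ..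
  have Y: "yT ^ m = eval_at fps_const xT (map_poly \<iota> F)"
  proof -
    have "eval_at cst xT F = eval_at fps_const xT (map_poly \<iota> F)"
      by (simp add: eval_at_def map_poly_map_poly comp_def cst_def[abs_def])
    thus ?thesis using yT by simp
  qed
  have Fi: "map_poly \<iota> F = [:- \<iota> \<rho>, 1:] * map_poly \<iota> g"
    unfolding F(1) by (simp add: hom_distribs)
  have gi: "poly (map_poly \<iota> g) (\<iota> \<rho>) \<noteq> 0" using F(2) by simp
  \<comment> \<open>The conic sorted by powers of \<open>yT\<close>. Its degree in \<open>yT\<close>
    is at most 2, which is below \<open>m\<close>, so independence of the powers applies.\<close>
  define A where "A = (\<lambda>j::nat. if j = 0 then [:c 0, c 2, c 5:] else if j = 1 then [:c 1, c 4:]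
    else if j = 2 then [:c 3:] else 0)"
  have "(\<Sum>j<6. fps_const (c j) * expand (phi x y 2 j)) = 0"
    using c by (intro fps_ext) (simp add: fps_sum_nth D_expand)
  hence "(\<Sum>j<m. eval_at fps_const xT (A j) * yT ^ j) = 0"
    unfolding m3 by (simp add: A_def sum_lessThan_6 phi_2 ex.hom_mult ex.hom_power expand_x expand_y hc
       eval_at_pCons algebra_simps power2_eq_square)
  from radical_powers_independent[OF hc tr Y Fi gi this]
  have "A 0 = 0" "A 1 = 0" "A 2 = 0" using m2 by auto
  hence "c 0 = 0" "c 1 = 0" "c 2 = 0" "c 3 = 0" "c 4 = 0" "c 5 = 0" by (auto simp: A_def)
  thus ?thesis by (auto simp: eval_nat_numeral less_Suc_eq)
qed

text \<open>A strictly increasing sequence has i-th entry at least i, so 0, ..., 4 precedes all its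
  competitors and is the order sequence as soon as its determinant is nonzero. Conversely some order
  sequence always exists, because no conic has infinite contact.\<close>

lemma frob_nonclassical_iff:
  "frob_nonclassical_wrt D q x y 2 \<longleftrightarrow> frob_det D q x y 2 [0..<5] = 0"
proof
  have len: "length (mon_exps 2) = 6" by (simp add: mon_exps_2)
  {
    assume "frob_nonclassical_wrt D q x y 2"
    then obtain nu where nu: "is_frob_order_seq D q x y 2 nu" "nu \<noteq> [0..<5]"
      by (auto simp: frob_nonclassical_wrt_def len)
    show "frob_det D q x y 2 [0..<5] = 0"
    proof (rule ccontr)
      assume "frob_det D q x y 2 [0..<5] \<noteq> 0"
      hence "lex_less nu [0..<5]" using nu by (auto simp: is_frob_order_seq_def len strict_inc_def)
      moreover have "length nu = 5" "sorted_wrt (<) nu"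
        using nu by (auto simp: is_frob_order_seq_def len strict_inc_def)
      moreover have "i \<le> nu ! i" if "i < 5" for i using that
      proof (induction i)
        case (Suc i)
        have "nu ! i < nu ! Suc i" 
          using Suc.prems \<open>length nu = 5\<close> \<open>sorted_wrt (<) nu\<close> by (simp add: sorted_wrt_iff_nth_less)
        thus ?case using Suc by simp
      qed simp
      ultimately show False by (fastforce simp: lex_less_def)
    qed
  next
    assume det0: "frob_det D q x y 2 [0..<5] = 0"
    have "\<exists>ks. length ks = 5 \<and> sorted_wrt (<) ks \<and>
      det (mat (Suc 5) (Suc 5) (\<lambda>(i, j). if i = 0 then phi x y 2 j ^ q else D (ks ! (i - 1)) (phi x y 2 j))) \<noteq> 0"
    proof (rule extend_to_nonsingular_sorted)
      fix c assume "\<And>k. (\<Sum>j<Suc 5. c j * D k (phi x y 2 j)) = 0"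
      thus "\<forall>j<Suc 5. c j = 0" using no_osculating_conic[of c] by simp
    qed (simp add: phi_2)
    hence "\<exists>ks. length ks = 5 \<and> strict_inc ks \<and> frob_det D q x y 2 ks \<noteq> 0"
      by (simp add: frob_det_def len strict_inc_def)
    then obtain nu where "is_frob_order_seq D q x y 2 nu"
      using lex_least_exists[of "\<lambda>ks. length ks = 5 \<and> strict_inc ks \<and> frob_det D q x y 2 ks \<noteq> 0" 5]
      unfolding is_frob_order_seq_def len by auto
    moreover from this have "nu \<noteq> [0..<5]" using det0 by (auto simp: is_frob_order_seq_def)
    ultimately show "frob_nonclassical_wrt D q x y 2"
      by (auto simp: frob_nonclassical_wrt_def len)
  }
qed

end

section \<open>The osculating conic\<close>

text \<open>Here \<open>a1\<close> to \<open>a4\<close> are the Hasse derivatives of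
  \<open>y\<close>, and \<open>d\<close> is the partial derivative of the conic in its second
  variable at (\<open>x\<close>, \<open>y\<close>). In the coordinates u and v along the tangent,
  the contact conditions express every coefficient through \<open>d\<close>; the factor a2 ^ 3
  clears the denominators.\<close>

lemma conic_taylor:
  fixes c0 :: "'a::idom"
  assumes d: "d = c1 + 2 * c3 * y + c4 * x"
    and e0: "c0 + c1 * y + c2 * x + c3 * y ^ 2 + c4 * (x * y) + c5 * x ^ 2 = 0"
    and e1: "d * a1 + c2 + c4 * y + 2 * c5 * x = 0"
    and e2: "d * a2 + c3 * a1 ^ 2 + c4 * a1 + c5 = 0"
    and e3: "d * a3 + 2 * c3 * a1 * a2 + c4 * a2 = 0"
    and e4: "d * a4 + 2 * c3 * a1 * a3 + c3 * a2 ^ 2 + c4 * a3 = 0"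
    and X: "X = x + u" and Y: "Y = y + a1 * u + v"
  shows "a2 ^ 3 * (c0 + c1 * Y + c2 * X + c3 * Y ^ 2 + c4 * (X * Y) + c5 * X ^ 2) =
    d * (a2 ^ 3 * v - a2 ^ 4 * u ^ 2 - a2 ^ 2 * a3 * u * v - (a2 * a4 - a3 ^ 2) * v ^ 2)"
proof -
  have "c0 + c1 * Y + c2 * X + c3 * Y ^ 2 + c4 * (X * Y) + c5 * X ^ 2 =
     (c0 + c1 * y + c2 * x + c3 * y ^ 2 + c4 * (x * y) + c5 * x ^ 2)
     + (d * a1 + c2 + c4 * y + 2 * c5 * x) * u + d * v
     + (c3 * a1 ^ 2 + c4 * a1 + c5) * u ^ 2
     + (2 * c3 * a1 + c4) * u * v + c3 * v ^ 2"
    unfolding X Y d by Groebner_Basis.algebra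
  hence *: "c0 + c1 * Y + c2 * X + c3 * Y ^ 2 + c4 * (X * Y) + c5 * X ^ 2 =
     d * v + (c3 * a1 ^ 2 + c4 * a1 + c5) * u ^ 2 + (2 * c3 * a1 + c4) * u * v + c3 * v ^ 2"
    unfolding e0 e1 by simp
  have e2': "c3 * a1 ^ 2 + c4 * a1 + c5 = - (d * a2)" using e2 by Groebner_Basis.algebra
  have e3': "a2 * (2 * c3 * a1 + c4) = - (d * a3)" using e3 by Groebner_Basis.algebra
  have e4': "a2 ^ 3 * c3 = - (d * (a2 * a4 - a3 ^ 2))" using e4 e3' by Groebner_Basis.algebra
  have "a2 ^ 3 * (d * v + (c3 * a1 ^ 2 + c4 * a1 + c5) * u ^ 2 + (2 * c3 * a1 + c4) * u * v + c3 * v ^ 2) =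
     d * (a2 ^ 3 * v) + a2 ^ 3 * (c3 * a1 ^ 2 + c4 * a1 + c5) * u ^ 2
     + a2 ^ 2 * (a2 * (2 * c3 * a1 + c4)) * u * v + a2 ^ 3 * c3 * v ^ 2"
    by Groebner_Basis.algebra
  thus ?thesis unfolding * e2' e3' e4' by Groebner_Basis.algebra
qed

text \<open>The first assumption is the derivative of the second, with u' = - 1, v' = - 2 a2 u and
  a_k' = (k + 1) a_(k + 1). Elimination between the two leaves v^2 times the expression of
  Monge.\<close>

lemma monge_algebra:
  fixes a2 :: "'a::idom"
  assumes "(3 * a2 ^ 2 * (3 * a3) * v + a2 ^ 3 * (- 2 * a2 * u))
    - (4 * a2 ^ 3 * (3 * a3) * u ^ 2 + a2 ^ 4 * (2 * u * - 1))
    - (((2 * a2 * (3 * a3) * a3 + a2 ^ 2 * (4 * a4)) * u + a2 ^ 2 * a3 * - 1) * v + a2 ^ 2 * a3 * u * (- 2 * a2 * u))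
    - ((3 * a3 * a4 + a2 * (5 * a5) - 2 * a3 * (4 * a4)) * v ^ 2 + (a2 * a4 - a3 ^ 2) * (2 * v * (- 2 * a2 * u))) = 0"
    and "a2 ^ 3 * v - a2 ^ 4 * u ^ 2 - a2 ^ 2 * a3 * u * v - (a2 * a4 - a3 ^ 2) * v ^ 2 = 0"
  shows "5 * v ^ 2 * (a2 ^ 2 * a5 - 3 * a2 * a3 * a4 + 2 * a3 ^ 3) = 0"
  using assms by Groebner_Basis.algebra

context curve begin

lemma D_one: "D k 1 = (if k = 0 then 1 else 0)"
  using D_i[of k 1] by simp

lemma D_x_all: "D k x = (if k = 0 then x else if k = 1 then 1 else 0)"
  using D_x by (simp add: not_less_eq_eq numeral_2_eq_2)

lemma sum_le_numeral:
  fixes g :: "nat \<Rightarrow> 'a::comm_monoid_add"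
  shows "(\<Sum>i\<le>1. g i) = g 0 + g 1"
    and "(\<Sum>i\<le>2. g i) = g 0 + g 1 + g 2"
    and "(\<Sum>i\<le>3. g i) = g 0 + g 1 + g 2 + g 3"
    and "(\<Sum>i\<le>4. g i) = g 0 + g 1 + g 2 + g 3 + g 4"
  by (simp_all add: numeral_eq_Suc flip: add.assoc)

lemma osculating_equations:
  assumes c: "\<forall>k<5. (\<Sum>j<6. c j * D k (phi x y 2 j)) = 0"
  defines "d \<equiv> c (Suc 0) + 2 * c 3 * y + c 4 * x"
  shows "c 0 + c (Suc 0) * y + c 2 * x + c 3 * y ^ 2 + c 4 * (x * y) + c 5 * x ^ 2 = 0"
    and "d * D 1 y + c 2 + c 4 * y + 2 * c 5 * x = 0"
    and "d * D 2 y + c 3 * D 1 y ^ 2 + c 4 * D 1 y + c 5 = 0"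
    and "d * D 3 y + 2 * c 3 * D 1 y * D 2 y + c 4 * D 2 y = 0"
    and "d * D 4 y + 2 * c 3 * D 1 y * D 3 y + c 3 * D 2 y ^ 2 + c 4 * D 3 y = 0"
proof -
  have c': "(\<Sum>j<6. c j * D k (phi x y 2 j)) = 0" if "k < 5" for k using c that by blast
  note s = sum_lessThan_6 phi_2 power2_eq_square D_mult sum_le_numeral D_x_all D_one d_def
  show "c 0 + c (Suc 0) * y + c 2 * x + c 3 * y ^ 2 + c 4 * (x * y) + c 5 * x ^ 2 = 0"
    using c'[of 0] unfolding s by simp
  show "d * D 1 y + c 2 + c 4 * y + 2 * c 5 * x = 0"
    using c'[of 1] unfolding s by (simp add: algebra_simps)
  show "d * D 2 y + c 3 * D 1 y ^ 2 + c 4 * D 1 y + c 5 = 0"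
    using c'[of 2] unfolding s by (simp add: algebra_simps)
  show "d * D 3 y + 2 * c 3 * D 1 y * D 2 y + c 4 * D 2 y = 0"
    using c'[of 3] unfolding s by (simp add: algebra_simps)
  show "d * D 4 y + 2 * c 3 * D 1 y * D 3 y + c 3 * D 2 y ^ 2 + c 4 * D 3 y = 0"
    using c'[of 4] unfolding s by (simp add: algebra_simps)
qed

text \<open>The conic with contact of order five at the generic point, in the Taylor coordinates
  \<open>X - x\<close> and \<open>Y - y - D 1 y * (X - x)\<close>.\<close>
definition osc :: "'f \<Rightarrow> 'f \<Rightarrow> 'f" where
  "osc X Y = (let \<xi> = X - x; \<eta> = Y - y - D 1 y * \<xi> in
     D 2 y ^ 3 * \<eta> - D 2 y ^ 4 * \<xi> ^ 2 - D 2 y ^ 2 * D 3 y * \<xi> * \<eta>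
     - (D 2 y * D 4 y - D 3 y ^ 2) * \<eta> ^ 2)"

text \<open>Any conic of contact five is a multiple of \<open>osc\<close>, so incidence can be
  tested on \<open>osc\<close> or on whichever such conic is easiest to write down.\<close>

lemma conic_eq_osc:
  assumes c: "\<forall>k<5. (\<Sum>j<6. c j * D k (phi x y 2 j)) = 0"
  defines "d \<equiv> c (Suc 0) + 2 * c 3 * y + c 4 * x"
  shows "D 2 y ^ 3 * (c 0 + c (Suc 0) * Y + c 2 * X + c 3 * Y ^ 2 + c 4 * (X * Y) + c 5 * X ^ 2)
    = d * osc X Y"
  unfolding osc_def Let_def d_def
  by (rule conic_taylor[OF refl osculating_equations[OF c]]) simp_all

text \<open>The equations of order 3 and 4 first kill the coefficients of the part of the conic that
  involves y^2 and xy; the others follow one by one.\<close>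

lemma conic_degenerate:
  assumes c: "\<forall>k<5. (\<Sum>j<6. c j * D k (phi x y 2 j)) = 0" and D2: "D 2 y \<noteq> 0"
    and d: "c (Suc 0) + 2 * c 3 * y + c 4 * x = 0"
  shows "\<forall>j<6. c j = 0"
proof -
  note e = osculating_equations[OF c, unfolded d]
  have "D 2 y * (2 * c 3 * D 1 y + c 4) = 0" using e(4) by (simp add: algebra_simps)
  hence 1: "2 * c 3 * D 1 y + c 4 = 0" using D2 by simp
  have "D 3 y * (2 * c 3 * D 1 y + c 4) + D 2 y ^ 2 * c 3 = 0" using e(5) by (simp add: algebra_simps)
  hence "D 2 y ^ 2 * c 3 = 0" unfolding 1 by simp
  hence c3: "c 3 = 0" using D2 by simp
  hence c4: "c 4 = 0" using 1 by simp
  hence c5: "c 5 = 0" using e(3) c3 by simp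
  have c1: "c (Suc 0) = 0" using d c3 c4 by simp
  have c2: "c 2 = 0" using e(2) c4 c5 by simp
  have "c 0 = 0" using e(1) c1 c2 c3 c4 c5 by simp
  thus ?thesis using c1 c2 c3 c4 c5 by (auto simp: eval_nat_numeral less_Suc_eq)
qed

lemma osc_eq_0_if_frob_det:
  assumes D2: "D 2 y \<noteq> 0" and "frob_det D q x y 2 [0..<5] = 0"
  shows "osc (x ^ q) (y ^ q) = 0"
proof -
  have "length [0..<5] = 5" by simp
  from iffD1[OF frob_det_eq_0_iff[OF this] assms(2)] obtain c where
    c: "(\<exists>j<6. c j \<noteq> 0) \<and> (\<Sum>j<6. c j * phi x y 2 j ^ q) = 0 \<and>
      (\<forall>k\<in>set [0..<5]. (\<Sum>j<6. c j * D k (phi x y 2 j)) = 0)" by (elim exE)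
  hence nz: "\<exists>j<6. c j \<noteq> 0" and fr: "(\<Sum>j<6. c j * phi x y 2 j ^ q) = 0"
    and os: "\<forall>k<5. (\<Sum>j<6. c j * D k (phi x y 2 j)) = 0" by simp_all
  define d where "d = c (Suc 0) + 2 * c 3 * y + c 4 * x"
  have "d \<noteq> 0" using conic_degenerate[OF os D2] nz unfolding d_def by blast
  moreover have "c 0 + c (Suc 0) * y ^ q + c 2 * x ^ q + c 3 * (y ^ q) ^ 2 + c 4 * (x ^ q * y ^ q)
      + c 5 * (x ^ q) ^ 2 = 0"
    using fr by (simp add: sum_lessThan_6 phi_2 power_mult_distrib mult.commute flip: power_mult)
  hence "d * osc (x ^ q) (y ^ q) = 0"
    unfolding d_def conic_eq_osc[OF os, symmetric] by simp
  ultimately show ?thesis by simp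
qed

lemma D1_frob: "D 1 (f ^ (p ^ h)) = 0" if "h > 0"
  using that of_nat_f_eq_0_iff[of "p ^ h"] by (simp only: D1_power) simp

lemma D1_D_small: 
  "D 1 (D 1 y) = 2 * D 2 y" "D 1 (D 2 y) = 3 * D 3 y" "D 1 (D 3 y) = 4 * D 4 y" "D 1 (D 4 y) = 5 * D 5 y"
  using D1_D[of 1 y] D1_D[of 2 y] D1_D[of 3 y] D1_D[of 4 y] p5 by (simp_all add: numeral_2_eq_2 eval_nat_numeral)

lemma numeral_f_nonzero: "k > 0 \<Longrightarrow> k < p \<Longrightarrow> of_nat k \<noteq> (0::'f)"
  using of_nat_f_eq_0_iff[of k] by (auto dest: dvd_imp_le)

lemma x_frob_neq: "x ^ q \<noteq> x" if "q > 1"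
proof
  interpret e: comm_ring_hom "eval_at \<iota> x" by (rule comm_ring_hom_eval_at[OF hom_i])
  assume "x ^ q = x"
  hence "eval_at \<iota> x (monom 1 q - [:0, 1:]) = 0"
    by (simp add: hom_i eval_at_pCons e.hom_minus)
  hence "monom 1 q - [:0, 1::'k:] = 0" using transcendental by blast
  hence "coeff (monom 1 q - [:0, 1::'k:]) q = 0" by simp
  thus False using that by (simp add: coeff_pCons split: nat.splits)
qed

text \<open>Differentiating the osculating equation at the Frobenius image, whose coordinates are constants
  of \<open>D 1\<close>, gives the classical equation of Monge for conics.\<close>
lemma monge:
  assumes D2: "D 2 y \<noteq> 0" and osc: "osc (x ^ (p ^ h)) (y ^ (p ^ h)) = 0" and h: "h > 0"
  shows "D 2 y ^ 2 * D 5 y - 3 * D 2 y * D 3 y * D 4 y + 2 * D 3 y ^ 3 = 0"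
proof -
  define \<xi> where "\<xi> = x ^ (p ^ h) - x"
  define \<eta> where "\<eta> = y ^ (p ^ h) - y - D 1 y * \<xi>"
  define A2 A3 A4 A5 where A: "A2 = D 2 y" "A3 = D 3 y" "A4 = D 4 y" "A5 = D 5 y"
  have "p ^ h > 1" using h p5 by (intro one_less_power) auto
  hence xi0: "\<xi> \<noteq> 0" using x_frob_neq by (simp add: \<xi>_def)
  have Dxi: "D 1 \<xi> = - 1" using D_x by (simp only: \<xi>_def D_minus D1_frob[OF h]) simp
  have "D 1 \<eta> = D 1 (y ^ (p ^ h)) - D 1 y - (D 1 (D 1 y) * \<xi> + D 1 y * D 1 \<xi>)"
    by (simp only: \<eta>_def D_minus D1_mult)
  hence Deta: "D 1 \<eta> = - 2 * A2 * \<xi>" 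
    by (simp only: Dxi D1_frob[OF h] D1_D_small A) simp
  have osc': "A2 ^ 3 * \<eta> - A2 ^ 4 * \<xi> ^ 2 - A2 ^ 2 * A3 * \<xi> * \<eta> - (A2 * A4 - A3 ^ 2) * \<eta> ^ 2 = 0"
    using osc by (simp add: osc_def Let_def \<xi>_def \<eta>_def A)
  \<comment> \<open>For \<eta> = 0 the equation of the osculating conic would reduce to A2^4 \<xi>^2
    = 0.\<close>
  have eta0: "\<eta> \<noteq> 0" using osc' xi0 D2 by (auto simp: A)
  have DA: "D 1 A2 = 3 * A3" "D 1 A3 = 4 * A4" "D 1 A4 = 5 * A5"
    unfolding A by (rule D1_D_small)+
  have p2: "D 1 (z ^ 2) = 2 * z * D 1 z" and p3: "D 1 (z ^ 3) = 3 * z ^ 2 * D 1 z"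
    and p4: "D 1 (z ^ 4) = 4 * z ^ 3 * D 1 z" for z
    unfolding D1_power by simp_all
  have "D 1 0 = 0" using D_i[of 1 0] by simp
  hence "D 1 (A2 ^ 3 * \<eta> - A2 ^ 4 * \<xi> ^ 2 - A2 ^ 2 * A3 * \<xi> * \<eta> - (A2 * A4 - A3 ^ 2) * \<eta> ^ 2) = 0"
    unfolding osc' .
  hence D: "(3 * A2 ^ 2 * (3 * A3) * \<eta> + A2 ^ 3 * (- 2 * A2 * \<xi>))
    - (4 * A2 ^ 3 * (3 * A3) * \<xi> ^ 2 + A2 ^ 4 * (2 * \<xi> * - 1))
    - (((2 * A2 * (3 * A3) * A3 + A2 ^ 2 * (4 * A4)) * \<xi> + A2 ^ 2 * A3 * - 1) * \<eta> + A2 ^ 2 * A3 * \<xi> * (- 2 * A2 * \<xi>))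
    - ((3 * A3 * A4 + A2 * (5 * A5) - 2 * A3 * (4 * A4)) * \<eta> ^ 2 + (A2 * A4 - A3 ^ 2) * (2 * \<eta> * (- 2 * A2 * \<xi>))) = 0"
    by (simp only: D_minus D1_mult p2 p3 p4 DA Dxi Deta)
  have "5 * \<eta> ^ 2 * (A2 ^ 2 * A5 - 3 * A2 * A3 * A4 + 2 * A3 ^ 3) = 0"
    by (rule monge_algebra[OF D osc'])
  moreover have "(5::'f) \<noteq> 0" using numeral_f_nonzero[of 5] p5 by simp
  ultimately show ?thesis using eta0 by (simp add: A)
qed

end

section \<open>Residues of the exponents\<close>

text \<open>With \<open>s = n / m\<close> and \<open>w = a x ^ n / (b y ^ m)\<close>, the derivative of \<open>y\<close> of order \<open>k + 1\<close> is
  \<open>y * w * jet_poly n s k w / x ^ (k + 1)\<close>.\<close>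
primrec jet_poly :: "'a::field \<Rightarrow> 'a \<Rightarrow> nat \<Rightarrow> 'a poly" where
  "jet_poly N s 0 = [:- s:]"
| "jet_poly N s (Suc k) =
     [:N - of_nat (Suc k), N - s:] * jet_poly N s k + [:0, N, N:] * pderiv (jet_poly N s k)"

text \<open>The derivative in the recursion carries the factor N w (1 + w), so at 0, and likewise at
  - 1, each value is a multiple of the preceding one.\<close>

lemma poly_jet_0: "poly (jet_poly N s (Suc k)) 0 = (N - of_nat (Suc k)) * poly (jet_poly N s k) 0"
  by simp

lemma poly_jet_minus_1:
  "poly (jet_poly N s (Suc k)) (- 1) = (s - of_nat (Suc k)) * poly (jet_poly N s k) (- 1)"
  by (simp add: algebra_simps)

lemma coeff_mult_top:
  assumes "degree P \<le> i" and "degree Q \<le> j"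
  shows "coeff (P * Q) (i + j) = coeff P i * coeff Q j"
proof -
  have "coeff (P * Q) (i + j) = (\<Sum>k\<le>i + j. coeff P k * coeff Q (i + j - k))"
    by (rule coeff_mult)
  also have "\<dots> = (\<Sum>k\<in>{i}. coeff P k * coeff Q (i + j - k))"
  proof (intro sum.mono_neutral_right ballI)
    fix k assume "k \<in> {..i + j} - {i}"
    hence "k < i \<or> k > i" by auto
    thus "coeff P k * coeff Q (i + j - k) = 0" using assms by (auto simp: coeff_eq_0)
  qed auto
  finally show ?thesis by simp
qed

lemma degree_jet: "degree (jet_poly N s k) \<le> k"
proof (induction k)
  case (Suc k)
  have "degree ([:N - of_nat (Suc k), N - s:] * jet_poly N s k) \<le> 1 + k"
    using Suc by (intro order.trans[OF degree_mult_le] add_mono) auto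
  moreover have "degree ([:0, N, N:] * pderiv (jet_poly N s k)) \<le> Suc k"
  proof (cases k)
    case 0 
    hence "pderiv (jet_poly N s k) = 0" by (simp add: pderiv_pCons)
    thus ?thesis by simp
  next
    case (Suc l)
    have "degree ([:0, N, N:] * pderiv (jet_poly N s k)) \<le> 2 + l"
      using degree_pderiv_le[of "jet_poly N s k"] Suc.IH Suc \<open>degree (jet_poly N s k) \<le> k\<close>
      by (intro order.trans[OF degree_mult_le] add_mono) auto
    thus ?thesis using Suc by simp
  qed
  ultimately show ?case by (simp add: degree_add_le)
qed simp

text \<open>The two summands contribute N - s and k N; for leading terms the operator w d/dw acts as
  multiplication by the degree k.\<close>

lemma coeff_jet_top:
  "coeff (jet_poly N s (Suc k)) (Suc k) = (of_nat (Suc k) * N - s) * coeff (jet_poly N s k) k"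
proof -
  have "coeff ([:N - of_nat (Suc k), N - s:] * jet_poly N s k) (1 + k) = (N - s) * coeff (jet_poly N s k) k"
    by (subst coeff_mult_top) (auto simp: degree_jet)
  moreover have "coeff ([:0, N, N:] * pderiv (jet_poly N s k)) (Suc k) = of_nat k * N * coeff (jet_poly N s k) k"
  proof (cases k)
    case 0 thus ?thesis by (simp add: pderiv_pCons)
  next
    case (Suc l)
    have "coeff ([:0, N, N:] * pderiv (jet_poly N s k)) (2 + l) = N * coeff (pderiv (jet_poly N s k)) l"
      using degree_pderiv_le[of "jet_poly N s k"] degree_jet[of N s k] Suc
      by (subst coeff_mult_top) (auto simp: numeral_2_eq_2 simp del: jet_poly.simps)
    thus ?thesis using Suc by (simp add: coeff_pderiv algebra_simps del: jet_poly.simps)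
  qed
  ultimately show ?thesis by (simp add: algebra_simps)
qed

text \<open>The values at \<open>0\<close> and \<open>- 1\<close> and the leading coefficients each form a sequence with explicit
  ratios, so the equation of Monge reduces to a condition on these ratios.\<close>
lemma monge_ratio:
  fixes r1 :: "'a::idom"
  assumes "9 * h1 ^ 2 * h4 - 45 * h1 * h2 * h3 + 40 * h2 ^ 3 = 0"
    and "h2 = r1 * h1" "h3 = r2 * h2" "h4 = r3 * h3" and "h1 \<noteq> 0"
  shows "r1 * (9 * r2 * r3 - 45 * r1 * r2 + 40 * r1 ^ 2) = 0"
proof -
  have "h1 ^ 3 * (r1 * (9 * r2 * r3 - 45 * r1 * r2 + 40 * r1 ^ 2)) = 0"
    using assms(1-4) by Groebner_Basis.algebra
  thus ?thesis using assms(5) by simp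
qed

text \<open>The coefficients 9, 45 and 40 are those of the equation of Monge in ordinary
  derivatives; the jets 1 to 4 stand for the derivatives of order 2 to 5.\<close>

definition monge_poly :: "'a::field \<Rightarrow> 'a \<Rightarrow> 'a poly" where
  "monge_poly N s = 9 * jet_poly N s 1 ^ 2 * jet_poly N s 4 - 45 * jet_poly N s 1 * jet_poly N s 2 * jet_poly N s 3
     + 40 * jet_poly N s 2 ^ 3"

lemma poly_monge:
  "poly (monge_poly N s) z = 9 * poly (jet_poly N s 1) z ^ 2 * poly (jet_poly N s 4) z
     - 45 * poly (jet_poly N s 1) z * poly (jet_poly N s 2) z * poly (jet_poly N s 3) z
     + 40 * poly (jet_poly N s 2) z ^ 3"
  unfolding monge_poly_def by simp

text \<open>The ratios at 0 are N - 2, N - 3 and N - 4, provided that the first jet does not vanish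
  there, that is, N is not 1. Their quadratic condition is 2 (2 N - 1)(N + 1).\<close>

lemma monge_poly_0:
  fixes N s :: "'a::field"
  assumes M: "monge_poly N s = 0" and s: "s \<noteq> 0" and two: "(2::'a) \<noteq> 0"
  shows "N = 1 \<or> N = 2 \<or> 2 * N = 1 \<or> N = - 1"
proof (cases "N = 1")
  case False
  let ?h = "\<lambda>k. poly (jet_poly N s k) 0"
  have h: "?h 1 = (N - 1) * ?h 0" "?h 2 = (N - 2) * ?h 1" "?h 3 = (N - 3) * ?h 2" "?h 4 = (N - 4) * ?h 3"
    using poly_jet_0[of N s 0] poly_jet_0[of N s 1] poly_jet_0[of N s 2] poly_jet_0[of N s 3]
    by (simp_all add: numeral_eq_Suc del: jet_poly.simps)
  have h1: "?h 1 \<noteq> 0" unfolding h(1) using False s by simp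
  have "9 * ?h 1 ^ 2 * ?h 4 - 45 * ?h 1 * ?h 2 * ?h 3 + 40 * ?h 2 ^ 3 = 0"
    using poly_monge[of N s 0] M by simp
  hence "(N - 2) * (9 * (N - 3) * (N - 4) - 45 * (N - 2) * (N - 3) + 40 * (N - 2) ^ 2) = 0"
    by (rule monge_ratio[OF _ h(2-4) h1])
  hence "2 * ((N - 2) * (2 * N - 1) * (N + 1)) = 0" by Groebner_Basis.algebra
  hence "N - 2 = 0 \<or> 2 * N - 1 = 0 \<or> N + 1 = 0" using two by simp
  thus ?thesis by (auto simp: eq_neg_iff_add_eq_0)
qed simp

lemma monge_poly_minus_1:
  fixes N s :: "'a::field"
  assumes M: "monge_poly N s = 0" and s: "s \<noteq> 0" and two: "(2::'a) \<noteq> 0"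
  shows "s = 1 \<or> s = 2 \<or> 2 * s = 1 \<or> s = - 1"
proof (cases "s = 1")
  case False
  let ?h = "\<lambda>k. poly (jet_poly N s k) (- 1)"
  have h: "?h 1 = (s - 1) * ?h 0" "?h 2 = (s - 2) * ?h 1" "?h 3 = (s - 3) * ?h 2" "?h 4 = (s - 4) * ?h 3"
    using poly_jet_minus_1[of N s 0] poly_jet_minus_1[of N s 1] poly_jet_minus_1[of N s 2] poly_jet_minus_1[of N s 3]
    by (simp_all add: numeral_eq_Suc del: jet_poly.simps)
  have h1: "?h 1 \<noteq> 0" unfolding h(1) using False s by simp
  have "9 * ?h 1 ^ 2 * ?h 4 - 45 * ?h 1 * ?h 2 * ?h 3 + 40 * ?h 2 ^ 3 = 0"
    using poly_monge[of N s "- 1"] M by simp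
  hence "(s - 2) * (9 * (s - 3) * (s - 4) - 45 * (s - 2) * (s - 3) + 40 * (s - 2) ^ 2) = 0"
    by (rule monge_ratio[OF _ h(2-4) h1])
  hence "2 * ((s - 2) * (2 * s - 1) * (s + 1)) = 0" by Groebner_Basis.algebra
  hence "s - 2 = 0 \<or> 2 * s - 1 = 0 \<or> s + 1 = 0" using two by simp
  thus ?thesis by (auto simp: eq_neg_iff_add_eq_0)
qed simp

text \<open>With the ratios 2 N - s, 3 N - s and 4 N - s the quadratic condition becomes - 2 (N - 2
  s)(N + s). Divided by s, this restricts the residue of \<open>m\<close>.\<close>

lemma monge_poly_top:
  fixes N s :: "'a::field"
  assumes M: "monge_poly N s = 0" and s: "s \<noteq> 0" and two: "(2::'a) \<noteq> 0"
  shows "N = s \<or> 2 * N = s \<or> N = 2 * s \<or> N = - s"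
proof (cases "N = s")
  case False
  let ?h = "\<lambda>k. coeff (jet_poly N s k) k"
  have h: "?h 1 = (N - s) * ?h 0" "?h 2 = (2 * N - s) * ?h 1" "?h 3 = (3 * N - s) * ?h 2"
      "?h 4 = (4 * N - s) * ?h 3"
    using coeff_jet_top[of N s 0] coeff_jet_top[of N s 1] coeff_jet_top[of N s 2] coeff_jet_top[of N s 3]
    by (simp_all add: numeral_eq_Suc del: jet_poly.simps)
  have h1: "?h 1 \<noteq> 0" unfolding h(1) using False s by simp
  let ?g = "jet_poly N s"
  have d2: "degree (?g i * ?g j) \<le> i + j" for i j
    by (intro order.trans[OF degree_mult_le] add_mono degree_jet)
  have c3: "coeff (?g i * ?g j * ?g k) (i + j + k) = ?h i * ?h j * ?h k" for i j k
    by (simp add: coeff_mult_top d2 degree_jet)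
  have "coeff (monge_poly N s) 6 = 9 * ?h 1 ^ 2 * ?h 4 - 45 * ?h 1 * ?h 2 * ?h 3 + 40 * ?h 2 ^ 3"
  proof -
    have num: "numeral n * P = smult (numeral n) P" for n and P :: "'a poly"
      by (simp add: numeral_poly)
    have "monge_poly N s = smult 9 (?g 1 * ?g 1 * ?g 4) - smult 45 (?g 1 * ?g 2 * ?g 3) + smult 40 (?g 2 * ?g 2 * ?g 2)"
      by (simp only: monge_poly_def num power2_eq_square power3_eq_cube mult_smult_left mult.assoc)
    hence "coeff (monge_poly N s) 6 = 9 * coeff (?g 1 * ?g 1 * ?g 4) (1 + 1 + 4)
        - 45 * coeff (?g 1 * ?g 2 * ?g 3) (1 + 2 + 3) + 40 * coeff (?g 2 * ?g 2 * ?g 2) (2 + 2 + 2)"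
      by simp
    thus ?thesis unfolding c3 by (simp only: power2_eq_square power3_eq_cube mult.assoc)
  qed
  hence "9 * ?h 1 ^ 2 * ?h 4 - 45 * ?h 1 * ?h 2 * ?h 3 + 40 * ?h 2 ^ 3 = 0" using M by simp
  hence "(2 * N - s) * (9 * (3 * N - s) * (4 * N - s) - 45 * (2 * N - s) * (3 * N - s) + 40 * (2 * N - s) ^ 2) = 0"
    by (rule monge_ratio[OF _ h(2-4) h1])
  hence "2 * ((2 * N - s) * (N - 2 * s) * (N + s)) = 0" by Groebner_Basis.algebra
  hence "2 * N - s = 0 \<or> N - 2 * s = 0 \<or> N + s = 0" using two by simp
  thus ?thesis by (auto simp: eq_neg_iff_add_eq_0)
qed simp

text \<open>In characteristic 7 the pairs N = 2, s = 4 and N = 4, s = 2 pass all three tests, since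
  4 is one half there. A value at a fourth point, w = 1, excludes them: here it is 6 modulo 7, for
  the other pair - 1.\<close>

lemma poly_monge_2_4: "poly (monge_poly 2 4) 1 = (449280 :: 'a::field)"
  by (simp add: poly_monge numeral_eq_Suc[of "Num.Bit0 _"] numeral_eq_Suc[of "Num.Bit1 _"] pderiv_pCons)

lemma poly_monge_4_2: "poly (monge_poly 4 2) 1 = (- 630720 :: 'a::field)"
  by (simp add: poly_monge numeral_eq_Suc[of "Num.Bit0 _"] numeral_eq_Suc[of "Num.Bit1 _"] pderiv_pCons)

text \<open>The conditions at \<open>0\<close>, \<open>- 1\<close> and infinity bound \<open>n\<close>, \<open>n / m\<close> and \<open>m\<close>; only in characteristic 7
  two further pairs survive them.\<close>
lemma monge_poly_cases:
  fixes N M s :: "'a::field"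
  assumes mp: "monge_poly N s = 0" and N: "N = s * M" and s: "s \<noteq> 0" and not1: "\<not> (N = 1 \<and> M = 1)"
    and char: "(2::'a) \<noteq> 0" "(3::'a) \<noteq> 0" "(5::'a) \<noteq> 0"
  shows "(N = 2 \<and> M = 2) \<or> (2 * N = 1 \<and> 2 * M = 1) \<or> (N = - 1 \<and> M = - 1)
    \<or> (N = 1 \<and> 2 * M = 1) \<or> (N = 2 \<and> M = 1)
    \<or> (N = 1 \<and> M = 2) \<or> (2 * N = 1 \<and> M = 1) \<or> (N = 1 \<and> M = - 1) \<or> (N = - 1 \<and> M = 1)"
proof -
  have cN: "N = 1 \<or> N = 2 \<or> 2 * N = 1 \<or> N = - 1" by (rule monge_poly_0[OF mp s char(1)])
  have cs: "s = 1 \<or> s = 2 \<or> 2 * s = 1 \<or> s = - 1" by (rule monge_poly_minus_1[OF mp s char(1)])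
  have "N = s \<or> 2 * N = s \<or> N = 2 * s \<or> N = - s" by (rule monge_poly_top[OF mp s char(1)])
  hence cM: "M = 1 \<or> 2 * M = 1 \<or> M = 2 \<or> M = - 1"
  proof (elim disjE)
    assume "N = s" hence "s * (M - 1) = 0" using N by (simp add: algebra_simps)
    thus ?thesis using s by simp
  next
    assume "2 * N = s" hence "s * (2 * M - 1) = 0" using N by (simp add: algebra_simps)
    thus ?thesis using s by simp
  next
    assume "N = 2 * s" hence "s * (M - 2) = 0" using N by Groebner_Basis.algebra
    thus ?thesis using s by simp
  next
    assume "N = - s" hence "s * (M + 1) = 0" using N by Groebner_Basis.algebra
    thus ?thesis using s by (simp add: eq_neg_iff_add_eq_0)
  qed
  have nz: "(4::'a) \<noteq> 0" "(6::'a) \<noteq> 0"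
    using char mult_eq_0_iff[of "2::'a" 2] mult_eq_0_iff[of "2::'a" 3] by simp_all
  have s1: "s \<noteq> - 2"
  proof
    assume "s = - 2"
    with cs have "1 - (-2) = (0::'a) \<or> 2 - (-2) = (0::'a) \<or> 2 * (-2) - 1 = (0::'a) \<or> (-1) - (-2) = (0::'a)"
      by (metis eq_iff_diff_eq_0)
    thus False using char nz by simp
  qed
  have s2: "2 * s \<noteq> - 1"
  proof
    assume "2 * s = - 1"
    with cs have "2 * 1 - (-1) = (0::'a) \<or> 2 * 2 - (-1) = (0::'a) \<or> 1 - (-1) = (0::'a) \<or> 2 * (-1) - (-1) = (0::'a)"
      by (metis eq_iff_diff_eq_0)
    thus False using char by simp
  qed
  have s3: "\<not> (N = 2 \<and> s = 4)"
  proof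
    assume *: "N = 2 \<and> s = 4"
    with cs have "4 - 1 = (0::'a) \<or> 4 - 2 = (0::'a) \<or> 2 * 4 - 1 = (0::'a) \<or> 4 - (-1) = (0::'a)"
      by (metis eq_iff_diff_eq_0)
    hence "(7::'a) = 0" using char by simp
    moreover have "(449280::'a) = 0" using poly_monge_2_4[where 'a = 'a] mp * by simp
    ultimately have "449280 - 64182 * 7 = (0::'a)" by (simp only: mult_zero_right diff_zero)
    thus False using nz by simp
  qed
  have s4: "\<not> (2 * N = 1 \<and> 4 * s = 1)"
  proof
    assume *: "2 * N = 1 \<and> 4 * s = 1"
    hence "2 * (2 * s) = 1" by simp
    \<comment> \<open>The four values allowed for \<open>s\<close> are put into 4 s = 1; only s = 2
      is possible, and it requires 7 = 0.\<close>
    hence "4 * 1 - 1 = (0::'a) \<or> (4 * 2 - 1 = (0::'a) \<and> s = 2) \<or> 2 * 1 - 1 = (0::'a) \<or> 4 * (-1) - 1 = (0::'a)"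
      using cs * by (elim disjE) (metis eq_iff_diff_eq_0)+
    hence "(7::'a) = 0 \<and> s = 2" using char by simp
    moreover from this have "N = 4"
    proof -
      have "N = 4 * (2 * N) - 7 * N" by simp
      thus ?thesis using * \<open>(7::'a) = 0 \<and> s = 2\<close> by simp
    qed
    ultimately have "(7::'a) = 0" "(- 630720::'a) = 0" using poly_monge_4_2[where 'a = 'a] mp by simp_all
    hence "- 630720 + 90103 * 7 = (0::'a)" by (simp only: mult_zero_right add_0_right)
    thus False by simp
  qed
  have M1: "s = - N" if "M = - 1" using N that by simp
  have M2: "s = 2 * N" if "2 * M = 1"
  proof -
    have "2 * N = s * (2 * M)" by (simp add: N)
    thus ?thesis using that by simp
  qed
  have M3: "2 * s = N" "4 * s = 2 * N" if "M = 2" using N that by simp_all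
  have e: "N = 2 \<Longrightarrow> M = - 1 \<Longrightarrow> s = - 2" "N = - 1 \<Longrightarrow> 2 * M = 1 \<Longrightarrow> s = - 2"
    "2 * N = 1 \<Longrightarrow> M = - 1 \<Longrightarrow> 2 * s = - 1" "N = - 1 \<Longrightarrow> M = 2 \<Longrightarrow> 2 * s = - 1"
    "N = 2 \<Longrightarrow> 2 * M = 1 \<Longrightarrow> s = 4" "2 * N = 1 \<Longrightarrow> M = 2 \<Longrightarrow> 4 * s = 1"
    using M1 M2 M3 by auto
  show ?thesis using cN cM not1 e s1 s2 s3 s4 by metis
qed

context curve begin

abbreviation N\<^sub>k :: 'k where "N\<^sub>k \<equiv> of_nat n"
abbreviation M\<^sub>k :: 'k where "M\<^sub>k \<equiv> of_nat m"

section \<open>Derivatives of \<open>y\<close> as polynomials in \<open>w\<close>\<close>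

definition u :: 'f where "u = \<iota> a * x ^ n"
definition v :: 'f where "v = \<iota> b * y ^ m"
definition w :: 'f where "w = u / v"
definition slope :: 'k where "slope = of_nat n / of_nat m"

lemma uv: "u + v = 1" and u0: "u \<noteq> 0" and v0: "v \<noteq> 0"
  using curve_eq x0 y0 a0 b0 by (simp_all add: u_def v_def)

text \<open>Linear factors are split off one at a time. If \<open>w\<close> were a constant z, then
  a (1 + z) x^n = z, impossible because z and 1 + z cannot both vanish.\<close>

lemma w_transcendental: "P \<noteq> 0 \<Longrightarrow> eval_at \<iota> w P \<noteq> 0"
proof (induction "degree P" arbitrary: P)
  case 0
  then obtain c where "P = [:c:]" by (auto elim: degree_eq_zeroE)
  thus ?case using 0 by (simp add: hom_i)
next
  case (Suc k)
  interpret e: comm_ring_hom "eval_at \<iota> w" by (rule comm_ring_hom_eval_at[OF hom_i])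
  interpret ev: comm_ring_hom "eval_at \<iota> x" by (rule comm_ring_hom_eval_at[OF hom_i])
  have "degree P > 0" using Suc by simp
  then obtain z where "poly P z = 0" using closed by (auto simp: alg_closed_field_def)
  then obtain Q where Q: "P = [:- z, 1:] * Q" by (auto simp: poly_eq_0_iff_dvd dvd_def)
  have "Q \<noteq> 0" using Suc Q by auto
  hence "degree P = 1 + degree Q" using degree_mult_eq[of "[:- z, 1:]" Q] by (simp add: Q)
  hence "eval_at \<iota> w Q \<noteq> 0" using Suc \<open>Q \<noteq> 0\<close> by simp
  moreover have "w \<noteq> \<iota> z"
  proof
    assume "w = \<iota> z"
    moreover have "u = w * v" using v0 by (simp add: w_def)
    moreover have "v = 1 - u" by (simp flip: uv)
    ultimately have "u = \<iota> z * (1 - u)" by simp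
    hence "\<iota> a * (1 + \<iota> z) * x ^ n - \<iota> z = 0" by (simp add: u_def algebra_simps)
    hence "eval_at \<iota> x (monom (a * (1 + z)) n - [:z:]) = 0"
      by (simp only: ev.hom_minus eval_at_monom[OF hom_i] eval_at_const[OF hom_i] i.hom_mult i.hom_add i.hom_one)
    hence 0: "monom (a * (1 + z)) n - [:z:] = 0" using transcendental by blast
    have "coeff (monom (a * (1 + z)) n - [:z:]) 0 = 0" "coeff (monom (a * (1 + z)) n - [:z:]) n = 0"
      unfolding 0 by simp_all
    thus False using n2 a0 by (auto simp: coeff_pCons split: nat.splits)
  qed
  ultimately show ?case
    unfolding Q by (simp only: e.hom_mult) (simp add: eval_at_pCons hom_i i.hom_uminus)
qed

lemma D1_i: "D 1 (\<iota> c * f) = \<iota> c * D 1 f"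
  by (simp only: D1_mult) simp

lemma D1_u: "x * D 1 u = of_nat n * u"
proof -
  have "x * D 1 u = \<iota> a * (of_nat n * (x * x ^ (n - 1)) * D 1 x)"
    by (simp only: u_def D1_i D1_power mult_ac)
  also have "x * x ^ (n - 1) = x ^ n" using n2 by (simp flip: power_Suc)
  finally show ?thesis using D_x by (simp add: u_def)
qed

lemma D1_y: "x * D 1 y = - \<iota> slope * w * y"
proof -
  have "0 = D 1 (u + v)" using D_i[of 1 1] uv by simp
  hence "D 1 v = - D 1 u" by (simp only: D_add) (simp add: eq_neg_iff_add_eq_0 add.commute)
  hence 1: "x * D 1 v = - (of_nat n * u)" using D1_u by simp
  have "y * D 1 v = \<iota> b * (of_nat m * (y * y ^ (m - 1)) * D 1 y)"
    by (simp only: v_def D1_i D1_power mult_ac)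
  also have "y * y ^ (m - 1) = y ^ m" using m2 by (simp flip: power_Suc)
  finally have "y * D 1 v = of_nat m * v * D 1 y" by (simp add: v_def mult_ac)
  hence "of_nat m * v * (x * D 1 y) = y * (x * D 1 v)" by (simp only: mult_ac)
  hence "of_nat m * v * (x * D 1 y) = - (of_nat n * u * y)" unfolding 1 by simp
  have sm: "\<iota> slope * of_nat m = of_nat n"
  proof -
    have "slope * of_nat m = of_nat n" using pm by (simp add: slope_def of_nat_k_eq_0_iff)
    from arg_cong[OF this, of \<iota>] show ?thesis by (simp only: i.hom_mult i.hom_of_nat)
  qed
  have "of_nat m * v * (x * D 1 y) = - (\<iota> slope * of_nat m * u * y)"
    unfolding sm by fact
  hence "(of_nat m * v) * (x * D 1 y) = (of_nat m * v) * (- \<iota> slope * w * y)"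
    using v0 by (simp add: w_def algebra_simps)
  moreover have "of_nat m * v \<noteq> 0" using v0 of_nat_m by simp
  ultimately show ?thesis by (metis mult_left_cancel)
qed

lemma D1_w: "x * D 1 w = of_nat n * w * (1 + w)"
proof -
  have "0 = D 1 (u + v)" using D_i[of 1 1] uv by simp
  hence Dv: "D 1 v = - D 1 u" by (simp only: D_add) (simp add: eq_neg_iff_add_eq_0 add.commute)
  have wv: "w * v = u" using v0 by (simp add: w_def)
  hence "D 1 w * v + w * D 1 v = D 1 u" by (simp only: D1_mult[symmetric])
  hence "D 1 w * v = D 1 u * (1 + w)" unfolding Dv by (simp add: algebra_simps)
  hence "v * (x * D 1 w) = (x * D 1 u) * (1 + w)" by (simp add: mult_ac)
  also have "\<dots> = v * (of_nat n * w * (1 + w))" unfolding D1_u by (simp flip: wv)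
  finally show ?thesis using v0 by simp
qed

lemma D1_eval_w: "D 1 (eval_at \<iota> w P) = eval_at \<iota> w (pderiv P) * D 1 w"
proof (induction P)
  case 0 thus ?case using D_i[of 1 0] by simp
next
  case (pCons c P)
  interpret e: comm_ring_hom "eval_at \<iota> w" by (rule comm_ring_hom_eval_at[OF hom_i])
  have "D 1 (eval_at \<iota> w (pCons c P)) = D 1 w * eval_at \<iota> w P + w * D 1 (eval_at \<iota> w P)"
    by (simp only: eval_at_pCons[OF hom_i] D_add D1_mult) simp
  also have "\<dots> = (eval_at \<iota> w P + w * eval_at \<iota> w (pderiv P)) * D 1 w"
    unfolding pCons.IH by (simp add: algebra_simps)
  also have "eval_at \<iota> w P + w * eval_at \<iota> w (pderiv P) = eval_at \<iota> w (pderiv (pCons c P))"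
    by (simp add: pderiv_pCons e.hom_add eval_at_pCons hom_i)
  finally show ?case .
qed

abbreviation J :: "nat \<Rightarrow> 'f" where "J k \<equiv> eval_at \<iota> w (jet_poly N\<^sub>k slope k)"

text \<open>The factorial turns Hasse derivatives into iterated ones. The recursion of
  \<open>jet_poly\<close> is the product rule applied to y w G(w) / x^(k + 1) with the logarithmic
  derivatives of \<open>y\<close> and \<open>w\<close>.\<close>

lemma D_y_formula:
  assumes "k < 5"
  shows "of_nat (fact (Suc k)) * D (Suc k) y * x ^ Suc k = y * w * J k"
  using assms
proof (induction k)
  case 0
  thus ?case using D1_y by (simp add: hom_i i.hom_uminus mult_ac)
next
  case (Suc k)
  interpret e: comm_ring_hom "eval_at \<iota> w" by (rule comm_ring_hom_eval_at[OF hom_i])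
  let ?A = "of_nat (fact (Suc k)) * D (Suc k) y * x ^ Suc k" and ?G' = "eval_at \<iota> w (pderiv (jet_poly N\<^sub>k slope k))"
  have IH: "?A = y * w * J k" using Suc by simp
  have c: "D 1 (of_nat (fact (Suc k)) * f) = of_nat (fact (Suc k)) * D 1 f" for f
    using D1_i[of "of_nat (fact (Suc k))" f] by (simp only: i.hom_of_nat)
  have DD: "D 1 (D (Suc k) y) = of_nat (Suc (Suc k)) * D (Suc (Suc k)) y"
    using Suc.prems p5 by (intro D1_D) simp
  have "x * D 1 ?A = of_nat (fact (Suc (Suc k))) * D (Suc (Suc k)) y * x ^ Suc (Suc k)
      + of_nat (Suc k) * ?A"
    unfolding D1_mult[of "of_nat (fact (Suc k)) * D (Suc k) y"] c DD D1_power fact_Suc[of "Suc k"] of_nat_mult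
    using D_x(1) by (simp add: algebra_simps del: fact_Suc of_nat_Suc)
  moreover have "x * D 1 ?A = (x * D 1 y) * w * J k + y * (x * D 1 w) * J k + y * w * (?G' * (x * D 1 w))"
    unfolding IH by (simp only: D1_mult D1_eval_w) (simp add: algebra_simps)
  ultimately have "of_nat (fact (Suc (Suc k))) * D (Suc (Suc k)) y * x ^ Suc (Suc k) =
      y * w * ((of_nat n - of_nat (Suc k) + (of_nat n - \<iota> slope) * w) * J k + (of_nat n * w + of_nat n * w ^ 2) * ?G')"
    unfolding D1_y D1_w IH by (simp add: algebra_simps power2_eq_square)
  also have "(of_nat n - of_nat (Suc k) + (of_nat n - \<iota> slope) * w) * J k + (of_nat n * w + of_nat n * w ^ 2) * ?G'
      = J (Suc k)"
    unfolding jet_poly.simps(2) e.hom_add e.hom_mult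
    by (simp only: eval_at_pCons[OF hom_i] i.hom_minus i.hom_of_nat i.hom_zero eval_at_0)
       (simp add: algebra_simps power2_eq_square)
  finally show ?case .
qed

lemma D2_y_eq_0_iff: "D 2 y = 0 \<longleftrightarrow> N\<^sub>k = 1 \<and> M\<^sub>k = 1"
proof -
  have 2: "(2::'f) \<noteq> 0" using numeral_f_nonzero[of 2] p5 by simp
  have s0: "slope \<noteq> 0" using pn pm by (simp add: slope_def of_nat_k_eq_0_iff)
  have "D 2 y = 0 \<longleftrightarrow> 2 * D 2 y * x ^ 2 = 0" using x0 2 by simp
  also have "2 * D 2 y * x ^ 2 = y * w * J 1"
    using D_y_formula[of 1] by (simp add: numeral_2_eq_2 del: jet_poly.simps)
  also have "y * w * J 1 = 0 \<longleftrightarrow> J 1 = 0" using y0 u0 v0 by (simp add: w_def)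
  also have "\<dots> \<longleftrightarrow> jet_poly N\<^sub>k slope 1 = 0" using w_transcendental by (metis eval_at_0)
  also have "\<dots> \<longleftrightarrow> N\<^sub>k = 1 \<and> N\<^sub>k = slope" using s0 by (auto simp: pderiv_pCons)
  also have "\<dots> \<longleftrightarrow> N\<^sub>k = 1 \<and> M\<^sub>k = 1"
    using pm of_nat_k_eq_0_iff[of m] by (auto simp: slope_def)
  finally show ?thesis .
qed

lemma residues:
  assumes D2: "D 2 y \<noteq> 0"
    and monge: "D 2 y ^ 2 * D 5 y - 3 * D 2 y * D 3 y * D 4 y + 2 * D 3 y ^ 3 = 0"
  shows "(N\<^sub>k = 2 \<and> M\<^sub>k = 2) \<or> (2 * N\<^sub>k = 1 \<and> 2 * M\<^sub>k = 1) \<or> (N\<^sub>k = - 1 \<and> M\<^sub>k = - 1)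
    \<or> (N\<^sub>k = 1 \<and> 2 * M\<^sub>k = 1) \<or> (N\<^sub>k = 2 \<and> M\<^sub>k = 1)
    \<or> (N\<^sub>k = 1 \<and> M\<^sub>k = 2) \<or> (2 * N\<^sub>k = 1 \<and> M\<^sub>k = 1) \<or> (N\<^sub>k = 1 \<and> M\<^sub>k = - 1) \<or> (N\<^sub>k = - 1 \<and> M\<^sub>k = 1)"
proof (rule monge_poly_cases)
  interpret e: comm_ring_hom "eval_at \<iota> w" by (rule comm_ring_hom_eval_at[OF hom_i])
  define B2 B3 B4 B5 where B: "B2 = 2 * D 2 y * x ^ 2" "B3 = 6 * D 3 y * x ^ 3"
    "B4 = 24 * D 4 y * x ^ 4" "B5 = 120 * D 5 y * x ^ 5"
  have J: "B2 = y * w * J 1" "B3 = y * w * J 2" "B4 = y * w * J 3" "B5 = y * w * J 4"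
    using D_y_formula[of 1] D_y_formula[of 2] D_y_formula[of 3] D_y_formula[of 4]
    unfolding B by (simp_all add: fact_numeral eval_nat_numeral del: jet_poly.simps)
  have "9 * B2 ^ 2 * B5 - 45 * B2 * B3 * B4 + 40 * B3 ^ 3 =
      4320 * x ^ 9 * (D 2 y ^ 2 * D 5 y - 3 * D 2 y * D 3 y * D 4 y + 2 * D 3 y ^ 3)"
    unfolding B by Groebner_Basis.algebra
  also have "\<dots> = 0" unfolding monge by simp
  finally have "(y * w) ^ 3 * (9 * J 1 ^ 2 * J 4 - 45 * J 1 * J 2 * J 3 + 40 * J 2 ^ 3) = 0"
    unfolding J by Groebner_Basis.algebra
  moreover have "y * w \<noteq> 0" using y0 u0 v0 by (simp add: w_def)
  ultimately have "9 * J 1 ^ 2 * J 4 - 45 * J 1 * J 2 * J 3 + 40 * J 2 ^ 3 = 0" by simp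
  hence "eval_at \<iota> w (monge_poly N\<^sub>k slope) = 0"
    unfolding monge_poly_def
    by (simp only: e.hom_add e.hom_minus e.hom_mult e.hom_power e.hom_numeral)
  thus "monge_poly N\<^sub>k slope = 0" using w_transcendental by blast
  show "N\<^sub>k = slope * M\<^sub>k" using pm by (simp add: slope_def of_nat_k_eq_0_iff)
  show "slope \<noteq> 0" using pn pm by (simp add: slope_def of_nat_k_eq_0_iff)
  show "\<not> (N\<^sub>k = 1 \<and> M\<^sub>k = 1)" using D2 D2_y_eq_0_iff by blast
  have nz: "of_nat j \<noteq> (0::'k)" if "0 < j" "j < 6" for j
    using that p5 of_nat_k_eq_0_iff[of j] by (auto dest: dvd_imp_le)
  show "(2::'k) \<noteq> 0" "(3::'k) \<noteq> 0" "(5::'k) \<noteq> 0"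
    using nz[of 2] nz[of 3] nz[of 5] by simp_all
qed

text \<open>If D 2 y = 0, the tangent line meets the conditions of order 0, 1 and 2, so the
  Wronskian of 1, \<open>y\<close>, \<open>x\<close> vanishes.\<close>

lemma D2_y_if_classical:
  assumes "classical_wrt D x y 1"
  shows "D 2 y \<noteq> 0"
proof
  assume D2: "D 2 y = 0"
  have me: "mon_exps (Suc 0) = [(0,0), (0,1), (1,0)]" by (simp add: mon_exps_def)
  have phi: "phi x y (Suc 0) 0 = 1" "phi x y (Suc 0) (Suc 0) = y" "phi x y (Suc 0) 2 = x"
    by (simp_all add: phi_def me)
  \<comment> \<open>The coefficients of the tangent line for the monomials in the order 1,
    \<open>y\<close>, \<open>x\<close>.\<close>
  define c where "c = (\<lambda>j::nat. if j = 0 then D 1 y * x - y else if j = 1 then 1 else - D 1 y)"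
  have s: "(\<Sum>j<3. g j) = g 0 + g (Suc 0) + g 2" for g :: "nat \<Rightarrow> 'f"
    by (simp add: eval_nat_numeral)
  have "(\<Sum>j<3. c j * D i (phi x y (Suc 0) j)) = 0" if "i < 3" for i
  proof -
    have "i = 0 \<or> i = 1 \<or> i = 2" using that by auto
    thus ?thesis unfolding s phi D_one D_x_all c_def using D2 by auto
  qed
  hence K: "(\<Sum>j<3. c j * D ([0..<3] ! i) (phi x y (Suc 0) j)) = 0" if "i < 3" for i
    using that by (simp only: nth_upt)
  have len: "length (mon_exps (Suc 0)) = 3" by (simp add: me)
  have "wr_det D x y (Suc 0) [0..<3] = 0"
    unfolding wr_det_def det_mat_eq_0_iff prod.case len
  proof (intro exI conjI allI impI)
    show "(\<Sum>j<3. c j * D ([0..<3] ! i) (phi x y (Suc 0) j)) = 0" if "i < 3" for i by (rule K[OF that])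
    show "c 1 \<noteq> 0" by (simp add: c_def)
  qed simp
  moreover have "wr_det D x y (Suc 0) [0..<length (mon_exps (Suc 0))] \<noteq> 0"
    using assms unfolding classical_wrt_def is_order_seq_def One_nat_def by (elim conjE)
  ultimately show False unfolding len by (elim notE)
qed

end

section \<open>Monomial identities on the points of the curve\<close>

context closed_char begin

lemma point_exists:
  fixes a b :: 'k
  assumes "a \<noteq> 0" "b \<noteq> 0" "n > 0" "m > 0"
  obtains X Y where "X ^ n = u / a" "Y ^ m = (1 - u) / b" "a * X ^ n + b * Y ^ m = 1"
proof -
  obtain X Y where "X ^ n = u / a" "Y ^ m = (1 - u) / b"
    using root_exists[OF assms(3)] root_exists[OF assms(4)] by metis
  thus ?thesis using that assms by simp
qed

context
  fixes a b :: 'k and n m :: nat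
  assumes ab: "a \<noteq> 0" "b \<noteq> 0" and nm: "n > 0" "m > 0" and p_nm: "\<not> p dvd n" "\<not> p dvd m"
begin

text \<open>The points on the axes give A = n N and B = m M with a = a^N and b = b^M. Both A and B
  are positive, so the term of the vanishing coordinate disappears. The remaining points,
  parametrized by u = a X^n, turn the hypothesis into u^N + (1 - u)^M = 1.\<close>

lemma fermat_points:
  assumes H: "\<And>X Y. a * X ^ n + b * Y ^ m = 1 \<Longrightarrow> a * X ^ A + b * Y ^ B = 1" and "A > 0" "B > 0"
  obtains r where "A = n * p ^ r" "B = m * p ^ r" "a ^ p ^ r = a" "b ^ p ^ r = b"
proof -
  have X: "a * X ^ A = 1" if "a * X ^ n = 1" for X using H[of X 0] that nm assms by (simp add: power_0_left)
  have Y: "b * Y ^ B = 1" if "b * Y ^ m = 1" for Y using H[of 0 Y] that nm assms by (simp add: power_0_left)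
  obtain N where N: "A = n * N" "a = a ^ N" using fermat_axis[OF nm(1) p_nm(1) ab(1) X] .
  obtain M where M: "B = m * M" "b = b ^ M" using fermat_axis[OF nm(2) p_nm(2) ab(2) Y] .
  have *: "u ^ N + (1 - u) ^ M = 1" for u :: 'k
  proof -
    obtain X Y where XY: "X ^ n = u / a" "Y ^ m = (1 - u) / b" "a * X ^ n + b * Y ^ m = 1"
      using point_exists[OF ab nm] .
    have "a * X ^ A = u ^ N" using ab N(2) by (simp add: N(1) power_mult XY power_divide)
    moreover have "b * Y ^ B = (1 - u) ^ M" using ab M(2) by (simp add: M(1) power_mult XY power_divide)
    ultimately show ?thesis using H[OF XY(3)] by simp
  qed
  have pos: "N > 0" "M > 0" using N(1) M(1) assms by auto
  obtain r where r: "N = p ^ r" using fermat_identity(2)[OF pos *] by blast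
  show ?thesis using that[of r] r N M fermat_identity(1)[OF pos *] by simp
qed

lemma parabola_points:
  assumes H: "\<And>X Y. a * X ^ n + b * Y ^ m = 1 \<Longrightarrow>
      (1 - a ^ 2 * X ^ A - b ^ 2 * Y ^ B) ^ 2 = 4 * (a ^ 2 * X ^ A) * (b ^ 2 * Y ^ B)" and "A > 0" "B > 0"
  obtains r where "A = n * (2 * p ^ r)" "B = m * (2 * p ^ r)" "(a ^ 2) ^ p ^ r = a ^ 2" "(b ^ 2) ^ p ^ r = b ^ 2"
proof -
  have X: "a ^ 2 * X ^ A = 1" if "a * X ^ n = 1" for X
    using H[of X 0] that nm assms by (simp add: power_0_left)
  have Y: "b ^ 2 * Y ^ B = 1" if "b * Y ^ m = 1" for Y
    using H[of 0 Y] that nm assms by (simp add: power_0_left)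
  obtain N where N: "A = n * N" "a ^ 2 = a ^ N" using fermat_axis[OF nm(1) p_nm(1) ab(1) X] .
  obtain M where M: "B = m * M" "b ^ 2 = b ^ M" using fermat_axis[OF nm(2) p_nm(2) ab(2) Y] .
  have *: "(1 - u ^ N - (1 - u) ^ M) ^ 2 = 4 * u ^ N * (1 - u) ^ M" for u :: 'k
  proof -
    obtain X Y where XY: "X ^ n = u / a" "Y ^ m = (1 - u) / b" "a * X ^ n + b * Y ^ m = 1"
      using point_exists[OF ab nm] .
    have "a ^ 2 * X ^ A = u ^ N" using ab N(2) by (simp add: N(1) power_mult XY power_divide)
    moreover have "b ^ 2 * Y ^ B = (1 - u) ^ M" using ab M(2) by (simp add: M(1) power_mult XY power_divide)
    ultimately show ?thesis using H[OF XY(3)] by simp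
  qed
  have pos: "N > 0" "M > 0" using N(1) M(1) assms by auto
  obtain r where r: "N = 2 * p ^ r" using parabola_identity(2)[OF pos *] by blast
  have MN: "M = 2 * p ^ r" using r parabola_identity(1)[OF pos *] by simp
  have "(a ^ 2) ^ p ^ r = a ^ N" "(b ^ 2) ^ p ^ r = b ^ M" by (simp_all only: r MN power_mult)
  thus ?thesis using that[of r] N M r MN by simp
qed

text \<open>The axis X = 0 determines only b^2, so b^(p^r) is known up to sign; hence the two
  alternatives for \<open>b\<close> in the final classification.\<close>

lemma square_points:
  assumes H: "\<And>X Y. a * X ^ n + b * Y ^ m = 1 \<Longrightarrow> b ^ 2 * Y ^ B = (1 - a * X ^ A) ^ 2" and "A > 0" "B > 0"
  obtains r where "A = n * p ^ r" "B = m * (2 * p ^ r)" "a ^ p ^ r = a" "(b ^ p ^ r) ^ 2 = b ^ 2"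
proof -
  have X: "a * X ^ A = 1" if "a * X ^ n = 1" for X
    using H[of X 0] that nm assms by (simp add: power_0_left)
  have Y: "b ^ 2 * Y ^ B = 1" if "b * Y ^ m = 1" for Y
    using H[of 0 Y] that nm assms by (simp add: power_0_left)
  obtain N where N: "A = n * N" "a = a ^ N" using fermat_axis[OF nm(1) p_nm(1) ab(1) X] .
  obtain M where M: "B = m * M" "b ^ 2 = b ^ M" using fermat_axis[OF nm(2) p_nm(2) ab(2) Y] .
  have *: "(1 - u) ^ M = (1 - u ^ N) ^ 2" for u :: 'k
  proof -
    obtain X Y where XY: "X ^ n = u / a" "Y ^ m = (1 - u) / b" "a * X ^ n + b * Y ^ m = 1"
      using point_exists[OF ab nm] .
    have "a * X ^ A = u ^ N" using ab N(2) by (simp add: N(1) power_mult XY power_divide)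
    moreover have "b ^ 2 * Y ^ B = (1 - u) ^ M" using ab M(2) by (simp add: M(1) power_mult XY power_divide)
    ultimately show ?thesis using H[OF XY(3)] by simp
  qed
  have pos: "N > 0" "M > 0" using N(1) M(1) assms by auto
  obtain r where r: "N = p ^ r" using square_identity(2)[OF pos *] by blast
  have MN: "M = 2 * p ^ r" using r square_identity(1)[OF pos *] by simp
  have "(b ^ p ^ r) ^ 2 = b ^ M" by (simp only: MN power_mult[symmetric] mult.commute)
  thus ?thesis using that[of r] N M r MN by simp
qed

text \<open>The equation reads (1 - a X^(n - 1 + q)) Y^q = b Y^(m + 1). Its m-th power involves only
  Y^m, which is a polynomial in X, and the two sides then differ in degree.\<close>

lemma parabola_points_impossible:
  assumes H: "\<And>X Y. a * X ^ n + b * Y ^ m = 1 \<Longrightarrow> a * X ^ (n - 1) * X ^ q * Y ^ q + b * Y ^ (m + 1) = Y ^ q"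
    and q: "q > 1"
  shows False
proof -
  define g where "g = smult (inverse b) (1 + monom (- a) n)"
  define l where "l = 1 + monom (- a) (n - 1 + q)"
  have gX: "b * poly g X = 1 - a * X ^ n" and lX: "poly l X = 1 - a * X ^ (n - 1 + q)" for X
    using ab by (simp_all add: g_def l_def poly_monom)
  have "l ^ m * g ^ q = smult (b ^ m) (g ^ (m + 1))"
  proof (rule poly_identity)
    fix X :: 'k
    define Z where "Z = poly g X"
    obtain Y where Y: "Y ^ m = Z" using root_exists[OF nm(2)] by blast
    have "a * X ^ (n - 1) * X ^ q * Y ^ q + b * Y ^ (m + 1) = Y ^ q"
      using gX[of X] by (intro H) (simp add: Y Z_def)
    hence "(1 - a * X ^ (n - 1 + q)) * Y ^ q = b * Y ^ (m + 1)" by (simp add: power_add algebra_simps)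
    hence "((1 - a * X ^ (n - 1 + q)) * Y ^ q) ^ m = (b * Y ^ (m + 1)) ^ m" by simp
    moreover have "(Y ^ j) ^ m = Z ^ j" for j
      unfolding Y[symmetric] by (simp only: power_mult[symmetric] mult.commute)
    ultimately have "(1 - a * X ^ (n - 1 + q)) ^ m * Z ^ q = b ^ m * Z ^ (m + 1)"
      by (simp only: power_mult_distrib)
    thus "poly (l ^ m * g ^ q) X = poly (smult (b ^ m) (g ^ (m + 1))) X"
      by (simp only: poly_mult poly_power poly_smult Z_def lX)
  qed
  moreover have dl: "degree (1 + monom (- a) k) = k" if "k > 0" for k
    using that ab by (simp add: degree_add_eq_right degree_monom_eq)
  have l: "degree l = n - 1 + q" unfolding l_def using q by (intro dl) simp
  hence l0: "l \<noteq> 0" using q by auto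
  have g: "degree g = n" using ab dl[OF nm(1)] by (simp add: g_def)
  hence g0: "g \<noteq> 0" using nm by auto
  have "degree (l ^ m * g ^ q) = m * (n - 1 + q) + q * n"
    using l0 g0 by (simp add: degree_mult_eq degree_power_eq l g)
  moreover have "degree (g ^ (m + 1)) = (m + 1) * n" by (simp only: degree_power_eq[OF g0] g mult.commute)
  hence "degree (smult (b ^ m) (g ^ (m + 1))) = m * n + n" using ab by simp
  ultimately have "m * (n - 1 + q) + q * n = m * n + n" by simp
  moreover have "m * n \<le> m * (n - 1 + q)" using q by (intro mult_left_mono) auto
  moreover have "1 * n < q * n" using q nm by (intro mult_strict_right_mono) auto
  ultimately show False by linarith
qed

text \<open>At one point with both coordinates nonzero, X is multiplied by an \<open>n\<close>-th
  root of unity z. Subtracting the two instances of the hypothesis leaves z = z^q. The parameter - 1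
  is chosen because 1 - (- 1) = 2 is nonzero.\<close>

lemma hyperbola_points_dvd:
  assumes H: "\<And>X Y. a * X ^ n + b * Y ^ m = 1 \<Longrightarrow>
      a * X ^ (n + 1) * Y ^ q + b * Y ^ (m + 1) * X ^ q = X ^ q * Y ^ q"
    and q: "q > 1"
  shows "n dvd q - 1"
proof (rule roots_of_unity_dvd[OF nm(1) p_nm(1)])
  fix z :: 'k assume z: "z ^ n = 1"
  hence "z \<noteq> 0" using nm by (auto simp: power_0_left)
  obtain X Y where XY: "X ^ n = - 1 / a" "Y ^ m = (1 - (- 1)) / b" "a * X ^ n + b * Y ^ m = 1"
    using point_exists[OF ab nm] .
  have "X \<noteq> 0" "Y \<noteq> 0" using XY ab nm two_k by (auto simp: power_0_left)
  have "a * (z * X) ^ n + b * Y ^ m = 1" using XY z by (simp add: power_mult_distrib)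
  from H[OF this] have "z * (a * X ^ (n + 1) * Y ^ q) + z ^ q * (b * Y ^ (m + 1) * X ^ q) = z ^ q * (X ^ q * Y ^ q)"
    by (simp add: power_mult_distrib z mult_ac)
  moreover have "z ^ q * (a * X ^ (n + 1) * Y ^ q) + z ^ q * (b * Y ^ (m + 1) * X ^ q) = z ^ q * (X ^ q * Y ^ q)"
    unfolding distrib_left[symmetric] H[OF XY(3)] ..
  ultimately have "z * (a * X ^ (n + 1) * Y ^ q) = z ^ q * (a * X ^ (n + 1) * Y ^ q)"
    by (metis add_right_cancel)
  hence "z = z ^ q" using ab \<open>X \<noteq> 0\<close> \<open>Y \<noteq> 0\<close> by simp
  also have "z ^ q = z * z ^ (q - 1)" using q by (simp flip: power_Suc)
  finally show "z ^ (q - 1) = 1" using \<open>z \<noteq> 0\<close> by simp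
qed

end

lemma hyperbola_points:
  fixes a b :: 'k
  assumes ab: "a \<noteq> 0" "b \<noteq> 0" and nm: "n > 0" "m > 0" and p_nm: "\<not> p dvd n" "\<not> p dvd m"
    and H: "\<And>X Y. a * X ^ n + b * Y ^ m = 1 \<Longrightarrow>
      a * X ^ (n + 1) * Y ^ q + b * Y ^ (m + 1) * X ^ q = X ^ q * Y ^ q"
    and q: "q > 1"
  shows "q = n + 1 \<and> q = m + 1 \<and> a + b = 1"
proof -
  have "n dvd q - 1" by (rule hyperbola_points_dvd[OF ab nm p_nm H q])
  then obtain e where e: "q - 1 = n * e" by (auto simp: dvd_def)
  have "m dvd q - 1"
  proof (rule hyperbola_points_dvd[OF ab(2,1) nm(2,1) p_nm(2,1) _ q])
    fix Y X assume "b * Y ^ m + a * X ^ n = 1"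
    thus "b * Y ^ (m + 1) * X ^ q + a * X ^ (n + 1) * Y ^ q = Y ^ q * X ^ q"
      using H[of X Y] by (simp add: add.commute mult_ac)
  qed
  then obtain f where f: "q - 1 = m * f" by (auto simp: dvd_def)
  have pos: "e > 0" "f > 0" using e f q by (auto intro!: Nat.gr0I)
  \<comment> \<open>With q - 1 = n e = m f the hypothesis divided by X Y is polynomial in u = a X^n,
    and \<open>P\<close> is what remains after division by u (1 - u). Its value at 0 forces e = 1,
    its value at 1 forces f = 1, and then 1/a + 1/b = 1/(ab).\<close>
  define P where "P = smult (inverse b ^ f) ([:1, -1:] ^ (f - 1)) + smult (inverse a ^ e) ([:0, 1:] ^ (e - 1))
     - smult (inverse a ^ e * inverse b ^ f) ([:0, 1:] ^ (e - 1) * [:1, -1:] ^ (f - 1))"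
  have "[:0, 1:] * [:1, -1:] * P = 0"
  proof (rule poly_vanishing)
    fix u :: 'k
    show "poly ([:0, 1:] * [:1, -1:] * P) u = 0"
    proof (cases "u = 0 \<or> u = 1")
      case False
      obtain X Y where XY: "X ^ n = u / a" "Y ^ m = (1 - u) / b" "a * X ^ n + b * Y ^ m = 1"
        using point_exists[OF ab nm] .
      have XY0: "X \<noteq> 0" "Y \<noteq> 0" using False XY ab nm by (auto simp: power_0_left)
      have Xq: "X ^ q = X * (u * inverse a) ^ e"
      proof -
        have "X ^ q = X * X ^ (n * e)" using q by (simp flip: e power_Suc)
        thus ?thesis by (simp only: power_mult XY(1) divide_inverse)
      qed
      have Yq: "Y ^ q = Y * ((1 - u) * inverse b) ^ f"
      proof -
        have "Y ^ q = Y * Y ^ (m * f)" using q by (simp flip: f power_Suc)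
        thus ?thesis by (simp only: power_mult XY(2) divide_inverse)
      qed
      have 1: "a * X ^ (n + 1) = u * X" "b * Y ^ (m + 1) = (1 - u) * Y" using XY ab by simp_all
      have "(u * ((1 - u) * inverse b) ^ f + (1 - u) * (u * inverse a) ^ e - (u * inverse a) ^ e * ((1 - u) * inverse b) ^ f) * (X * Y) = 0"
        using H[OF XY(3)] unfolding 1 Xq Yq by (simp add: algebra_simps)
      hence "u * ((1 - u) * inverse b) ^ f + (1 - u) * (u * inverse a) ^ e - (u * inverse a) ^ e * ((1 - u) * inverse b) ^ f = 0"
        using XY0 by simp
      moreover have "((1 - u) * inverse b) ^ f = (1 - u) * (1 - u) ^ (f - 1) * inverse b ^ f"
        "(u * inverse a) ^ e = u * u ^ (e - 1) * inverse a ^ e"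
        using pos by (simp_all add: power_mult_distrib flip: power_Suc)
      ultimately have "u * ((1 - u) * (1 - u) ^ (f - 1) * inverse b ^ f) + (1 - u) * (u * u ^ (e - 1) * inverse a ^ e)
        - u * u ^ (e - 1) * inverse a ^ e * ((1 - u) * (1 - u) ^ (f - 1) * inverse b ^ f) = 0" by simp
      thus ?thesis unfolding P_def by (simp add: algebra_simps)
    qed auto
  qed
  hence P: "P = 0" by (simp only: mult_eq_0_iff pCons_eq_0_iff) simp
  have P0: "poly P 0 = 0" and P1: "poly P 1 = 0" unfolding P by simp_all
  have "e = 1"
  proof (rule ccontr)
    assume "e \<noteq> 1"
    thus False using P0 pos ab by (simp add: P_def power_0_left)
  qed
  moreover have "f = 1"
  proof (rule ccontr)
    assume "f \<noteq> 1"
    thus False using P1 pos ab by (simp add: P_def power_0_left)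
  qed
  ultimately have "inverse b + inverse a = inverse a * inverse b" using P0 by (simp add: P_def)
  hence "a + b = 1" using ab by (simp add: field_simps)
  thus ?thesis using e f \<open>e = 1\<close> \<open>f = 1\<close> q by simp
qed

end

section \<open>The osculating conics in the nonclassical cases\<close>

context curve begin

text \<open>Below order \<open>p\<close> Hasse derivatives are iterates of \<open>D 1\<close> up to
  units. Elements killed by \<open>D 1\<close> thus behave as constants in all conditions of a conic
  of contact five.\<close>

lemma D_const:
  assumes "D 1 c = 0" and "0 < k" "k < p"
  shows "D k c = 0"
  using assms(2,3)
proof (induction k)
  case (Suc k)
  show ?case
  proof (cases "k = 0")
    case True thus ?thesis using assms(1) by simp
  next
    case False
    hence "D k c = 0" using Suc by simp
    hence "of_nat (Suc k) * D (Suc k) c = D 1 0" using D1_D[of k c] Suc.prems by simp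
    also have "D 1 0 = 0" using D_i[of 1 0] by simp
    finally show ?thesis
      using Suc.prems of_nat_f_eq_0_iff[of "Suc k"] by (auto dest: dvd_imp_le simp del: of_nat_Suc)
  qed
qed simp

lemma D_const_mult:
  assumes "D 1 c = 0" and "k < p"
  shows "D k (c * f) = c * D k f"
proof -
  have "D k (c * f) = (\<Sum>i\<in>{0}. D i c * D (k - i) f)"
    unfolding D_mult using assms D_const[OF assms(1)] by (intro sum.mono_neutral_right) auto
  thus ?thesis by simp
qed

lemma D_sum: "D k (\<Sum>j\<in>A. g j) = (\<Sum>j\<in>A. D k (g j))"
proof (induction A rule: infinite_finite_induct)
  case (insert j A) thus ?case by (simp add: D_add)
qed (use D_i[of k 0] in \<open>cases "k = 0"; simp\<close>)+

lemma D1_monomial: "p dvd k \<Longrightarrow> D 1 (\<iota> c * x ^ k) = 0" "p dvd k \<Longrightarrow> D 1 (\<iota> c * y ^ k) = 0"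
  unfolding D1_i D1_power using of_nat_f_eq_0_iff[of k] by simp_all

text \<open>A conic with \<open>D 1\<close>-constant coefficients through the generic point is the osculating conic.\<close>
lemma frob_det_conic:
  fixes c0 c1 c2 c3 c4 c5 :: 'f
  assumes D2: "D 2 y \<noteq> 0"
    and const: "D 1 c0 = 0" "D 1 c1 = 0" "D 1 c2 = 0" "D 1 c3 = 0" "D 1 c4 = 0" "D 1 c5 = 0"
    and nz: "c0 \<noteq> 0 \<or> c1 \<noteq> 0 \<or> c2 \<noteq> 0"
    and van: "c0 + c1 * y + c2 * x + c3 * y ^ 2 + c4 * (x * y) + c5 * x ^ 2 = 0"
  shows "frob_det D q x y 2 [0..<5] = 0 \<longleftrightarrow>
    c0 + c1 * y ^ q + c2 * x ^ q + c3 * (y ^ q) ^ 2 + c4 * (x ^ q * y ^ q) + c5 * (x ^ q) ^ 2 = 0"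
proof -
  define c where "c = (\<lambda>j. [c0, c1, c2, c3, c4, c5] ! j)"
  have c: "c 0 = c0" "c (Suc 0) = c1" "c 2 = c2" "c 3 = c3" "c 4 = c4" "c 5 = c5"
    by (simp_all add: c_def numeral_eq_Suc)
  have "D 1 (c j) = 0" if "j < 6" for j
  proof -
    have "j = 0 \<or> j = Suc 0 \<or> j = 2 \<or> j = 3 \<or> j = 4 \<or> j = 5" using that by auto
    thus ?thesis using const c by (elim disjE) simp_all
  qed
  hence "(\<Sum>j<6. c j * D k (phi x y 2 j)) = D k (\<Sum>j<6. c j * phi x y 2 j)" if "k < 5" for k
    unfolding D_sum using that p5 by (intro sum.cong refl D_const_mult[symmetric]) auto
  moreover have "(\<Sum>j<6. c j * phi x y 2 j) = 0"
    using van by (simp add: sum_lessThan_6 phi_2 c)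
  moreover have "D k 0 = 0" for k using D_i[of k 0] by (cases "k = 0") simp_all
  ultimately have os: "\<forall>k<5. (\<Sum>j<6. c j * D k (phi x y 2 j)) = 0" by simp
  have fr: "(\<Sum>j<6. c j * phi x y 2 j ^ q) =
      c0 + c1 * y ^ q + c2 * x ^ q + c3 * (y ^ q) ^ 2 + c4 * (x ^ q * y ^ q) + c5 * (x ^ q) ^ 2"
    by (simp add: sum_lessThan_6 phi_2 c power_mult_distrib mult.commute flip: power_mult)
  have cnz: "\<exists>j<6. c j \<noteq> 0" using nz
  proof (elim disjE)
    assume "c0 \<noteq> 0" thus ?thesis by (intro exI[of _ 0]) (simp add: c)
  next
    assume "c1 \<noteq> 0" thus ?thesis by (intro exI[of _ "Suc 0"]) (simp add: c)
  next
    assume "c2 \<noteq> 0" thus ?thesis by (intro exI[of _ 2]) (simp add: c)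
  qed
  show ?thesis
  proof
    assume "frob_det D q x y 2 [0..<5] = 0"
    hence "osc (x ^ q) (y ^ q) = 0" by (rule osc_eq_0_if_frob_det[OF D2])
    hence "D 2 y ^ 3 * (c 0 + c (Suc 0) * y ^ q + c 2 * x ^ q + c 3 * (y ^ q) ^ 2 + c 4 * (x ^ q * y ^ q) + c 5 * (x ^ q) ^ 2) = 0"
      using conic_eq_osc[OF os] by simp
    thus "c0 + c1 * y ^ q + c2 * x ^ q + c3 * (y ^ q) ^ 2 + c4 * (x ^ q * y ^ q) + c5 * (x ^ q) ^ 2 = 0"
      using D2 by (simp add: c)
  next
    assume "c0 + c1 * y ^ q + c2 * x ^ q + c3 * (y ^ q) ^ 2 + c4 * (x ^ q * y ^ q) + c5 * (x ^ q) ^ 2 = 0"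
    hence "(\<Sum>j<6. c j * phi x y 2 j ^ q) = 0" unfolding fr .
    moreover have "length [0..<5] = 5" by simp
    ultimately show "frob_det D q x y 2 [0..<5] = 0"
      using os cnz by (subst frob_det_eq_0_iff) auto
  qed
qed

lemma D1_const_simps:
  "D 1 0 = 0" "D 1 1 = 0" "D 1 c = 0 \<Longrightarrow> D 1 (- c) = 0" "D 1 c = 0 \<Longrightarrow> D 1 d = 0 \<Longrightarrow> D 1 (c * d) = 0"
  "D 1 c = 0 \<Longrightarrow> D 1 (2 * c) = 0" "D 1 c = 0 \<Longrightarrow> D 1 (c ^ 2) = 0"
proof -
  show "D 1 0 = 0" "D 1 1 = 0" using D_i[of 1 0] D_i[of 1 1] by simp_all
  show "D 1 c = 0 \<Longrightarrow> D 1 (- c) = 0" by (simp add: D_uminus)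
  show 1: "D 1 c = 0 \<Longrightarrow> D 1 d = 0 \<Longrightarrow> D 1 (c * d) = 0" for c d by (simp only: D1_mult) simp
  show "D 1 c = 0 \<Longrightarrow> D 1 (2 * c) = 0" using D_i[of 1 2] by (intro 1) (simp_all add: i.hom_numeral)
  show "D 1 c = 0 \<Longrightarrow> D 1 (c ^ 2) = 0" unfolding power2_eq_square by (rule 1)
qed

text \<open>The suffixes record the residues of \<open>n\<close> and \<open>m\<close> modulo \<open>p\<close>: \<open>2\<close>, \<open>1\<close>, \<open>h\<close> for one half and \<open>m\<close>
  for minus one. In each case the equation of the curve is a conic in \<open>x\<close> and \<open>y\<close> up to \<open>p\<close>-th powers.\<close>
lemma frob_det_22:
  assumes D2: "D 2 y \<noteq> 0" and dvd: "p dvd n - 2" "p dvd m - 2"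
  shows "frob_det D q x y 2 [0..<5] = 0 \<longleftrightarrow>
    (\<iota> a * x ^ (n - 2)) * (x ^ q) ^ 2 + (\<iota> b * y ^ (m - 2)) * (y ^ q) ^ 2 = 1"
proof -
  define P where "P = \<iota> a * x ^ (n - 2)"
  define Q where "Q = \<iota> b * y ^ (m - 2)"
  have const: "D 1 P = 0" "D 1 Q = 0" unfolding P_def Q_def by (intro D1_monomial dvd)+
  have nm: "Suc (Suc (n - 2)) = n" "Suc (Suc (m - 2)) = m" using n2 m2 by simp_all
  have P: "P * x ^ 2 = u" and Q: "Q * y ^ 2 = v"
    using n2 m2 by (simp_all add: P_def Q_def u_def v_def nm i.hom_power power_mult_distrib mult_ac
       flip: power_add power_mult power_Suc power_Suc2)
  have PQ: "P \<noteq> 0" "Q \<noteq> 0" using x0 y0 a0 b0 by (simp_all add: P_def Q_def)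
  define X where "X = x ^ q"
  define Y where "Y = y ^ q"
  have "frob_det D q x y 2 [0..<5] = 0 \<longleftrightarrow>
    - 1 + 0 * y ^ q + 0 * x ^ q + Q * (y ^ q) ^ 2 + 0 * (x ^ q * y ^ q) + P * (x ^ q) ^ 2 = 0"
  proof (rule frob_det_conic[OF D2])
    show "- 1 + 0 * y + 0 * x + Q * y ^ 2 + 0 * (x * y) + P * x ^ 2 = 0"
      using uv unfolding P[symmetric] Q[symmetric] by Groebner_Basis.algebra
  qed (use const PQ in \<open>simp_all add: D1_const_simps del: One_nat_def\<close>)
  also have "\<dots> \<longleftrightarrow> P * X ^ 2 + Q * Y ^ 2 = 1"
    unfolding X_def[symmetric] Y_def[symmetric] by Groebner_Basis.algebra
  finally show ?thesis unfolding P_def Q_def X_def Y_def .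
qed

lemma frob_det_12:
  assumes D2: "D 2 y \<noteq> 0" and dvd: "p dvd n - 1" "p dvd m - 2"
  shows "frob_det D q x y 2 [0..<5] = 0 \<longleftrightarrow>
    (\<iota> a * x ^ (n - 1)) * x ^ q + (\<iota> b * y ^ (m - 2)) * (y ^ q) ^ 2 = 1"
proof -
  define P where "P = \<iota> a * x ^ (n - 1)"
  define Q where "Q = \<iota> b * y ^ (m - 2)"
  have const: "D 1 P = 0" "D 1 Q = 0" unfolding P_def Q_def by (intro D1_monomial dvd)+
  have nm: "Suc (Suc (n - 2)) = n" "Suc (Suc (m - 2)) = m" using n2 m2 by simp_all
  have P: "P * x = u" and Q: "Q * y ^ 2 = v"
    using n2 m2 by (simp_all add: P_def Q_def u_def v_def nm i.hom_power power_mult_distrib mult_ac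
       flip: power_add power_mult power_Suc power_Suc2)
  have PQ: "P \<noteq> 0" "Q \<noteq> 0" using x0 y0 a0 b0 by (simp_all add: P_def Q_def)
  define X where "X = x ^ q"
  define Y where "Y = y ^ q"
  have "frob_det D q x y 2 [0..<5] = 0 \<longleftrightarrow>
    - 1 + 0 * y ^ q + P * x ^ q + Q * (y ^ q) ^ 2 + 0 * (x ^ q * y ^ q) + 0 * (x ^ q) ^ 2 = 0"
  proof (rule frob_det_conic[OF D2])
    show "- 1 + 0 * y + P * x + Q * y ^ 2 + 0 * (x * y) + 0 * x ^ 2 = 0"
      using uv unfolding P[symmetric] Q[symmetric] by Groebner_Basis.algebra
  qed (use const PQ in \<open>simp_all add: D1_const_simps del: One_nat_def\<close>)
  also have "\<dots> \<longleftrightarrow> P * X + Q * Y ^ 2 = 1"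
    unfolding X_def[symmetric] Y_def[symmetric] by Groebner_Basis.algebra
  finally show ?thesis unfolding P_def Q_def X_def Y_def .
qed

lemma frob_det_21:
  assumes D2: "D 2 y \<noteq> 0" and dvd: "p dvd n - 2" "p dvd m - 1"
  shows "frob_det D q x y 2 [0..<5] = 0 \<longleftrightarrow>
    (\<iota> a * x ^ (n - 2)) * (x ^ q) ^ 2 + (\<iota> b * y ^ (m - 1)) * y ^ q = 1"
proof -
  define P where "P = \<iota> a * x ^ (n - 2)"
  define Q where "Q = \<iota> b * y ^ (m - 1)"
  have const: "D 1 P = 0" "D 1 Q = 0" unfolding P_def Q_def by (intro D1_monomial dvd)+
  have nm: "Suc (Suc (n - 2)) = n" "Suc (Suc (m - 2)) = m" using n2 m2 by simp_all
  have P: "P * x ^ 2 = u" and Q: "Q * y = v"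
    using n2 m2 by (simp_all add: P_def Q_def u_def v_def nm i.hom_power power_mult_distrib mult_ac
       flip: power_add power_mult power_Suc power_Suc2)
  have PQ: "P \<noteq> 0" "Q \<noteq> 0" using x0 y0 a0 b0 by (simp_all add: P_def Q_def)
  define X where "X = x ^ q"
  define Y where "Y = y ^ q"
  have "frob_det D q x y 2 [0..<5] = 0 \<longleftrightarrow>
    - 1 + Q * y ^ q + 0 * x ^ q + 0 * (y ^ q) ^ 2 + 0 * (x ^ q * y ^ q) + P * (x ^ q) ^ 2 = 0"
  proof (rule frob_det_conic[OF D2])
    show "- 1 + Q * y + 0 * x + 0 * y ^ 2 + 0 * (x * y) + P * x ^ 2 = 0"
      using uv unfolding P[symmetric] Q[symmetric] by Groebner_Basis.algebra
  qed (use const PQ in \<open>simp_all add: D1_const_simps del: One_nat_def\<close>)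
  also have "\<dots> \<longleftrightarrow> P * X ^ 2 + Q * Y = 1"
    unfolding X_def[symmetric] Y_def[symmetric] by Groebner_Basis.algebra
  finally show ?thesis unfolding P_def Q_def X_def Y_def .
qed

text \<open>Here P x = u^2 and Q y = v^2, so u + v = 1 says that the square roots of P x and Q y add
  up to 1. Rationalizing gives a parabola with constant coefficients.\<close>

lemma frob_det_hh:
  assumes D2: "D 2 y \<noteq> 0" and dvd: "p dvd 2 * n - 1" "p dvd 2 * m - 1"
  shows "frob_det D q x y 2 [0..<5] = 0 \<longleftrightarrow>
    (1 - (\<iota> (a ^ 2) * x ^ (2 * n - 1)) * x ^ q - (\<iota> (b ^ 2) * y ^ (2 * m - 1)) * y ^ q) ^ 2 = 4 * ((\<iota> (a ^ 2) * x ^ (2 * n - 1)) * x ^ q) * ((\<iota> (b ^ 2) * y ^ (2 * m - 1)) * y ^ q)"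
proof -
  define P where "P = \<iota> (a ^ 2) * x ^ (2 * n - 1)"
  define Q where "Q = \<iota> (b ^ 2) * y ^ (2 * m - 1)"
  have const: "D 1 P = 0" "D 1 Q = 0" unfolding P_def Q_def by (intro D1_monomial dvd)+
  have P: "P * x = u ^ 2" and Q: "Q * y = v ^ 2"
    using n2 m2 by (simp_all add: P_def Q_def u_def v_def i.hom_power power_mult_distrib mult_ac
       flip: power_add power_mult power_Suc power_Suc2)
  have PQ: "P \<noteq> 0" "Q \<noteq> 0" using x0 y0 a0 b0 by (simp_all add: P_def Q_def)
  define X where "X = x ^ q"
  define Y where "Y = y ^ q"
  have "frob_det D q x y 2 [0..<5] = 0 \<longleftrightarrow>
    1 + - (2 * Q) * y ^ q + - (2 * P) * x ^ q + Q ^ 2 * (y ^ q) ^ 2 + - (2 * (P * Q)) * (x ^ q * y ^ q) + P ^ 2 * (x ^ q) ^ 2 = 0"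
  proof (rule frob_det_conic[OF D2])
    show "1 + - (2 * Q) * y + - (2 * P) * x + Q ^ 2 * y ^ 2 + - (2 * (P * Q)) * (x * y) + P ^ 2 * x ^ 2 = 0"
      using P Q uv by Groebner_Basis.algebra
  qed (use const PQ in \<open>simp_all add: D1_const_simps del: One_nat_def\<close>)
  also have "\<dots> \<longleftrightarrow> (1 - P * X - Q * Y) ^ 2 = 4 * (P * X) * (Q * Y)"
    unfolding X_def[symmetric] Y_def[symmetric] by Groebner_Basis.algebra
  finally show ?thesis unfolding P_def Q_def X_def Y_def .
qed

text \<open>Only the term in \<open>y\<close> is a square root: Q y = v^2 = (1 - P x)^2.\<close>

lemma frob_det_1h:
  assumes D2: "D 2 y \<noteq> 0" and dvd: "p dvd n - 1" "p dvd 2 * m - 1"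
  shows "frob_det D q x y 2 [0..<5] = 0 \<longleftrightarrow>
    (\<iota> (b ^ 2) * y ^ (2 * m - 1)) * y ^ q = (1 - (\<iota> a * x ^ (n - 1)) * x ^ q) ^ 2"
proof -
  define P where "P = \<iota> a * x ^ (n - 1)"
  define Q where "Q = \<iota> (b ^ 2) * y ^ (2 * m - 1)"
  have const: "D 1 P = 0" "D 1 Q = 0" unfolding P_def Q_def by (intro D1_monomial dvd)+
  have P: "P * x = u" and Q: "Q * y = v ^ 2"
    using n2 m2 by (simp_all add: P_def Q_def u_def v_def i.hom_power power_mult_distrib mult_ac
       flip: power_add power_mult power_Suc power_Suc2)
  have v: "v = 1 - u" using uv by (simp add: eq_diff_eq add.commute)
  have PQ: "P \<noteq> 0" "Q \<noteq> 0" using x0 y0 a0 b0 by (simp_all add: P_def Q_def)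
  define X where "X = x ^ q"
  define Y where "Y = y ^ q"
  have "frob_det D q x y 2 [0..<5] = 0 \<longleftrightarrow>
    - 1 + Q * y ^ q + 2 * P * x ^ q + 0 * (y ^ q) ^ 2 + 0 * (x ^ q * y ^ q) + - (P ^ 2) * (x ^ q) ^ 2 = 0"
  proof (rule frob_det_conic[OF D2])
    show "- 1 + Q * y + 2 * P * x + 0 * y ^ 2 + 0 * (x * y) + - (P ^ 2) * x ^ 2 = 0"
      using Q unfolding v P[symmetric] by Groebner_Basis.algebra
  qed (use const PQ in \<open>simp_all add: D1_const_simps del: One_nat_def\<close>)
  also have "\<dots> \<longleftrightarrow> Q * Y = (1 - P * X) ^ 2"
    unfolding X_def[symmetric] Y_def[symmetric] by Groebner_Basis.algebra
  finally show ?thesis unfolding P_def Q_def X_def Y_def .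
qed

lemma frob_det_h1:
  assumes D2: "D 2 y \<noteq> 0" and dvd: "p dvd 2 * n - 1" "p dvd m - 1"
  shows "frob_det D q x y 2 [0..<5] = 0 \<longleftrightarrow>
    (\<iota> (a ^ 2) * x ^ (2 * n - 1)) * x ^ q = (1 - (\<iota> b * y ^ (m - 1)) * y ^ q) ^ 2"
proof -
  define P where "P = \<iota> (a ^ 2) * x ^ (2 * n - 1)"
  define Q where "Q = \<iota> b * y ^ (m - 1)"
  have const: "D 1 P = 0" "D 1 Q = 0" unfolding P_def Q_def by (intro D1_monomial dvd)+
  have P: "P * x = u ^ 2" and Q: "Q * y = v"
    using n2 m2 by (simp_all add: P_def Q_def u_def v_def i.hom_power power_mult_distrib mult_ac
       flip: power_add power_mult power_Suc power_Suc2)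
  have PQ: "P \<noteq> 0" "Q \<noteq> 0" using x0 y0 a0 b0 by (simp_all add: P_def Q_def)
  define X where "X = x ^ q"
  define Y where "Y = y ^ q"
  have "frob_det D q x y 2 [0..<5] = 0 \<longleftrightarrow>
    - 1 + 2 * Q * y ^ q + P * x ^ q + - (Q ^ 2) * (y ^ q) ^ 2 + 0 * (x ^ q * y ^ q) + 0 * (x ^ q) ^ 2 = 0"
  proof (rule frob_det_conic[OF D2])
    show "- 1 + 2 * Q * y + P * x + - (Q ^ 2) * y ^ 2 + 0 * (x * y) + 0 * x ^ 2 = 0"
      using P Q uv by Groebner_Basis.algebra
  qed (use const PQ in \<open>simp_all add: D1_const_simps del: One_nat_def\<close>)
  also have "\<dots> \<longleftrightarrow> P * X = (1 - Q * Y) ^ 2"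
    unfolding X_def[symmetric] Y_def[symmetric] by Groebner_Basis.algebra
  finally show ?thesis unfolding P_def Q_def X_def Y_def .
qed

text \<open>The curve reads P / x + Q / y = 1; clearing denominators gives a conic without constant
  term.\<close>

lemma frob_det_mm:
  assumes D2: "D 2 y \<noteq> 0" and dvd: "p dvd n + 1" "p dvd m + 1"
  shows "frob_det D q x y 2 [0..<5] = 0 \<longleftrightarrow>
    (\<iota> a * x ^ (n + 1)) * y ^ q + (\<iota> b * y ^ (m + 1)) * x ^ q = x ^ q * y ^ q"
proof -
  define P where "P = \<iota> a * x ^ (n + 1)"
  define Q where "Q = \<iota> b * y ^ (m + 1)"
  have const: "D 1 P = 0" "D 1 Q = 0" unfolding P_def Q_def by (intro D1_monomial dvd)+
  have P: "P = u * x" and Q: "Q = v * y"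
    using n2 m2 by (simp_all add: P_def Q_def u_def v_def i.hom_power power_mult_distrib mult_ac
       flip: power_add power_mult power_Suc power_Suc2)
  have PQ: "P \<noteq> 0" "Q \<noteq> 0" using x0 y0 a0 b0 by (simp_all add: P_def Q_def)
  define X where "X = x ^ q"
  define Y where "Y = y ^ q"
  have "frob_det D q x y 2 [0..<5] = 0 \<longleftrightarrow>
    0 + P * y ^ q + Q * x ^ q + 0 * (y ^ q) ^ 2 + - 1 * (x ^ q * y ^ q) + 0 * (x ^ q) ^ 2 = 0"
  proof (rule frob_det_conic[OF D2])
    show "0 + P * y + Q * x + 0 * y ^ 2 + - 1 * (x * y) + 0 * x ^ 2 = 0"
      using P Q uv by Groebner_Basis.algebra
  qed (use const PQ in \<open>simp_all add: D1_const_simps del: One_nat_def\<close>)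
  also have "\<dots> \<longleftrightarrow> P * Y + Q * X = X * Y"
    unfolding X_def[symmetric] Y_def[symmetric] by Groebner_Basis.algebra
  finally show ?thesis unfolding P_def Q_def X_def Y_def .
qed

lemma frob_det_1m:
  assumes D2: "D 2 y \<noteq> 0" and dvd: "p dvd n - 1" "p dvd m + 1"
  shows "frob_det D q x y 2 [0..<5] = 0 \<longleftrightarrow>
    (\<iota> a * x ^ (n - 1)) * x ^ q * y ^ q + (\<iota> b * y ^ (m + 1)) = y ^ q"
proof -
  define P where "P = \<iota> a * x ^ (n - 1)"
  define Q where "Q = \<iota> b * y ^ (m + 1)"
  have const: "D 1 P = 0" "D 1 Q = 0" unfolding P_def Q_def by (intro D1_monomial dvd)+
  have P: "P * x = u" and Q: "Q = v * y"
    using n2 m2 by (simp_all add: P_def Q_def u_def v_def i.hom_power power_mult_distrib mult_ac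
       flip: power_add power_mult power_Suc power_Suc2)
  have v: "v = 1 - u" using uv by (simp add: eq_diff_eq add.commute)
  have PQ: "P \<noteq> 0" "Q \<noteq> 0" using x0 y0 a0 b0 by (simp_all add: P_def Q_def)
  define X where "X = x ^ q"
  define Y where "Y = y ^ q"
  have "frob_det D q x y 2 [0..<5] = 0 \<longleftrightarrow>
    Q + - 1 * y ^ q + 0 * x ^ q + 0 * (y ^ q) ^ 2 + P * (x ^ q * y ^ q) + 0 * (x ^ q) ^ 2 = 0"
  proof (rule frob_det_conic[OF D2])
    show "Q + - 1 * y + 0 * x + 0 * y ^ 2 + P * (x * y) + 0 * x ^ 2 = 0"
      using Q unfolding v P[symmetric] by Groebner_Basis.algebra
  qed (use const PQ in \<open>simp_all add: D1_const_simps del: One_nat_def\<close>)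
  also have "\<dots> \<longleftrightarrow> P * X * Y + Q = Y"
    unfolding X_def[symmetric] Y_def[symmetric] by Groebner_Basis.algebra
  finally show ?thesis unfolding P_def Q_def X_def Y_def .
qed

lemma frob_det_m1:
  assumes D2: "D 2 y \<noteq> 0" and dvd: "p dvd n + 1" "p dvd m - 1"
  shows "frob_det D q x y 2 [0..<5] = 0 \<longleftrightarrow>
    (\<iota> a * x ^ (n + 1)) + (\<iota> b * y ^ (m - 1)) * x ^ q * y ^ q = x ^ q"
proof -
  define P where "P = \<iota> a * x ^ (n + 1)"
  define Q where "Q = \<iota> b * y ^ (m - 1)"
  have const: "D 1 P = 0" "D 1 Q = 0" unfolding P_def Q_def by (intro D1_monomial dvd)+
  have P: "P = u * x" and Q: "Q * y = v"
    using n2 m2 by (simp_all add: P_def Q_def u_def v_def i.hom_power power_mult_distrib mult_ac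
       flip: power_add power_mult power_Suc power_Suc2)
  have PQ: "P \<noteq> 0" "Q \<noteq> 0" using x0 y0 a0 b0 by (simp_all add: P_def Q_def)
  define X where "X = x ^ q"
  define Y where "Y = y ^ q"
  have "frob_det D q x y 2 [0..<5] = 0 \<longleftrightarrow>
    P + 0 * y ^ q + - 1 * x ^ q + 0 * (y ^ q) ^ 2 + Q * (x ^ q * y ^ q) + 0 * (x ^ q) ^ 2 = 0"
  proof (rule frob_det_conic[OF D2])
    show "P + 0 * y + - 1 * x + 0 * y ^ 2 + Q * (x * y) + 0 * x ^ 2 = 0"
      using P Q uv by Groebner_Basis.algebra
  qed (use const PQ in \<open>simp_all add: D1_const_simps del: One_nat_def\<close>)
  also have "\<dots> \<longleftrightarrow> P + Q * X * Y = X"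
    unfolding X_def[symmetric] Y_def[symmetric] by Groebner_Basis.algebra
  finally show ?thesis unfolding P_def Q_def X_def Y_def .
qed

end

section \<open>Frobenius nonclassical curves\<close>

text \<open>Reducing \<open>h\<close> modulo \<open>r\<close> to t gives p^r - 1 dividing 2 (p^t -
  1). The factor 2 does no harm for p > 2, since 2 p^t < p^(t + 1) \<le> p^r.\<close>

lemma power_minus_1_dvd:
  fixes p :: nat
  assumes p: "p > 2" and r: "r > 0" and dvd: "p ^ r - 1 dvd 2 * (p ^ h - 1)"
  shows "r dvd h"
proof (rule ccontr)
  assume "\<not> r dvd h"
  define t where "t = h mod r"
  define s where "s = h div r"
  have t: "t > 0" "t < r" using r \<open>\<not> r dvd h\<close> by (auto simp: t_def mod_greater_zero_iff_not_dvd)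
  have h: "h = r * s + t" by (simp add: s_def t_def)
  have pos: "p ^ j \<ge> 1" for j using p by simp
  have d: "int (p ^ j - 1) = int p ^ j - 1" for j using pos[of j] by (simp add: of_nat_diff)
  have "int (p ^ r - 1) dvd int (2 * (p ^ h - 1))" using dvd by (simp only: int_dvd_int_iff)
  hence "int p ^ r - 1 dvd 2 * (int p ^ h - 1)" by (simp only: of_nat_mult d) simp
  moreover have "int p ^ r - 1 dvd 2 * int p ^ t * ((int p ^ r) ^ s - 1)"
    by (simp add: power_diff_1_eq)
  ultimately have "int p ^ r - 1 dvd 2 * (int p ^ h - 1) - 2 * int p ^ t * ((int p ^ r) ^ s - 1)"
    by (rule dvd_diff)
  also have "2 * (int p ^ h - 1) - 2 * int p ^ t * ((int p ^ r) ^ s - 1) = 2 * (int p ^ t - 1)"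
    by (simp add: h power_add power_mult algebra_simps)
  finally have "int p ^ r - 1 dvd 2 * (int p ^ t - 1)" .
  moreover have "2 * (int p ^ t - 1) > 0" using p t(1) by (simp add: one_less_power)
  ultimately have "int p ^ r - 1 \<le> 2 * (int p ^ t - 1)" by (rule zdvd_imp_le)
  moreover have "2 * int p ^ t < int p ^ r"
  proof -
    have "2 * int p ^ t < int p * int p ^ t" using p by (intro mult_strict_right_mono) auto
    also have "\<dots> = int p ^ Suc t" by simp
    also have "\<dots> \<le> int p ^ r" using p t(2) by (intro power_increasing) auto
    finally show ?thesis .
  qed
  ultimately show False by simp
qed

text \<open>Common arithmetic of the cases, with \<open>c\<close> equal to \<open>n\<close> or 2 n
  and \<open>d\<close> equal to 1 or 2.\<close>

lemma exponent_bounds: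
  fixes p :: nat
  assumes p: "p > 2" and h: "h > 0" and eq: "c * (p ^ r - 1) = d * (p ^ h - 1)" and "c > d" "d > 0" "d dvd 2"
  shows "0 < r" "r < h" "r dvd h"
proof -
  have "p ^ h > 1" using p h by (intro one_less_power) auto
  hence "d * (p ^ h - 1) > 0" using assms by simp
  hence "p ^ r - 1 > 0" using eq by (metis mult_0_right neq0_conv)
  thus r: "0 < r" by (cases r) auto
  show "r < h"
  proof (rule ccontr)
    assume "\<not> r < h"
    hence "p ^ h - 1 \<le> p ^ r - 1" using p by (intro diff_le_mono power_increasing) auto
    hence "c * (p ^ h - 1) \<le> c * (p ^ r - 1)" by (intro mult_left_mono) auto
    moreover have "d * (p ^ h - 1) < c * (p ^ h - 1)"
      using assms \<open>p ^ h > 1\<close> by (intro mult_strict_right_mono) auto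
    ultimately have "d * (p ^ h - 1) < c * (p ^ r - 1)" by (rule less_le_trans[rotated])
    thus False using eq by simp
  qed
  obtain e where e: "2 = d * e" using \<open>d dvd 2\<close> by (auto simp: dvd_def)
  have "2 * (p ^ h - 1) = e * c * (p ^ r - 1)" unfolding e using eq by (simp add: mult_ac)
  hence "p ^ r - 1 dvd 2 * (p ^ h - 1)" by simp
  thus "r dvd h" by (rule power_minus_1_dvd[OF p r])
qed

context curve begin

lemma residue_dvd:
  "of_nat j = (2::'k) \<Longrightarrow> p dvd j - 2" "of_nat j = (1::'k) \<Longrightarrow> p dvd j - 1"
  "of_nat j = (- 1::'k) \<Longrightarrow> p dvd j + 1" "2 * of_nat j = (1::'k) \<Longrightarrow> p dvd 2 * j - 1"
proof -
  assume 2: "of_nat j = (2::'k)"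
  show "p dvd j - 2"
  proof (cases "j \<ge> 2")
    case True
    hence "of_nat (j - 2) = (0::'k)" using 2 by (simp add: of_nat_diff)
    thus ?thesis by (simp only: of_nat_k_eq_0_iff)
  qed simp
next
  assume 1: "of_nat j = (1::'k)"
  show "p dvd j - 1"
  proof (cases "j \<ge> 1")
    case True
    hence "of_nat (j - 1) = (0::'k)" using 1 by (simp add: of_nat_diff)
    thus ?thesis by (simp only: of_nat_k_eq_0_iff)
  qed simp
next
  assume "of_nat j = (- 1::'k)"
  hence "of_nat (j + 1) = (0::'k)" by simp
  thus "p dvd j + 1" by (simp only: of_nat_k_eq_0_iff)
next
  assume h: "2 * of_nat j = (1::'k)"
  show "p dvd 2 * j - 1"
  proof (cases "j \<ge> 1")
    case True
    hence "of_nat (2 * j - 1) = (0::'k)" using h by (simp add: of_nat_diff)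
    thus ?thesis by (simp only: of_nat_k_eq_0_iff)
  qed simp
qed

section \<open>Incidence equations at the points of the curve\<close>

lemma fermat_specialize:
  assumes "\<iota> a * x ^ A + \<iota> b * y ^ B = 1" and "a * X ^ n + b * Y ^ m = 1"
  shows "a * X ^ A + b * Y ^ B = 1"
  using specialize[of "[(a, A, 0), (b, 0, B), (- 1, 0, 0)]", OF _ assms(2)] assms(1)
  by (simp add: i.hom_uminus add_diff_eq)

lemma parabola_specialize:
  assumes eq: "(1 - \<iota> (a ^ 2) * x ^ A - \<iota> (b ^ 2) * y ^ B) ^ 2 = 4 * (\<iota> (a ^ 2) * x ^ A) * (\<iota> (b ^ 2) * y ^ B)"
    and pt: "a * X ^ n + b * Y ^ m = 1"
  shows "(1 - a ^ 2 * X ^ A - b ^ 2 * Y ^ B) ^ 2 = 4 * (a ^ 2 * X ^ A) * (b ^ 2 * Y ^ B)"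
proof -
  \<comment> \<open>The monomials of (1 - U - V)^2 - 4 U V; the mixed term is 2 U V - 4 U V.\<close>
  define l where "l = [(1, 0, 0), ((a ^ 2) ^ 2, 2 * A, 0), ((b ^ 2) ^ 2, 0, 2 * B), (- (2 * a ^ 2), A, 0),
    (- (2 * b ^ 2), 0, B), (- (2 * (a ^ 2 * b ^ 2)), A, B)]"
  have expand: "1 + (U ^ 2 + (V ^ 2 + (- (2 * U) + (- (2 * V) + - (2 * (U * V)))))) = (1 - U - V) ^ 2 - 4 * U * V"
    for U V :: "'c::idom" by (simp add: algebra_simps power2_eq_square)
  have "(\<Sum>(c, i, j)\<leftarrow>l. \<iota> c * x ^ i * y ^ j) =
      1 + ((\<iota> (a ^ 2) * x ^ A) ^ 2 + ((\<iota> (b ^ 2) * y ^ B) ^ 2 + (- (2 * (\<iota> (a ^ 2) * x ^ A))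
        + (- (2 * (\<iota> (b ^ 2) * y ^ B)) + - (2 * ((\<iota> (a ^ 2) * x ^ A) * (\<iota> (b ^ 2) * y ^ B)))))))"
    by (simp add: l_def i.hom_power i.hom_uminus i.hom_mult i.hom_numeral power_mult_distrib mult_ac power_mult[symmetric])
  also have "\<dots> = 0" unfolding expand using eq by simp
  finally have "(\<Sum>(c, i, j)\<leftarrow>l. c * X ^ i * Y ^ j) = 0" by (rule specialize[OF _ pt])
  moreover have "(\<Sum>(c, i, j)\<leftarrow>l. c * X ^ i * Y ^ j) =
      1 + ((a ^ 2 * X ^ A) ^ 2 + ((b ^ 2 * Y ^ B) ^ 2 + (- (2 * (a ^ 2 * X ^ A))
        + (- (2 * (b ^ 2 * Y ^ B)) + - (2 * ((a ^ 2 * X ^ A) * (b ^ 2 * Y ^ B)))))))"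
    by (simp add: l_def power_mult_distrib mult_ac power_mult[symmetric])
  ultimately show ?thesis unfolding expand by simp
qed

lemma square_specialize:
  assumes eq: "\<iota> (b ^ 2) * y ^ B = (1 - \<iota> a * x ^ A) ^ 2"
    and pt: "a * X ^ n + b * Y ^ m = 1"
  shows "b ^ 2 * Y ^ B = (1 - a * X ^ A) ^ 2"
proof -
  define l where "l = [(b ^ 2, 0, B), (- 1, 0, 0), (2 * a, A, 0), (- (a ^ 2), 2 * A, 0)]"
  have expand: "V + (- 1 + (2 * U + - (U ^ 2))) = V - (1 - U) ^ 2"
    for U V :: "'c::idom" by (simp add: algebra_simps power2_eq_square)
  have "(\<Sum>(c, i, j)\<leftarrow>l. \<iota> c * x ^ i * y ^ j) =
      \<iota> (b ^ 2) * y ^ B + (- 1 + (2 * (\<iota> a * x ^ A) + - ((\<iota> a * x ^ A) ^ 2)))"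
    by (simp add: l_def i.hom_power i.hom_uminus i.hom_mult i.hom_numeral power_mult_distrib mult_ac power_mult[symmetric])
  also have "\<dots> = 0" unfolding expand using eq by simp
  finally have "(\<Sum>(c, i, j)\<leftarrow>l. c * X ^ i * Y ^ j) = 0" by (rule specialize[OF _ pt])
  moreover have "(\<Sum>(c, i, j)\<leftarrow>l. c * X ^ i * Y ^ j) =
      b ^ 2 * Y ^ B + (- 1 + (2 * (a * X ^ A) + - ((a * X ^ A) ^ 2)))"
    by (simp add: l_def power_mult_distrib mult_ac power_mult[symmetric])
  ultimately show ?thesis unfolding expand by simp
qed

lemma square_specialize':
  assumes eq: "\<iota> (a ^ 2) * x ^ A = (1 - \<iota> b * y ^ B) ^ 2"
    and pt: "a * X ^ n + b * Y ^ m = 1"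
  shows "a ^ 2 * X ^ A = (1 - b * Y ^ B) ^ 2"
proof -
  define l where "l = [(a ^ 2, A, 0), (- 1, 0, 0), (2 * b, 0, B), (- (b ^ 2), 0, 2 * B)]"
  have expand: "V + (- 1 + (2 * U + - (U ^ 2))) = V - (1 - U) ^ 2"
    for U V :: "'c::idom" by (simp add: algebra_simps power2_eq_square)
  have "(\<Sum>(c, i, j)\<leftarrow>l. \<iota> c * x ^ i * y ^ j) =
      \<iota> (a ^ 2) * x ^ A + (- 1 + (2 * (\<iota> b * y ^ B) + - ((\<iota> b * y ^ B) ^ 2)))"
    by (simp add: l_def i.hom_power i.hom_uminus i.hom_mult i.hom_numeral power_mult_distrib mult_ac power_mult[symmetric])
  also have "\<dots> = 0" unfolding expand using eq by simp
  finally have "(\<Sum>(c, i, j)\<leftarrow>l. c * X ^ i * Y ^ j) = 0" by (rule specialize[OF _ pt])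
  moreover have "(\<Sum>(c, i, j)\<leftarrow>l. c * X ^ i * Y ^ j) =
      a ^ 2 * X ^ A + (- 1 + (2 * (b * Y ^ B) + - ((b * Y ^ B) ^ 2)))"
    by (simp add: l_def power_mult_distrib mult_ac power_mult[symmetric])
  ultimately show ?thesis unfolding expand by simp
qed

lemma nm_pos: "n > 0" "m > 0"
  using n2 m2 by simp_all

context
  fixes h q :: nat
  assumes h: "h > 0" and q: "q = p ^ h"
begin

lemma q1: "q > 1"
  unfolding q using h p5 by (intro one_less_power) auto

lemma p2: "p > 2"
  using p5 by simp

lemma mult_pred: "(k::nat) * (j - 1) = k * j - k"
  by (simp add: diff_mult_distrib2)

section \<open>Exponents and coefficients forced by incidence\<close>

lemma case_22:
  assumes eq: "\<iota> a * x ^ (n - 2) * (x ^ q) ^ 2 + \<iota> b * y ^ (m - 2) * (y ^ q) ^ 2 = 1"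
  shows "m = n \<and> (\<exists>r. r < h \<and> r dvd h \<and> n * (p ^ r - 1) = 2 * (q - 1) \<and> in_Fpr p r a \<and> in_Fpr p r b)"
proof -
  have "\<iota> a * x ^ (n - 2 + 2 * q) + \<iota> b * y ^ (m - 2 + 2 * q) = 1"
    using eq by (simp add: power_add mult.assoc mult.commute[of q] flip: power_mult)
  from fermat_specialize[OF this] obtain r where r: "n - 2 + 2 * q = n * p ^ r" "m - 2 + 2 * q = m * p ^ r"
    "a ^ p ^ r = a" "b ^ p ^ r = b"
    using q1 by (elim fermat_points[OF a0 b0 nm_pos pn pm]) auto
  have n: "n * (p ^ r - 1) = 2 * (q - 1)" and m: "m * (p ^ r - 1) = 2 * (q - 1)"
    unfolding mult_pred r(1,2)[symmetric] using n2 m2 q1 by auto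
  have "p ^ r - 1 \<noteq> 0" using n q1 by (intro notI) simp
  hence "n = m" using n m by (metis mult_right_cancel)
  thus ?thesis using exponent_bounds[OF p2 h n[unfolded q]] n2 n r by (auto simp: in_Fpr_def)
qed

text \<open>Only the ratio of the exponents is recorded: m = 2 n contradicts n \<ge> m in the
  classification.\<close>

lemma case_12:
  assumes eq: "\<iota> a * x ^ (n - 1) * x ^ q + \<iota> b * y ^ (m - 2) * (y ^ q) ^ 2 = 1"
  shows "m = 2 * n"
proof -
  have "\<iota> a * x ^ (n - 1 + q) + \<iota> b * y ^ (m - 2 + 2 * q) = 1"
    using eq by (simp add: power_add mult.assoc mult.commute[of q] flip: power_mult)
  from fermat_specialize[OF this] obtain r where r: "n - 1 + q = n * p ^ r" "m - 2 + 2 * q = m * p ^ r"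
    using q1 by (elim fermat_points[OF a0 b0 nm_pos pn pm]) auto
  have n: "n * (p ^ r - 1) = q - 1" and m: "m * (p ^ r - 1) = 2 * (q - 1)"
    unfolding mult_pred r(1,2)[symmetric] using n2 m2 q1 by auto
  have "p ^ r - 1 \<noteq> 0" using n q1 by (intro notI) simp
  moreover have "m * (p ^ r - 1) = 2 * n * (p ^ r - 1)" using n m by simp
  ultimately show ?thesis by (metis mult_right_cancel)
qed

lemma case_21:
  assumes eq: "\<iota> a * x ^ (n - 2) * (x ^ q) ^ 2 + \<iota> b * y ^ (m - 1) * y ^ q = 1"
  shows "n = 2 * m \<and> (\<exists>r. r < h \<and> r dvd h \<and> n * (p ^ r - 1) = 2 * (q - 1) \<and> in_Fpr p r a \<and> in_Fpr p r b)"
proof -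
  have "\<iota> a * x ^ (n - 2 + 2 * q) + \<iota> b * y ^ (m - 1 + q) = 1"
    using eq by (simp add: power_add mult.assoc mult.commute[of q] flip: power_mult)
  from fermat_specialize[OF this] obtain r where r: "n - 2 + 2 * q = n * p ^ r" "m - 1 + q = m * p ^ r"
    "a ^ p ^ r = a" "b ^ p ^ r = b"
    using q1 by (elim fermat_points[OF a0 b0 nm_pos pn pm]) auto
  have n: "n * (p ^ r - 1) = 2 * (q - 1)" and m: "m * (p ^ r - 1) = q - 1"
    unfolding mult_pred r(1,2)[symmetric] using n2 m2 q1 by auto
  have "p ^ r - 1 \<noteq> 0" using n q1 by (intro notI) simp
  moreover have "n * (p ^ r - 1) = 2 * m * (p ^ r - 1)" using n m by simp
  ultimately have "n = 2 * m" by (metis mult_right_cancel)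
  thus ?thesis using exponent_bounds[OF p2 h n[unfolded q]] n2 n r by (auto simp: in_Fpr_def)
qed

lemma case_hh:
  assumes eq: "(1 - \<iota> (a ^ 2) * x ^ (2 * n - 1) * x ^ q - \<iota> (b ^ 2) * y ^ (2 * m - 1) * y ^ q) ^ 2
    = 4 * (\<iota> (a ^ 2) * x ^ (2 * n - 1) * x ^ q) * (\<iota> (b ^ 2) * y ^ (2 * m - 1) * y ^ q)"
  shows "m = n \<and> (\<exists>r. r < h \<and> r dvd h \<and> 2 * (p ^ r - 1) * n = q - 1 \<and> in_Fpr p r (a ^ 2) \<and> in_Fpr p r (b ^ 2))"
proof -
  have "(1 - \<iota> (a ^ 2) * x ^ (2 * n - 1 + q) - \<iota> (b ^ 2) * y ^ (2 * m - 1 + q)) ^ 2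
    = 4 * (\<iota> (a ^ 2) * x ^ (2 * n - 1 + q)) * (\<iota> (b ^ 2) * y ^ (2 * m - 1 + q))"
    using eq by (simp only: power_add mult.assoc)
  from parabola_specialize[OF this] obtain r where r: "2 * n - 1 + q = n * (2 * p ^ r)" "2 * m - 1 + q = m * (2 * p ^ r)"
    "(a ^ 2) ^ p ^ r = a ^ 2" "(b ^ 2) ^ p ^ r = b ^ 2"
    using q1 by (elim parabola_points[OF a0 b0 nm_pos pn pm]) auto
  have "2 * n * (p ^ r - 1) = n * (2 * p ^ r) - 2 * n" "2 * m * (p ^ r - 1) = m * (2 * p ^ r) - 2 * m"
    unfolding mult_pred by simp_all
  hence n: "2 * n * (p ^ r - 1) = 1 * (q - 1)" and m: "2 * m * (p ^ r - 1) = 1 * (q - 1)"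
    unfolding r(1,2)[symmetric] using n2 m2 q1 by auto
  have "p ^ r - 1 \<noteq> 0" using n q1 by (intro notI) simp
  hence "2 * n = 2 * m" using n m by (metis mult_right_cancel)
  thus ?thesis using exponent_bounds[OF p2 h n[unfolded q]] n2 n r by (auto simp: in_Fpr_def mult_ac)
qed

lemma case_1h:
  assumes eq: "\<iota> (b ^ 2) * y ^ (2 * m - 1) * y ^ q = (1 - \<iota> a * x ^ (n - 1) * x ^ q) ^ 2"
    and bq: "in_Fpr p h b"
  shows "n = 2 * m \<and> (\<exists>r. r < h \<and> r dvd h \<and> n * (p ^ r - 1) = q - 1 \<and>
    ((in_Fpr p r a \<and> in_Fpr p r b) \<or>
      ((2 * r) dvd h \<and> in_Fpr p r a \<and> in_Fpr p (2 * r) b \<and> b ^ (p ^ r) = - b)))"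
proof -
  have "\<iota> (b ^ 2) * y ^ (2 * m - 1 + q) = (1 - \<iota> a * x ^ (n - 1 + q)) ^ 2"
    using eq by (simp only: power_add mult.assoc)
  from square_specialize[OF this] obtain r where r: "n - 1 + q = n * p ^ r" "2 * m - 1 + q = m * (2 * p ^ r)"
    "a ^ p ^ r = a" "(b ^ p ^ r) ^ 2 = b ^ 2"
    using q1 by (elim square_points[OF a0 b0 nm_pos pn pm]) auto
  have "2 * m * (p ^ r - 1) = m * (2 * p ^ r) - 2 * m" unfolding mult_pred by simp
  hence n: "n * (p ^ r - 1) = 1 * (q - 1)" and m: "2 * m * (p ^ r - 1) = 1 * (q - 1)"
    unfolding mult_pred[of n] r(1,2)[symmetric] using n2 m2 q1 by auto
  have "p ^ r - 1 \<noteq> 0" using n q1 by (intro notI) simp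
  hence nm: "n = 2 * m" using n m by (metis mult_right_cancel)
  note bd = exponent_bounds[OF p2 h n[unfolded q]]
  have rh: "r < h" "r dvd h" using bd n2 by auto
  have "b ^ p ^ r = b \<or> b ^ p ^ r = - b" using r(4) by (simp add: power2_eq_iff)
  moreover have "(2 * r) dvd h \<and> in_Fpr p (2 * r) b" if neg: "b ^ p ^ r = - b"
  proof
    show "in_Fpr p (2 * r) b"
      unfolding in_Fpr_def by (simp add: mult_2 power_add power_mult neg frob_uminus)
    obtain s where s: "h = r * s" using rh by (auto simp: dvd_def)
    \<comment> \<open>Each application of the p^r-power map changes the sign of \<open>b\<close>. As
      h = r s and \<open>b\<close> is fixed by the p^h-power map, s must be even.\<close>
    have iter: "b ^ p ^ (r * j) = (- 1) ^ j * b" for j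
    proof (induction j)
      case (Suc j)
      have "b ^ p ^ (r * Suc j) = (b ^ p ^ (r * j)) ^ p ^ r" by (simp add: power_add mult.commute flip: power_mult)
      also have "\<dots> = ((- 1) ^ p ^ r) ^ j * b ^ p ^ r"
        unfolding Suc by (simp add: power_mult_distrib mult.commute flip: power_mult)
      also have "(- 1 :: 'k) ^ p ^ r = - 1" using frob_uminus[of 1 r] by simp
      finally show ?case by (simp add: neg)
    qed simp
    have "(- 1) ^ s * b = b" using bq iter[of s] by (simp add: in_Fpr_def s)
    hence "even s" using b0 two_k by (cases "even s") (auto simp: eq_neg_iff_add_eq_0 simp flip: mult_2)
    thus "(2 * r) dvd h" using s by (auto simp: mult_ac)
  qed
  ultimately show ?thesis using rh nm n r(3) by (auto simp: in_Fpr_def)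
qed

lemma case_h1:
  assumes eq: "\<iota> (a ^ 2) * x ^ (2 * n - 1) * x ^ q = (1 - \<iota> b * y ^ (m - 1) * y ^ q) ^ 2"
  shows "m = 2 * n"
proof -
  have "\<iota> (a ^ 2) * x ^ (2 * n - 1 + q) = (1 - \<iota> b * y ^ (m - 1 + q)) ^ 2"
    using eq by (simp only: power_add mult.assoc)
  hence H: "a ^ 2 * X ^ (2 * n - 1 + q) = (1 - b * Y ^ (m - 1 + q)) ^ 2" if "b * Y ^ m + a * X ^ n = 1" for X Y
    using square_specialize' that by (simp add: add.commute)
  obtain r where r: "m - 1 + q = m * p ^ r" "2 * n - 1 + q = n * (2 * p ^ r)"
    by (rule square_points[OF b0 a0 nm_pos(2,1) pm pn H]) (use q1 in auto)
  have "2 * n * (p ^ r - 1) = n * (2 * p ^ r) - 2 * n" unfolding mult_pred by simp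
  hence n: "2 * n * (p ^ r - 1) = 1 * (q - 1)" and m: "m * (p ^ r - 1) = 1 * (q - 1)"
    unfolding mult_pred[of m] r(1,2)[symmetric] using n2 m2 q1 by auto
  have "p ^ r - 1 \<noteq> 0" using n q1 by (intro notI) simp
  thus ?thesis using n m by (metis mult_right_cancel)
qed

lemma case_mm:
  assumes eq: "\<iota> a * x ^ (n + 1) * y ^ q + \<iota> b * y ^ (m + 1) * x ^ q = x ^ q * y ^ q"
  shows "q = n + 1 \<and> q = m + 1 \<and> a + b = 1"
proof (rule hyperbola_points[OF a0 b0 nm_pos pn pm _ q1])
  fix X Y assume "a * X ^ n + b * Y ^ m = 1"
  from specialize[of "[(a, n + 1, q), (b, q, m + 1), (- 1, q, q)]", OF _ this] eq
  show "a * X ^ (n + 1) * Y ^ q + b * Y ^ (m + 1) * X ^ q = X ^ q * Y ^ q"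
    by (simp add: i.hom_uminus mult_ac add_diff_eq)
qed

lemma case_1m:
  assumes eq: "\<iota> a * x ^ (n - 1) * x ^ q * y ^ q + \<iota> b * y ^ (m + 1) = y ^ q"
  shows False
proof (rule parabola_points_impossible[OF a0 b0 nm_pos pn pm _ q1])
  fix X Y assume "a * X ^ n + b * Y ^ m = 1"
  from specialize[of "[(a, n - 1 + q, q), (b, 0, m + 1), (- 1, 0, q)]", OF _ this] eq
  show "a * X ^ (n - 1) * X ^ q * Y ^ q + b * Y ^ (m + 1) = Y ^ q"
    by (simp add: i.hom_uminus power_add mult_ac add_diff_eq)
qed

lemma case_m1:
  assumes eq: "\<iota> a * x ^ (n + 1) + \<iota> b * y ^ (m - 1) * x ^ q * y ^ q = x ^ q"
  shows False
proof (rule parabola_points_impossible[OF b0 a0 nm_pos(2,1) pm pn _ q1])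
  fix Y X assume "b * Y ^ m + a * X ^ n = 1"
  hence "a * X ^ n + b * Y ^ m = 1" by (simp add: add.commute)
  from specialize[of "[(a, n + 1, 0), (b, q, m - 1 + q), (- 1, q, 0)]", OF _ this] eq
  have "a * X ^ (n + 1) + b * Y ^ (m - 1) * X ^ q * Y ^ q = X ^ q"
    by (simp add: i.hom_uminus power_add mult_ac add_diff_eq)
  thus "b * Y ^ (m - 1) * Y ^ q * X ^ q + a * X ^ (n + 1) = X ^ q"
    by (simp add: add.commute mult_ac)
qed

section \<open>The listed curves satisfy the incidence equations\<close>

lemma frob_f: "(z1 + z2 :: 'f) ^ p ^ r = z1 ^ p ^ r + z2 ^ p ^ r"
  using char_f prime_p by (intro freshmans_dream'[where n = r]) auto

lemma frob_uv: "u ^ p ^ r + v ^ p ^ r = 1"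
  using frob_f[of u v r] uv by simp

lemma u_power: "c = a ^ N \<Longrightarrow> \<iota> c * x ^ (n * N) = u ^ N" and v_power: "c = b ^ N \<Longrightarrow> \<iota> c * y ^ (m * N) = v ^ N"
  by (simp_all add: u_def v_def i.hom_power power_mult_distrib power_mult)

lemma exponent_sum:
  assumes "(k::nat) * (p ^ r - 1) = j"
  shows "k * p ^ r = k + j"
proof -
  have "p ^ r = Suc (p ^ r - 1)" using p5 by simp
  hence "k * p ^ r = k * Suc (p ^ r - 1)" by metis
  thus ?thesis using assms by simp
qed

text \<open>The relation between \<open>n\<close>, \<open>r\<close> and \<open>q\<close> makes the
  two monomials equal to the p^r-th powers of u and v, whose sum is the p^r-th power of u + v =
  1.\<close>

lemma conv_22:
  assumes D2: "D 2 y \<noteq> 0" and d: "p dvd n - 2" and e: "m = n" "n * (p ^ r - 1) = 2 * (q - 1)"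
    and F: "in_Fpr p r a" "in_Fpr p r b"
  shows "frob_det D q x y 2 [0..<5] = 0"
proof -
  have s: "n * p ^ r = n - 2 + 2 * q" using exponent_sum[OF e(2)] n2 q1 by simp
  have "\<iota> a * x ^ (n * p ^ r) = u ^ p ^ r" "\<iota> b * y ^ (m * p ^ r) = v ^ p ^ r"
    using u_power[of a "p ^ r"] v_power[of b "p ^ r"] F by (simp_all add: in_Fpr_def)
  hence 1: "\<iota> a * x ^ (n - 2) * (x ^ q) ^ 2 = u ^ p ^ r" "\<iota> b * y ^ (m - 2) * (y ^ q) ^ 2 = v ^ p ^ r"
    unfolding e(1) s by (simp_all add: power_add mult.assoc mult.commute[of q] flip: power_mult)
  have "p dvd m - 2" using d e(1) by simp
  show ?thesis unfolding frob_det_22[OF D2 d \<open>p dvd m - 2\<close>] 1 by (rule frob_uv)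
qed

lemma conv_hh:
  assumes D2: "D 2 y \<noteq> 0" and d: "p dvd 2 * n - 1" and e: "m = n" "2 * (p ^ r - 1) * n = q - 1"
    and F: "in_Fpr p r (a ^ 2)" "in_Fpr p r (b ^ 2)"
  shows "frob_det D q x y 2 [0..<5] = 0"
proof -
  have "2 * n * (p ^ r - 1) = q - 1" using e(2) by (simp add: mult_ac)
  hence s: "n * (2 * p ^ r) = 2 * n - 1 + q" using exponent_sum[of "2 * n" r "q - 1"] n2 q1 by simp
  hence t: "m * (2 * p ^ r) = 2 * m - 1 + q" by (simp add: e(1))
  define U where "U = u ^ p ^ r"
  define V where "V = v ^ p ^ r"
  have "a ^ 2 = a ^ (2 * p ^ r)" "b ^ 2 = b ^ (2 * p ^ r)" using F by (simp_all add: in_Fpr_def power_mult)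
  from u_power[OF this(1)] v_power[OF this(2)]
  have "\<iota> (a ^ 2) * x ^ (2 * n - 1 + q) = U ^ 2" "\<iota> (b ^ 2) * y ^ (2 * m - 1 + q) = V ^ 2"
    unfolding s t by (simp_all add: U_def V_def mult.commute flip: power_mult)
  hence UV: "\<iota> (a ^ 2) * x ^ (2 * n - 1) * x ^ q = U ^ 2" "\<iota> (b ^ 2) * y ^ (2 * m - 1) * y ^ q = V ^ 2"
    by (simp_all add: power_add mult.assoc)
  have "U + V = 1" by (simp add: U_def V_def frob_uv)
  hence sq: "(1 - U ^ 2 - V ^ 2) ^ 2 = 4 * U ^ 2 * V ^ 2" by Groebner_Basis.algebra
  have "p dvd 2 * m - 1" using d e(1) by simp
  show ?thesis unfolding frob_det_hh[OF D2 d \<open>p dvd 2 * m - 1\<close>] UV by (rule sq)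
qed

lemma conv_mm:
  assumes D2: "D 2 y \<noteq> 0" and d: "p dvd n + 1" and e: "q = n + 1" "q = m + 1" "a + b = 1"
  shows "frob_det D q x y 2 [0..<5] = 0"
proof -
  have "p dvd m + 1" using d e by simp
  have "\<iota> a * x ^ q * y ^ q + \<iota> b * y ^ q * x ^ q = \<iota> (a + b) * (x ^ q * y ^ q)"
    by (simp add: i.hom_add algebra_simps)
  thus ?thesis
    unfolding frob_det_mm[OF D2 d \<open>p dvd m + 1\<close>] e(1)[symmetric] e(2)[symmetric] by (simp add: e(3))
qed

text \<open>Only b^2 enters, so both signs in b^(p^r) = \<plusminus> b lead to V^2 = (1 -
  U)^2.\<close>

lemma conv_1h:
  assumes D2: "D 2 y \<noteq> 0" and d: "p dvd n - 1" and e: "n = 2 * m" "n * (p ^ r - 1) = q - 1"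
    and F: "in_Fpr p r a" and b2: "b ^ p ^ r = b \<or> b ^ p ^ r = - b"
  shows "frob_det D q x y 2 [0..<5] = 0"
proof -
  have s: "n * p ^ r = n - 1 + q" using exponent_sum[OF e(2)] n2 q1 by simp
  define U where "U = u ^ p ^ r"
  define V where "V = v ^ p ^ r"
  have "\<iota> a * x ^ (n * p ^ r) = U" using u_power[of a "p ^ r"] F by (simp add: in_Fpr_def U_def)
  hence 1: "\<iota> a * x ^ (n - 1) * x ^ q = U" unfolding s by (simp add: power_add mult.assoc)
  have "b ^ 2 = (b ^ p ^ r) ^ 2" using b2 by auto
  hence "b ^ 2 = b ^ (2 * p ^ r)" by (simp add: mult.commute flip: power_mult)
  from v_power[OF this] have "\<iota> (b ^ 2) * y ^ (m * (2 * p ^ r)) = V ^ 2"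
    by (simp add: V_def mult.commute flip: power_mult)
  moreover have "m * (2 * p ^ r) = 2 * m - 1 + q" using s e(1) by simp
  ultimately have 2: "\<iota> (b ^ 2) * y ^ (2 * m - 1) * y ^ q = V ^ 2" by (simp add: power_add mult.assoc)
  have "U + V = 1" by (simp add: U_def V_def frob_uv)
  hence sq: "V ^ 2 = (1 - U) ^ 2" by (simp flip: \<open>U + V = 1\<close>)
  have "p dvd 2 * m - 1" using d e(1) by simp
  show ?thesis unfolding frob_det_1h[OF D2 d \<open>p dvd 2 * m - 1\<close>] 1 2 by (rule sq)
qed

lemma conv_21:
  assumes D2: "D 2 y \<noteq> 0" and d: "p dvd n - 2" and e: "n = 2 * m" "n * (p ^ r - 1) = 2 * (q - 1)"
    and F: "in_Fpr p r a" "in_Fpr p r b"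
  shows "frob_det D q x y 2 [0..<5] = 0"
proof -
  have s: "n * p ^ r = n - 2 + 2 * q" using exponent_sum[OF e(2)] n2 q1 by simp
  have "m * (p ^ r - 1) = q - 1" using e by simp
  hence t: "m * p ^ r = m - 1 + q" using exponent_sum[of m r "q - 1"] m2 q1 by simp
  have "\<iota> a * x ^ (n * p ^ r) = u ^ p ^ r" "\<iota> b * y ^ (m * p ^ r) = v ^ p ^ r"
    using u_power[of a "p ^ r"] v_power[of b "p ^ r"] F by (simp_all add: in_Fpr_def)
  hence 1: "\<iota> a * x ^ (n - 2) * (x ^ q) ^ 2 = u ^ p ^ r" "\<iota> b * y ^ (m - 1) * y ^ q = v ^ p ^ r"
    unfolding s t by (simp_all add: power_add mult.assoc mult.commute[of q] flip: power_mult)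
  have "2 * (m - 1) = n - 2" using e(1) by simp
  hence "p dvd 2 * (m - 1)" using d by simp
  hence "p dvd m - 1" using prime_p p5 by (auto simp: prime_dvd_mult_iff dest: dvd_imp_le)
  show ?thesis unfolding frob_det_21[OF D2 d \<open>p dvd m - 1\<close>] 1 by (rule frob_uv)
qed

text \<open>Classicality for lines excludes n = m = 1 modulo \<open>p\<close> by way of D 2 y. Of
  the nine residue classes five give the listed families, two are excluded by n \<ge> m and two
  contain no solution.\<close>

lemma frobenius_conic_iff:
  assumes nm: "n \<ge> m" and cl: "classical_wrt D x y 1" and bq: "in_Fpr p h b"
  shows "frob_nonclassical_wrt D q x y 2 \<longleftrightarrow>
    ((p dvd (n - 2) \<and> m = n \<and>
        (\<exists>r. r < h \<and> r dvd h \<and> n * (p ^ r - 1) = 2 * (q - 1) \<and> in_Fpr p r a \<and> in_Fpr p r b))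
   \<or> (p dvd (2 * n - 1) \<and> m = n \<and>
        (\<exists>r. r < h \<and> r dvd h \<and> 2 * (p ^ r - 1) * n = q - 1 \<and>
             in_Fpr p r (a ^ 2) \<and> in_Fpr p r (b ^ 2)))
   \<or> (p dvd (n + 1) \<and> q = n + 1 \<and> q = m + 1 \<and> a + b = 1)
   \<or> (p dvd (n - 1) \<and> n = 2 * m \<and>
        (\<exists>r. r < h \<and> r dvd h \<and> n * (p ^ r - 1) = q - 1 \<and>
             ((in_Fpr p r a \<and> in_Fpr p r b) \<or>
              ((2 * r) dvd h \<and> in_Fpr p r a \<and> in_Fpr p (2 * r) b \<and> b ^ (p ^ r) = - b))))
   \<or> (p dvd (n - 2) \<and> n = 2 * m \<and>
        (\<exists>r. r < h \<and> r dvd h \<and> n * (p ^ r - 1) = 2 * (q - 1) \<and> in_Fpr p r a \<and> in_Fpr p r b)))"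
    (is "_ \<longleftrightarrow> ?A \<or> ?B \<or> ?C \<or> ?D \<or> ?E")
proof -
  have D2: "D 2 y \<noteq> 0" by (rule D2_y_if_classical[OF cl])
  show ?thesis
    unfolding frob_nonclassical_iff
  proof
    assume fd: "frob_det D q x y 2 [0..<5] = 0"
    have "osc (x ^ q) (y ^ q) = 0" by (rule osc_eq_0_if_frob_det[OF D2 fd])
    hence "D 2 y ^ 2 * D 5 y - 3 * D 2 y * D 3 y * D 4 y + 2 * D 3 y ^ 3 = 0"
      unfolding q by (rule monge[OF D2 _ h])
    note res = residues[OF D2 this]
    show "?A \<or> ?B \<or> ?C \<or> ?D \<or> ?E"
      using res
    proof (elim disjE conjE)
      assume r: "N\<^sub>k = 2" "M\<^sub>k = 2"
      note d = residue_dvd(1)[OF r(1)] residue_dvd(1)[OF r(2)]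
      note eq = iffD1[OF frob_det_22[OF D2 d] fd]
      have "?A" by (rule conjI[OF d(1) case_22[OF eq]])
      thus ?thesis by (rule disjI1)
    next
      assume r: "2 * N\<^sub>k = 1" "2 * M\<^sub>k = 1"
      note d = residue_dvd(4)[OF r(1)] residue_dvd(4)[OF r(2)]
      note eq = iffD1[OF frob_det_hh[OF D2 d] fd]
      have "?B" by (rule conjI[OF d(1) case_hh[OF eq]])
      thus ?thesis by (rule disjI2[OF disjI1])
    next
      assume r: "N\<^sub>k = - 1" "M\<^sub>k = - 1"
      note d = residue_dvd(3)[OF r(1)] residue_dvd(3)[OF r(2)]
      note eq = iffD1[OF frob_det_mm[OF D2 d] fd]
      have "?C" by (rule conjI[OF d(1) case_mm[OF eq]])
      thus ?thesis by (rule disjI2[OF disjI2[OF disjI1]])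
    next
      assume r: "N\<^sub>k = 1" "2 * M\<^sub>k = 1"
      note d = residue_dvd(2)[OF r(1)] residue_dvd(4)[OF r(2)]
      note eq = iffD1[OF frob_det_1h[OF D2 d] fd]
      have "?D" by (rule conjI[OF d(1) case_1h[OF eq bq]])
      thus ?thesis by (rule disjI2[OF disjI2[OF disjI2[OF disjI1]]])
    next
      assume r: "N\<^sub>k = 2" "M\<^sub>k = 1"
      note d = residue_dvd(1)[OF r(1)] residue_dvd(2)[OF r(2)]
      note eq = iffD1[OF frob_det_21[OF D2 d] fd]
      have "?E" by (rule conjI[OF d(1) case_21[OF eq]])
      thus ?thesis by (rule disjI2[OF disjI2[OF disjI2[OF disjI2]]])
    next
      assume r: "N\<^sub>k = 1" "M\<^sub>k = 2"
      note d = residue_dvd(2)[OF r(1)] residue_dvd(1)[OF r(2)]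
      note eq = iffD1[OF frob_det_12[OF D2 d] fd]
      show ?thesis using case_12[OF eq] nm n2 by simp
    next
      assume r: "2 * N\<^sub>k = 1" "M\<^sub>k = 1"
      note d = residue_dvd(4)[OF r(1)] residue_dvd(2)[OF r(2)]
      note eq = iffD1[OF frob_det_h1[OF D2 d] fd]
      show ?thesis using case_h1[OF eq] nm n2 by simp
    next
      assume r: "N\<^sub>k = 1" "M\<^sub>k = - 1"
      note d = residue_dvd(2)[OF r(1)] residue_dvd(3)[OF r(2)]
      note eq = iffD1[OF frob_det_1m[OF D2 d] fd]
      show ?thesis using case_1m[OF eq] ..
    next
      assume r: "N\<^sub>k = - 1" "M\<^sub>k = 1"
      note d = residue_dvd(3)[OF r(1)] residue_dvd(2)[OF r(2)]
      note eq = iffD1[OF frob_det_m1[OF D2 d] fd]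
      show ?thesis using case_m1[OF eq] ..
    qed
  next
    assume "?A \<or> ?B \<or> ?C \<or> ?D \<or> ?E"
    thus "frob_det D q x y 2 [0..<5] = 0"
    proof (elim disjE exE conjE, goal_cases)
      case (1 r) thus ?case by (intro conv_22[OF D2])
    next
      case (2 r) thus ?case by (intro conv_hh[OF D2])
    next
      case 3 thus ?case by (intro conv_mm[OF D2])
    next
      case (4 r)
      moreover from this have "b ^ p ^ r = b" by (simp add: in_Fpr_def)
      ultimately show ?case by (intro conv_1h[OF D2 _ _ _ _ disjI1])
    next
      case (5 r) thus ?case by (intro conv_1h[OF D2 _ _ _ _ disjI2])
    next
      case (6 r) thus ?case by (intro conv_21[OF D2])
    qed
  qed
qed

end
end

text \<open>The quotients that define \<open>n\<close> are written as products, which avoids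
  division of naturals; since q > 1, each such equation also forces r > 0.\<close>

theorem theorem3p18:
  fixes p h q n m :: nat and a b :: "'k::field" and \<iota> :: "'k \<Rightarrow> 'f::field" and x y :: 'f
  assumes "prime p" and "p > 5" and "h > 0" and "q = p ^ h"
    and "is_alg_closure_Fp p TYPE('k)"
    and "a \<noteq> 0" and "b \<noteq> 0" and "in_Fpr p h a" and "in_Fpr p h b"
    and "n \<ge> m" and "m > 2" and "\<not> p dvd (m * n)"
    and "is_curve_function_field \<iota> x y a b n m"
    and "classical_wrt (hasse \<iota> x) x y 1"
  shows "frob_nonclassical_wrt (hasse \<iota> x) q x y 2 \<longleftrightarrow>
    ((p dvd (n - 2) \<and> m = n \<and>
        (\<exists>r. r < h \<and> r dvd h \<and> n * (p ^ r - 1) = 2 * (q - 1) \<and> in_Fpr p r a \<and> in_Fpr p r b))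
   \<or> (p dvd (2 * n - 1) \<and> m = n \<and>
        (\<exists>r. r < h \<and> r dvd h \<and> 2 * (p ^ r - 1) * n = q - 1 \<and>
             in_Fpr p r (a ^ 2) \<and> in_Fpr p r (b ^ 2)))
   \<or> (p dvd (n + 1) \<and> q = n + 1 \<and> q = m + 1 \<and> a + b = 1)
   \<or> (p dvd (n - 1) \<and> n = 2 * m \<and>
        (\<exists>r. r < h \<and> r dvd h \<and> n * (p ^ r - 1) = q - 1 \<and>
             ((in_Fpr p r a \<and> in_Fpr p r b) \<or>
              ((2 * r) dvd h \<and> in_Fpr p r a \<and> in_Fpr p (2 * r) b \<and> b ^ (p ^ r) = - b))))
   \<or> (p dvd (n - 2) \<and> n = 2 * m \<and>
        (\<exists>r. r < h \<and> r dvd h \<and> n * (p ^ r - 1) = 2 * (q - 1) \<and> in_Fpr p r a \<and> in_Fpr p r b)))"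
proof -
  have alg: "of_nat p = (0::'k)" "alg_closed_field TYPE('k)"
    using assms(5) by (simp_all add: is_alg_closure_Fp_def)
  have "\<not> p dvd n" "\<not> p dvd m" using assms(12) by (auto simp: dvd_mult dvd_mult2)
  then interpret curve p "TYPE('k)" n m a b \<iota> x y
    using assms alg by unfold_locales auto
  show ?thesis by (rule frobenius_conic_iff) (use assms in auto)
qed

end
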